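(* Let $\mathcal{M}$ and $\mathcal{M}'$ be preadditive monoidal categories with equalizers. Assume that the tensor functors are additive and preserve equalizers in both categories. Let $(F,\phi_0,\phi_2):\mathcal{M}\to\mathcal{M}'$ be a monoidal functor which preserves equalizers. Then the square formed by $\mathrm{BrBialg}F$, $\mathrm{Br}F$, $P_{\mathrm{Br}}$ and $P'_{\mathrm{Br}}$ commutes, that is $$P'_{\mathrm{Br}}\circ\mathrm{BrBialg}F=\mathrm{Br}F\circ P_{\mathrm{Br}}:\mathrm{BrBialg}_{\mathcal{M}}\to\mathrm{Br}_{\mathcal{M}'}.$$ Moreover $$\xi'(\mathrm{BrBialg}F)=(\mathrm{Br}F)\xi .$$
   Context: Associativity constraints of a monoidal category $(\mathcal M,\otimes,\mathbf 1,a,l,r)$ are suppressed; $l_X:\mathbf 1\otimes X\to X$, $r_X:X\otimes\mathbf 1\to X$; an object also denotes its identity morphism. The tensor functors are $M\otimes(-)$ and $(-)\otimes M$ for all objects $M$. $\Delta_{\mathbf 1}=l_{\mathbf 1}^{-1}=r_{\mathbf 1}^{-1}$, $m_{\mathbf 1}=l_{\mathbf 1}=r_{\mathbf 1}$. A monoidal functor means a strong monoidal one: $\phi_2(U,V):FU\otimes FV\to F(U\otimes V)$ (natural in $U,V$) and $\phi_0:\mathbf 1'\to F\mathbf 1$ are isomorphisms satisfying the usual coherence. A braided object is a pair $(V,c)$ with $c:V\otimes V\to V\otimes V$ invertible and $(c\otimes V)(V\otimes c)(c\otimes V)=(V\otimes c)(c\otimes V)(V\otimes c)$; a morphism $(V,c_V)\to(W,c_W)$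 is $f:V\to W$ with $c_W(f\otimes f)=(f\otimes f)c_V$; category $\mathrm{Br}_{\mathcal M}$. A braided algebra is $(A,m,u,c)$ with $(A,m,u)$ an algebra, $(A,c)$ a braided object, and $c(m\otimes A)=(A\otimes m)(c\otimes A)(A\otimes c)$, $c(A\otimes m)=(m\otimes A)(A\otimes c)(c\otimes A)$, $c(u\otimes A)l_A^{-1}=(A\otimes u)r_A^{-1}$, $c(A\otimes u)r_A^{-1}=(u\otimes A)l_A^{-1}$. A braided coalgebra is $(C,\Delta,\varepsilon,c)$ with $(C,\Delta,\varepsilon)$ a coalgebra, $(C,c)$ a braided object, and $(\Delta\otimes C)c=(C\otimes c)(c\otimes C)(C\otimes\Delta)$, $(C\otimes\Delta)c=(c\otimes C)(C\otimes c)(\Delta\otimes C)$, $l_C(\varepsilon\otimes C)c=r_C(C\otimes\varepsilon)$, $r_C(C\otimes\varepsilon)c=l_C(\varepsilon\otimes C)$. A braided bialgebra is $(B,m,u,\Delta,\varepsilon,c)$ with $(B,m,u,c)$ a braided algebra, $(B,\Delta,\varepsilon,c)$ a braided coalgebra, and $\Delta m=(m\otimes m)(B\otimes c\otimes B)(\Delta\otimes\Delta)$, $\Delta u=(u\otimes u)\Delta_{\mathbf 1}$, $\varepsilon m=m_{\mathbf 1}(\varepsilon\otimes\varepsilon)$, $\varepsilon u=\mathrm{Id}_{\mathbf 1}$; morphisms are algebra and coalgebra morphisms that are morphisms of braided objects; category $\mathrm{BrBialg}_{\mathcal M}$. Induced functors, acting as $F$ on morphisms: $\mathrm{Br}F(V,c_V)=(FV,c_{FV})$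 and $\mathrm{BrBialg}F(B,m_B,u_B,\Delta_B,\varepsilon_B,c_B)=(FB,m_{FB},u_{FB},\Delta_{FB},\varepsilon_{FB},c_{FB})$, with $c_{FV}=\phi_2^{-1}(V,V)\circ Fc_V\circ\phi_2(V,V)$, $m_{FB}=Fm_B\circ\phi_2(B,B)$, $u_{FB}=Fu_B\circ\phi_0$, $\Delta_{FB}=\phi_2^{-1}(B,B)\circ F\Delta_B$, $\varepsilon_{FB}=\phi_0^{-1}\circ F\varepsilon_B$. Braided primitive functor: it is always implicitly assumed that specific equalizers can be chosen. For $\mathbb A=(A,m_A,u_A,\Delta_A,\varepsilon_A,c_A)\in\mathrm{BrBialg}_{\mathcal M}$, $\xi\mathbb A:P(\mathbb A)\to A$ is the chosen equalizer of $\Delta_A$ and $(A\otimes u_A)r_A^{-1}+(u_A\otimes A)l_A^{-1}$, and $P_{\mathrm{Br}}(\mathbb A)=(P(\mathbb A),c_{P(\mathbb A)})$ where $c_{P(\mathbb A)}$ is the unique morphism with $(\xi\mathbb A\otimes\xi\mathbb A)c_{P(\mathbb A)}=c_A(\xi\mathbb A\otimes\xi\mathbb A)$; for $f:\mathbb A\to\mathbb A'$, $P_{\mathrm{Br}}(f)$ is the unique morphism with $\xi\mathbb A'\circ P_{\mathrm{Br}}(f)=f\circ\xi\mathbb A$. This gives a functor $P_{\mathrm{Br}}:\mathrm{BrBialg}_{\mathcal M}\to\mathrm{Br}_{\mathcal M}$, and $\xi$ is a natural transformation from $P_{\mathrm{Br}}$ to the forgetful functor $\mathrm{BrBialg}_{\mathcal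 M}\to\mathrm{Br}_{\mathcal M}$. $P'_{\mathrm{Br}}$ and $\xi'$ denote the analogues for $\mathcal M'$.
   Formalization: F is also assumed additive (the constant functor at the unit is a counterexample otherwise); the strict equalities hold when the equalizers chosen in M' are the F-images of those chosen in M, and for arbitrary choices the square commutes up to a natural isomorphism compatible with ξ and ξ'. *)

theory Defs
  imports "HOL-Algebra.Group"
begin

section \<open>Categories, functors, natural transformations\<close>

text \<open>Categories are single-sorted in their arrows: every arrow has one domain and one codomain.
  All laws are relativised to the sets of objects and of arrows.\<close>

record ('o, 'a) cat =
  Obj :: "'o set"
  Arr :: "'a set"
  Dom :: "'a \<Rightarrow> 'o"
  Cod :: "'a \<Rightarrow> 'o"
  Ide :: "'o \<Rightarrow> 'a"
  Comp :: "'a \<Rightarrow> 'a \<Rightarrow> 'a"  (infixr "\<cdot>\<index>" 55)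

definition Hom :: "('o, 'a, 'x) cat_scheme \<Rightarrow> 'o \<Rightarrow> 'o \<Rightarrow> 'a set" where
  "Hom C X Y = {f \<in> Arr C. Dom C f = X \<and> Cod C f = Y}"

locale category =
  fixes C :: "('o, 'a, 'x) cat_scheme" (structure)
  assumes Dom_Obj: "f \<in> Arr C \<Longrightarrow> Dom C f \<in> Obj C"
    and Cod_Obj: "f \<in> Arr C \<Longrightarrow> Cod C f \<in> Obj C"
    and Ide_Hom: "X \<in> Obj C \<Longrightarrow> Ide C X \<in> Hom C X X"
    and Comp_Hom: "f \<in> Hom C X Y \<Longrightarrow> g \<in> Hom C Y Z \<Longrightarrow> g \<cdot> f \<in> Hom C X Z"
    and Comp_assoc: "f \<in> Hom C W X \<Longrightarrow> g \<in> Hom C X Y \<Longrightarrow> h \<in> Hom C Y Z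
                      \<Longrightarrow> (h \<cdot> g) \<cdot> f = h \<cdot> (g \<cdot> f)"
    and Comp_Ide_right: "f \<in> Hom C X Y \<Longrightarrow> f \<cdot> Ide C X = f"
    and Comp_Ide_left: "f \<in> Hom C X Y \<Longrightarrow> Ide C Y \<cdot> f = f"

context
  fixes C :: "('o, 'a, 'x) cat_scheme" (structure)
begin

definition inverse_arrows :: "'a \<Rightarrow> 'a \<Rightarrow> bool" where
  "inverse_arrows f g \<longleftrightarrow> f \<in> Arr C \<and> g \<in> Hom C (Cod C f) (Dom C f) \<and>
     g \<cdot> f = Ide C (Dom C f) \<and> f \<cdot> g = Ide C (Cod C f)"

definition iso_arr :: "'a \<Rightarrow> bool" where
  "iso_arr f \<longleftrightarrow> (\<exists>g. inverse_arrows f g)"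

definition inv_arr :: "'a \<Rightarrow> 'a" where
  "inv_arr f = (THE g. inverse_arrows f g)"

definition parallel :: "'a \<Rightarrow> 'a \<Rightarrow> bool" where
  "parallel f g \<longleftrightarrow> f \<in> Arr C \<and> g \<in> Arr C \<and> Dom C f = Dom C g \<and> Cod C f = Cod C g"

definition is_equalizer :: "'a \<Rightarrow> 'a \<Rightarrow> 'a \<Rightarrow> bool" where
  "is_equalizer f g e \<longleftrightarrow> parallel f g \<and> e \<in> Arr C \<and> Cod C e = Dom C f \<and> f \<cdot> e = g \<cdot> e \<and>
     (\<forall>h\<in>Arr C. Cod C h = Dom C f \<and> f \<cdot> h = g \<cdot> h \<longrightarrow>
        (\<exists>!k. k \<in> Hom C (Dom C h) (Dom C e) \<and> e \<cdot> k = h))"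

definition has_equalizers :: bool where
  "has_equalizers \<longleftrightarrow> (\<forall>f g. parallel f g \<longrightarrow> (\<exists>e. is_equalizer f g e))"

definition equalizer_choice :: "('a \<Rightarrow> 'a \<Rightarrow> 'a) \<Rightarrow> bool" where
  "equalizer_choice eqz \<longleftrightarrow> (\<forall>f g. parallel f g \<longrightarrow> is_equalizer f g (eqz f g))"

end

record ('o, 'a, 'p, 'b) cfunctor =
  on_obj :: "'o \<Rightarrow> 'p"
  on_arr :: "'a \<Rightarrow> 'b"

definition comp_functor ::
  "('p, 'b, 'q, 'c) cfunctor \<Rightarrow> ('o, 'a, 'p, 'b) cfunctor \<Rightarrow> ('o, 'a, 'q, 'c) cfunctor"
  (infixr "\<circ>\<^sub>F" 55) where
  "G \<circ>\<^sub>F F = \<lparr>on_obj = on_obj G \<circ> on_obj F, on_arr = on_arr G \<circ> on_arr F\<rparr>"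

locale is_functor = dom: category C + cod: category D
  for C :: "('o, 'a, 'x) cat_scheme" and D :: "('p, 'b, 'y) cat_scheme"
  and F :: "('o, 'a, 'p, 'b) cfunctor" +
  assumes on_obj_Obj: "X \<in> Obj C \<Longrightarrow> on_obj F X \<in> Obj D"
    and on_arr_Hom: "f \<in> Hom C X Y \<Longrightarrow> on_arr F f \<in> Hom D (on_obj F X) (on_obj F Y)"
    and on_arr_Ide: "X \<in> Obj C \<Longrightarrow> on_arr F (Ide C X) = Ide D (on_obj F X)"
    and on_arr_Comp: "f \<in> Hom C X Y \<Longrightarrow> g \<in> Hom C Y Z
                       \<Longrightarrow> on_arr F (g \<cdot>\<^bsub>C\<^esub> f) = on_arr F g \<cdot>\<^bsub>D\<^esub> on_arr F f"

definition preserves_equalizers ::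
  "('o, 'a, 'x) cat_scheme \<Rightarrow> ('p, 'b, 'y) cat_scheme \<Rightarrow> ('o, 'a, 'p, 'b) cfunctor \<Rightarrow> bool" where
  "preserves_equalizers C D F \<longleftrightarrow>
     (\<forall>f g e. is_equalizer C f g e \<longrightarrow> is_equalizer D (on_arr F f) (on_arr F g) (on_arr F e))"

text \<open>Equality of functors \<open>C \<rightarrow> D\<close> (values outside \<open>C\<close> are irrelevant).\<close>

definition equal_functors ::
  "('o, 'a, 'x) cat_scheme \<Rightarrow> ('p, 'b, 'y) cat_scheme \<Rightarrow>
   ('o, 'a, 'p, 'b) cfunctor \<Rightarrow> ('o, 'a, 'p, 'b) cfunctor \<Rightarrow> bool" where
  "equal_functors C D F G \<longleftrightarrow> is_functor C D F \<and> is_functor C D G \<and>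
     (\<forall>X\<in>Obj C. on_obj F X = on_obj G X) \<and> (\<forall>f\<in>Arr C. on_arr F f = on_arr G f)"

definition natural_transformation ::
  "('o, 'a, 'x) cat_scheme \<Rightarrow> ('p, 'b, 'y) cat_scheme \<Rightarrow>
   ('o, 'a, 'p, 'b) cfunctor \<Rightarrow> ('o, 'a, 'p, 'b) cfunctor \<Rightarrow> ('o \<Rightarrow> 'b) \<Rightarrow> bool" where
  "natural_transformation C D F G \<tau> \<longleftrightarrow> is_functor C D F \<and> is_functor C D G \<and>
     (\<forall>X\<in>Obj C. \<tau> X \<in> Hom D (on_obj F X) (on_obj G X)) \<and>
     (\<forall>f\<in>Arr C. \<tau> (Cod C f) \<cdot>\<^bsub>D\<^esub> on_arr F f = on_arr G f \<cdot>\<^bsub>D\<^esub> \<tau> (Dom C f))"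

definition natural_isomorphism ::
  "('o, 'a, 'x) cat_scheme \<Rightarrow> ('p, 'b, 'y) cat_scheme \<Rightarrow>
   ('o, 'a, 'p, 'b) cfunctor \<Rightarrow> ('o, 'a, 'p, 'b) cfunctor \<Rightarrow> ('o \<Rightarrow> 'b) \<Rightarrow> bool" where
  "natural_isomorphism C D F G \<tau> \<longleftrightarrow>
     natural_transformation C D F G \<tau> \<and> (\<forall>X\<in>Obj C. iso_arr D (\<tau> X))"


section \<open>Preadditive monoidal categories\<close>

record ('o, 'a) moncat = "('o, 'a) cat" +
  TenO :: "'o \<Rightarrow> 'o \<Rightarrow> 'o"  (infixl "\<boxdot>\<index>" 65)
  TenA :: "'a \<Rightarrow> 'a \<Rightarrow> 'a"  (infixl "\<boxtimes>\<index>" 65)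
  Unit :: "'o"
  Assoc :: "'o \<Rightarrow> 'o \<Rightarrow> 'o \<Rightarrow> 'a"
  LUnit :: "'o \<Rightarrow> 'a"
  RUnit :: "'o \<Rightarrow> 'a"

record ('o, 'a) addmoncat = "('o, 'a) moncat" +
  HAdd :: "'a \<Rightarrow> 'a \<Rightarrow> 'a"

locale monoidal_category = category M
  for M :: "('o, 'a, 'x) moncat_scheme" (structure) +
  assumes TenO_Obj: "X \<in> Obj M \<Longrightarrow> Y \<in> Obj M \<Longrightarrow> X \<boxdot> Y \<in> Obj M"
    and TenA_Hom: "f \<in> Hom M X Y \<Longrightarrow> g \<in> Hom M X' Y' \<Longrightarrow> f \<boxtimes> g \<in> Hom M (X \<boxdot> X') (Y \<boxdot> Y')"
    and TenA_Ide: "X \<in> Obj M \<Longrightarrow> Y \<in> Obj M \<Longrightarrow> Ide M X \<boxtimes> Ide M Y = Ide M (X \<boxdot> Y)"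
    and TenA_Comp: "f \<in> Hom M X Y \<Longrightarrow> g \<in> Hom M Y Z \<Longrightarrow> f' \<in> Hom M X' Y' \<Longrightarrow> g' \<in> Hom M Y' Z'
                     \<Longrightarrow> (g \<cdot> f) \<boxtimes> (g' \<cdot> f') = (g \<boxtimes> g') \<cdot> (f \<boxtimes> f')"
    and Unit_Obj: "Unit M \<in> Obj M"
    and Assoc_Hom: "X \<in> Obj M \<Longrightarrow> Y \<in> Obj M \<Longrightarrow> Z \<in> Obj M
                     \<Longrightarrow> Assoc M X Y Z \<in> Hom M ((X \<boxdot> Y) \<boxdot> Z) (X \<boxdot> (Y \<boxdot> Z))"
    and Assoc_iso: "X \<in> Obj M \<Longrightarrow> Y \<in> Obj M \<Longrightarrow> Z \<in> Obj M \<Longrightarrow> iso_arr M (Assoc M X Y Z)"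
    and Assoc_natural:
      "f \<in> Hom M X X' \<Longrightarrow> g \<in> Hom M Y Y' \<Longrightarrow> h \<in> Hom M Z Z'
        \<Longrightarrow> Assoc M X' Y' Z' \<cdot> ((f \<boxtimes> g) \<boxtimes> h) = (f \<boxtimes> (g \<boxtimes> h)) \<cdot> Assoc M X Y Z"
    and LUnit_Hom: "X \<in> Obj M \<Longrightarrow> LUnit M X \<in> Hom M (Unit M \<boxdot> X) X"
    and LUnit_iso: "X \<in> Obj M \<Longrightarrow> iso_arr M (LUnit M X)"
    and LUnit_natural: "f \<in> Hom M X Y \<Longrightarrow> LUnit M Y \<cdot> (Ide M (Unit M) \<boxtimes> f) = f \<cdot> LUnit M X"
    and RUnit_Hom: "X \<in> Obj M \<Longrightarrow> RUnit M X \<in> Hom M (X \<boxdot> Unit M) X"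
    and RUnit_iso: "X \<in> Obj M \<Longrightarrow> iso_arr M (RUnit M X)"
    and RUnit_natural: "f \<in> Hom M X Y \<Longrightarrow> RUnit M Y \<cdot> (f \<boxtimes> Ide M (Unit M)) = f \<cdot> RUnit M X"
    and pentagon:
      "W \<in> Obj M \<Longrightarrow> X \<in> Obj M \<Longrightarrow> Y \<in> Obj M \<Longrightarrow> Z \<in> Obj M
        \<Longrightarrow> (Ide M W \<boxtimes> Assoc M X Y Z) \<cdot> Assoc M W (X \<boxdot> Y) Z \<cdot> (Assoc M W X Y \<boxtimes> Ide M Z)
          = Assoc M W X (Y \<boxdot> Z) \<cdot> Assoc M (W \<boxdot> X) Y Z"
    and triangle:
      "X \<in> Obj M \<Longrightarrow> Y \<in> Obj M
        \<Longrightarrow> (Ide M X \<boxtimes> LUnit M Y) \<cdot> Assoc M X (Unit M) Y = RUnit M X \<boxtimes> Ide M Y"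

locale preadditive_monoidal_category = monoidal_category M
  for M :: "('o, 'a, 'x) addmoncat_scheme" (structure) +
  assumes Hom_comm_group: "X \<in> Obj M \<Longrightarrow> Y \<in> Obj M
            \<Longrightarrow> \<exists>z. comm_group \<lparr>carrier = Hom M X Y, monoid.mult = HAdd M, one = z\<rparr>"
    and Comp_HAdd_left: "f \<in> Hom M X Y \<Longrightarrow> g \<in> Hom M Y Z \<Longrightarrow> g' \<in> Hom M Y Z
            \<Longrightarrow> HAdd M g g' \<cdot> f = HAdd M (g \<cdot> f) (g' \<cdot> f)"
    and Comp_HAdd_right: "f \<in> Hom M X Y \<Longrightarrow> f' \<in> Hom M X Y \<Longrightarrow> g \<in> Hom M Y Z
            \<Longrightarrow> g \<cdot> HAdd M f f' = HAdd M (g \<cdot> f) (g \<cdot> f')"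

definition additive ::
  "('o, 'a, 'x) addmoncat_scheme \<Rightarrow> ('p, 'b, 'y) addmoncat_scheme \<Rightarrow>
   ('o, 'a, 'p, 'b) cfunctor \<Rightarrow> bool" where
  "additive M N F \<longleftrightarrow> (\<forall>X\<in>Obj M. \<forall>Y\<in>Obj M. \<forall>f\<in>Hom M X Y. \<forall>g\<in>Hom M X Y.
     on_arr F (HAdd M f g) = HAdd N (on_arr F f) (on_arr F g))"

definition tensor_left :: "('o, 'a, 'x) moncat_scheme \<Rightarrow> 'o \<Rightarrow> ('o, 'a, 'o, 'a) cfunctor" where
  "tensor_left M X = \<lparr>on_obj = \<lambda>Y. X \<boxdot>\<^bsub>M\<^esub> Y, on_arr = \<lambda>f. Ide M X \<boxtimes>\<^bsub>M\<^esub> f\<rparr>"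

definition tensor_right :: "('o, 'a, 'x) moncat_scheme \<Rightarrow> 'o \<Rightarrow> ('o, 'a, 'o, 'a) cfunctor" where
  "tensor_right M X = \<lparr>on_obj = \<lambda>Y. Y \<boxdot>\<^bsub>M\<^esub> X, on_arr = \<lambda>f. f \<boxtimes>\<^bsub>M\<^esub> Ide M X\<rparr>"

definition tensor_functors_additive :: "('o, 'a, 'x) addmoncat_scheme \<Rightarrow> bool" where
  "tensor_functors_additive M \<longleftrightarrow>
     (\<forall>X\<in>Obj M. additive M M (tensor_left M X) \<and> additive M M (tensor_right M X))"

definition tensor_functors_preserve_equalizers :: "('o, 'a, 'x) moncat_scheme \<Rightarrow> bool" where
  "tensor_functors_preserve_equalizers M \<longleftrightarrow>
     (\<forall>X\<in>Obj M. preserves_equalizers M M (tensor_left M X) \<and>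
                 preserves_equalizers M M (tensor_right M X))"

text \<open>Strong monoidal functors.\<close>

locale monoidal_functor =
  src: monoidal_category M + tgt: monoidal_category N + is_functor M N F
  for M :: "('o, 'a, 'x) moncat_scheme" and N :: "('p, 'b, 'y) moncat_scheme"
  and F :: "('o, 'a, 'p, 'b) cfunctor" and \<phi>\<^sub>0 :: 'b and \<phi>\<^sub>2 :: "'o \<Rightarrow> 'o \<Rightarrow> 'b" +
  assumes \<phi>0_Hom: "\<phi>\<^sub>0 \<in> Hom N (Unit N) (on_obj F (Unit M))"
    and \<phi>0_iso: "iso_arr N \<phi>\<^sub>0"
    and \<phi>2_Hom: "U \<in> Obj M \<Longrightarrow> V \<in> Obj M
                  \<Longrightarrow> \<phi>\<^sub>2 U V \<in> Hom N (on_obj F U \<boxdot>\<^bsub>N\<^esub> on_obj F V) (on_obj F (U \<boxdot>\<^bsub>M\<^esub> V))"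
    and \<phi>2_iso: "U \<in> Obj M \<Longrightarrow> V \<in> Obj M \<Longrightarrow> iso_arr N (\<phi>\<^sub>2 U V)"
    and \<phi>2_natural: "f \<in> Hom M U U' \<Longrightarrow> g \<in> Hom M V V'
         \<Longrightarrow> \<phi>\<^sub>2 U' V' \<cdot>\<^bsub>N\<^esub> (on_arr F f \<boxtimes>\<^bsub>N\<^esub> on_arr F g) = on_arr F (f \<boxtimes>\<^bsub>M\<^esub> g) \<cdot>\<^bsub>N\<^esub> \<phi>\<^sub>2 U V"
    and \<phi>2_Assoc: "U \<in> Obj M \<Longrightarrow> V \<in> Obj M \<Longrightarrow> W \<in> Obj M
         \<Longrightarrow> on_arr F (Assoc M U V W) \<cdot>\<^bsub>N\<^esub> \<phi>\<^sub>2 (U \<boxdot>\<^bsub>M\<^esub> V) W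
               \<cdot>\<^bsub>N\<^esub> (\<phi>\<^sub>2 U V \<boxtimes>\<^bsub>N\<^esub> Ide N (on_obj F W))
           = \<phi>\<^sub>2 U (V \<boxdot>\<^bsub>M\<^esub> W) \<cdot>\<^bsub>N\<^esub> (Ide N (on_obj F U) \<boxtimes>\<^bsub>N\<^esub> \<phi>\<^sub>2 V W)
               \<cdot>\<^bsub>N\<^esub> Assoc N (on_obj F U) (on_obj F V) (on_obj F W)"
    and \<phi>2_LUnit: "U \<in> Obj M
         \<Longrightarrow> on_arr F (LUnit M U) \<cdot>\<^bsub>N\<^esub> \<phi>\<^sub>2 (Unit M) U \<cdot>\<^bsub>N\<^esub> (\<phi>\<^sub>0 \<boxtimes>\<^bsub>N\<^esub> Ide N (on_obj F U))
           = LUnit N (on_obj F U)"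
    and \<phi>2_RUnit: "U \<in> Obj M
         \<Longrightarrow> on_arr F (RUnit M U) \<cdot>\<^bsub>N\<^esub> \<phi>\<^sub>2 U (Unit M) \<cdot>\<^bsub>N\<^esub> (Ide N (on_obj F U) \<boxtimes>\<^bsub>N\<^esub> \<phi>\<^sub>0)
           = RUnit N (on_obj F U)"


section \<open>Braided objects and braided bialgebras\<close>

text \<open>
  Associators are written out. For \<open>c : V \<otimes> V \<rightarrow> V \<otimes> V\<close> the endomorphisms \<open>c \<otimes> V\<close> and
  \<open>V \<otimes> c\<close> both act on \<open>(V \<otimes> V) \<otimes> V\<close>; the second one is conjugated by the associator.
\<close>

record ('o, 'a) bialg =
  carr :: 'o
  mul :: 'a
  unt :: 'a
  comul :: 'a
  counit :: 'a
  braid :: 'a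

context
  fixes M :: "('o, 'a, 'x) moncat_scheme" (structure)
begin

definition br12 :: "'o \<Rightarrow> 'a \<Rightarrow> 'a" where
  "br12 V c = c \<boxtimes> Ide M V"

definition br23 :: "'o \<Rightarrow> 'a \<Rightarrow> 'a" where
  "br23 V c = inv_arr M (Assoc M V V V) \<cdot> (Ide M V \<boxtimes> c) \<cdot> Assoc M V V V"

definition braided_object :: "'o \<Rightarrow> 'a \<Rightarrow> bool" where
  "braided_object V c \<longleftrightarrow> V \<in> Obj M \<and> c \<in> Hom M (V \<boxdot> V) (V \<boxdot> V) \<and> iso_arr M c \<and>
     br12 V c \<cdot> br23 V c \<cdot> br12 V c = br23 V c \<cdot> br12 V c \<cdot> br23 V c"

definition algebra_in :: "'o \<Rightarrow> 'a \<Rightarrow> 'a \<Rightarrow> bool" where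
  "algebra_in A m u \<longleftrightarrow> A \<in> Obj M \<and> m \<in> Hom M (A \<boxdot> A) A \<and> u \<in> Hom M (Unit M) A \<and>
     m \<cdot> (m \<boxtimes> Ide M A) = m \<cdot> (Ide M A \<boxtimes> m) \<cdot> Assoc M A A A \<and>
     m \<cdot> (u \<boxtimes> Ide M A) = LUnit M A \<and>
     m \<cdot> (Ide M A \<boxtimes> u) = RUnit M A"

definition coalgebra_in :: "'o \<Rightarrow> 'a \<Rightarrow> 'a \<Rightarrow> bool" where
  "coalgebra_in C \<Delta> \<epsilon> \<longleftrightarrow> C \<in> Obj M \<and> \<Delta> \<in> Hom M C (C \<boxdot> C) \<and> \<epsilon> \<in> Hom M C (Unit M) \<and>
     Assoc M C C C \<cdot> (\<Delta> \<boxtimes> Ide M C) \<cdot> \<Delta> = (Ide M C \<boxtimes> \<Delta>) \<cdot> \<Delta> \<and>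
     LUnit M C \<cdot> (\<epsilon> \<boxtimes> Ide M C) \<cdot> \<Delta> = Ide M C \<and>
     RUnit M C \<cdot> (Ide M C \<boxtimes> \<epsilon>) \<cdot> \<Delta> = Ide M C"

definition braided_algebra :: "'o \<Rightarrow> 'a \<Rightarrow> 'a \<Rightarrow> 'a \<Rightarrow> bool" where
  "braided_algebra A m u c \<longleftrightarrow> algebra_in A m u \<and> braided_object A c \<and>
     c \<cdot> (m \<boxtimes> Ide M A) = (Ide M A \<boxtimes> m) \<cdot> Assoc M A A A \<cdot> br12 A c \<cdot> br23 A c \<and>
     c \<cdot> (Ide M A \<boxtimes> m) \<cdot> Assoc M A A A = (m \<boxtimes> Ide M A) \<cdot> br23 A c \<cdot> br12 A c \<and>
     c \<cdot> (u \<boxtimes> Ide M A) \<cdot> inv_arr M (LUnit M A) = (Ide M A \<boxtimes> u) \<cdot> inv_arr M (RUnit M A) \<and>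
     c \<cdot> (Ide M A \<boxtimes> u) \<cdot> inv_arr M (RUnit M A) = (u \<boxtimes> Ide M A) \<cdot> inv_arr M (LUnit M A)"

definition braided_coalgebra :: "'o \<Rightarrow> 'a \<Rightarrow> 'a \<Rightarrow> 'a \<Rightarrow> bool" where
  "braided_coalgebra C \<Delta> \<epsilon> c \<longleftrightarrow> coalgebra_in C \<Delta> \<epsilon> \<and> braided_object C c \<and>
     (\<Delta> \<boxtimes> Ide M C) \<cdot> c = br23 C c \<cdot> br12 C c \<cdot> inv_arr M (Assoc M C C C) \<cdot> (Ide M C \<boxtimes> \<Delta>) \<and>
     inv_arr M (Assoc M C C C) \<cdot> (Ide M C \<boxtimes> \<Delta>) \<cdot> c = br12 C c \<cdot> br23 C c \<cdot> (\<Delta> \<boxtimes> Ide M C) \<and>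
     LUnit M C \<cdot> (\<epsilon> \<boxtimes> Ide M C) \<cdot> c = RUnit M C \<cdot> (Ide M C \<boxtimes> \<epsilon>) \<and>
     RUnit M C \<cdot> (Ide M C \<boxtimes> \<epsilon>) \<cdot> c = LUnit M C \<cdot> (\<epsilon> \<boxtimes> Ide M C)"

text \<open>\<open>B \<otimes> c \<otimes> B\<close> as an endomorphism of \<open>(B \<otimes> B) \<otimes> (B \<otimes> B)\<close>.\<close>

definition mid_braid :: "'o \<Rightarrow> 'a \<Rightarrow> 'a" where
  "mid_braid B c = Assoc M (B \<boxdot> B) B B \<cdot> (br23 B c \<boxtimes> Ide M B) \<cdot> inv_arr M (Assoc M (B \<boxdot> B) B B)"

text \<open>In the last four equations \<open>m\<^sub>\<one>\<close> is \<open>l\<^sub>\<one>\<close> and \<open>\<Delta>\<^sub>\<one>\<close> is its inverse.\<close>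

definition braided_bialgebra :: "('o, 'a) bialg \<Rightarrow> bool" where
  "braided_bialgebra B \<longleftrightarrow>
     braided_algebra (carr B) (mul B) (unt B) (braid B) \<and>
     braided_coalgebra (carr B) (comul B) (counit B) (braid B) \<and>
     comul B \<cdot> mul B = (mul B \<boxtimes> mul B) \<cdot> mid_braid (carr B) (braid B) \<cdot> (comul B \<boxtimes> comul B) \<and>
     comul B \<cdot> unt B = (unt B \<boxtimes> unt B) \<cdot> inv_arr M (LUnit M (Unit M)) \<and>
     counit B \<cdot> mul B = LUnit M (Unit M) \<cdot> (counit B \<boxtimes> counit B) \<and>
     counit B \<cdot> unt B = Ide M (Unit M)"

definition braided_morphism :: "'o \<times> 'a \<Rightarrow> 'a \<Rightarrow> 'o \<times> 'a \<Rightarrow> bool" where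
  "braided_morphism V f W \<longleftrightarrow> f \<in> Hom M (fst V) (fst W) \<and>
     snd W \<cdot> (f \<boxtimes> f) = (f \<boxtimes> f) \<cdot> snd V"

definition bialgebra_morphism :: "('o, 'a) bialg \<Rightarrow> 'a \<Rightarrow> ('o, 'a) bialg \<Rightarrow> bool" where
  "bialgebra_morphism A f B \<longleftrightarrow>
     braided_morphism (carr A, braid A) f (carr B, braid B) \<and>
     f \<cdot> mul A = mul B \<cdot> (f \<boxtimes> f) \<and> f \<cdot> unt A = unt B \<and>
     comul B \<cdot> f = (f \<boxtimes> f) \<cdot> comul A \<and> counit B \<cdot> f = counit A"

end

text \<open>
  A morphism of \<open>M\<close> can be a morphism of braided objects (bialgebras) for several braidings
  (structures), so an arrow here is a triple \<open>(source, underlying morphism, target)\<close>.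
\<close>

definition Br :: "('o, 'a, 'x) moncat_scheme \<Rightarrow> ('o \<times> 'a, ('o \<times> 'a) \<times> 'a \<times> ('o \<times> 'a)) cat" where
  "Br M = \<lparr>Obj = {(V, c). braided_object M V c},
     Arr = {(V, f, W). braided_object M (fst V) (snd V) \<and> braided_object M (fst W) (snd W) \<and>
              braided_morphism M V f W},
     Dom = (\<lambda>(V, f, W). V),
     Cod = (\<lambda>(V, f, W). W),
     Ide = (\<lambda>V. (V, Ide M (fst V), V)),
     Comp = (\<lambda>(V', g, W) (V, f, W'). (V, g \<cdot>\<^bsub>M\<^esub> f, W))\<rparr>"

definition BrBialg ::
  "('o, 'a, 'x) moncat_scheme \<Rightarrow> (('o, 'a) bialg, ('o, 'a) bialg \<times> 'a \<times> ('o, 'a) bialg) cat" where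
  "BrBialg M = \<lparr>Obj = {B. braided_bialgebra M B},
     Arr = {(A, f, B). braided_bialgebra M A \<and> braided_bialgebra M B \<and> bialgebra_morphism M A f B},
     Dom = (\<lambda>(A, f, B). A),
     Cod = (\<lambda>(A, f, B). B),
     Ide = (\<lambda>A. (A, Ide M (carr A), A)),
     Comp = (\<lambda>(A', g, B) (A, f, B'). (A, g \<cdot>\<^bsub>M\<^esub> f, B))\<rparr>"

definition BrBialg_forget ::
  "(('o, 'a) bialg, ('o, 'a) bialg \<times> 'a \<times> ('o, 'a) bialg,
    'o \<times> 'a, ('o \<times> 'a) \<times> 'a \<times> ('o \<times> 'a)) cfunctor" where
  "BrBialg_forget = \<lparr>on_obj = \<lambda>A. (carr A, braid A),
     on_arr = \<lambda>(A, f, B). ((carr A, braid A), f, (carr B, braid B))\<rparr>"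


section \<open>Functors induced by a monoidal functor\<close>

context
  fixes N :: "('p, 'b, 'y) moncat_scheme" (structure)
    and F :: "('o, 'a, 'p, 'b) cfunctor" and \<phi>\<^sub>0 :: 'b and \<phi>\<^sub>2 :: "'o \<Rightarrow> 'o \<Rightarrow> 'b"
begin

definition Br_map_obj :: "'o \<times> 'a \<Rightarrow> 'p \<times> 'b" where
  "Br_map_obj = (\<lambda>(V, c). (on_obj F V, inv_arr N (\<phi>\<^sub>2 V V) \<cdot> on_arr F c \<cdot> \<phi>\<^sub>2 V V))"

definition Br_map ::
  "('o \<times> 'a, ('o \<times> 'a) \<times> 'a \<times> ('o \<times> 'a), 'p \<times> 'b, ('p \<times> 'b) \<times> 'b \<times> ('p \<times> 'b)) cfunctor" where
  "Br_map = \<lparr>on_obj = Br_map_obj,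
     on_arr = \<lambda>(V, f, W). (Br_map_obj V, on_arr F f, Br_map_obj W)\<rparr>"

definition BrBialg_map_obj :: "('o, 'a) bialg \<Rightarrow> ('p, 'b) bialg" where
  "BrBialg_map_obj B =
    (let V = carr B; \<phi> = \<phi>\<^sub>2 V V in
     \<lparr>carr = on_obj F V,
      mul = on_arr F (mul B) \<cdot> \<phi>,
      unt = on_arr F (unt B) \<cdot> \<phi>\<^sub>0,
      comul = inv_arr N \<phi> \<cdot> on_arr F (comul B),
      counit = inv_arr N \<phi>\<^sub>0 \<cdot> on_arr F (counit B),
      braid = inv_arr N \<phi> \<cdot> on_arr F (braid B) \<cdot> \<phi>\<rparr>)"

definition BrBialg_map ::
  "(('o, 'a) bialg, ('o, 'a) bialg \<times> 'a \<times> ('o, 'a) bialg,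
    ('p, 'b) bialg, ('p, 'b) bialg \<times> 'b \<times> ('p, 'b) bialg) cfunctor" where
  "BrBialg_map = \<lparr>on_obj = BrBialg_map_obj,
     on_arr = \<lambda>(A, f, B). (BrBialg_map_obj A, on_arr F f, BrBialg_map_obj B)\<rparr>"

end


section \<open>The braided primitive functor\<close>

text \<open>
  The equalizer of \<open>f\<close> and \<open>g\<close> that is chosen in \<open>M\<close> is \<open>eqz f g\<close>; it is given as an arrow, and the
  chosen object is its domain. \<open>prim_sum\<close> is the morphism \<open>(A \<otimes> u) r\<^sup>-\<^sup>1 + (u \<otimes> A) l\<^sup>-\<^sup>1\<close>, which is
  equalized with the comultiplication.
\<close>

context
  fixes M :: "('o, 'a, 'x) addmoncat_scheme" (structure)
    and eqz :: "'a \<Rightarrow> 'a \<Rightarrow> 'a"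
begin

definition prim_sum :: "('o, 'a) bialg \<Rightarrow> 'a" where
  "prim_sum A = HAdd M ((Ide M (carr A) \<boxtimes> unt A) \<cdot> inv_arr M (RUnit M (carr A)))
                       ((unt A \<boxtimes> Ide M (carr A)) \<cdot> inv_arr M (LUnit M (carr A)))"

definition prim_arr :: "('o, 'a) bialg \<Rightarrow> 'a" where
  "prim_arr A = eqz (comul A) (prim_sum A)"

definition prim :: "('o, 'a) bialg \<Rightarrow> 'o" where
  "prim A = Dom M (prim_arr A)"

definition prim_braid :: "('o, 'a) bialg \<Rightarrow> 'a" where
  "prim_braid A = (THE c. c \<in> Hom M (prim A \<boxdot> prim A) (prim A \<boxdot> prim A) \<and>
     (prim_arr A \<boxtimes> prim_arr A) \<cdot> c = braid A \<cdot> (prim_arr A \<boxtimes> prim_arr A))"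

definition P_Br ::
  "(('o, 'a) bialg, ('o, 'a) bialg \<times> 'a \<times> ('o, 'a) bialg,
    'o \<times> 'a, ('o \<times> 'a) \<times> 'a \<times> ('o \<times> 'a)) cfunctor" where
  "P_Br = \<lparr>on_obj = \<lambda>A. (prim A, prim_braid A),
     on_arr = \<lambda>(A, f, B). ((prim A, prim_braid A),
                THE g. g \<in> Hom M (prim A) (prim B) \<and> prim_arr B \<cdot> g = f \<cdot> prim_arr A,
                (prim B, prim_braid B))\<rparr>"

definition xi :: "('o, 'a) bialg \<Rightarrow> ('o \<times> 'a) \<times> 'a \<times> ('o \<times> 'a)" where
  "xi A = (on_obj P_Br A, prim_arr A, on_obj BrBialg_forget A)"

end

text \<open>
  Which equalizers are chosen matters for an equality of functors on the nose. \<open>F\<close> turns a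
  parallel pair \<open>f, g : A \<rightarrow> A \<otimes> A\<close> into \<open>\<phi>\<^sub>2\<^sup>-\<^sup>1 \<circ> F f, \<phi>\<^sub>2\<^sup>-\<^sup>1 \<circ> F g : F A \<rightarrow> F A \<otimes> F A\<close>; the choices in
  source and target are compatible if, for the pairs defining primitives, the equalizer chosen
  for the transported pair is the image of the equalizer chosen for the original pair.
\<close>

definition compatible_choices ::
  "('o, 'a, 'x) addmoncat_scheme \<Rightarrow> ('p, 'b, 'y) addmoncat_scheme \<Rightarrow>
   ('o, 'a, 'p, 'b) cfunctor \<Rightarrow> ('o \<Rightarrow> 'o \<Rightarrow> 'b) \<Rightarrow> ('a \<Rightarrow> 'a \<Rightarrow> 'a) \<Rightarrow> ('b \<Rightarrow> 'b \<Rightarrow> 'b) \<Rightarrow> bool" where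
  "compatible_choices M N F \<phi>\<^sub>2 eqz eqz' \<longleftrightarrow>
     (\<forall>A\<in>Obj (BrBialg M). let \<psi> = inv_arr N (\<phi>\<^sub>2 (carr A) (carr A)) in
        eqz' (\<psi> \<cdot>\<^bsub>N\<^esub> on_arr F (comul A)) (\<psi> \<cdot>\<^bsub>N\<^esub> on_arr F (prim_sum M A))
          = on_arr F (eqz (comul A) (prim_sum M A)))"

end

theory Submission
  imports Defs
begin

text \<open>
  Since \<open>F\<close> is additive and \<open>\<phi>\<^sub>2\<close> is compatible with the unit constraints, \<open>\<phi>\<^sub>2\<^sup>-\<^sup>1 \<circ> F (-)\<close> sends the
  pair of arrows that defines the primitives of \<open>A\<close> to the pair that defines the primitives of the
  bialgebra \<open>F A\<close>. Hence \<open>F \<xi>\<close> and \<open>\<xi>'\<close> are equalizers of the same pair, and the induced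
  isomorphism between them respects the braidings and is natural, because \<open>F \<xi>\<close> and
  \<open>F \<xi> \<otimes> F \<xi>\<close> are monomorphisms. The braiding of the primitives exists because \<open>\<xi> \<otimes> \<xi>\<close>
  is an intersection of two equalizers, and both arrows of the defining pair slide through the
  braiding of \<open>A\<close> in the same way.
\<close>

section \<open>Isomorphisms and equalizers\<close>

text \<open>Associators, unit constraints and \<open>\<phi>\<^sub>2\<close> are all explicit, so
  moving a single axiom along \<open>F\<close> would be a diagram chase of its own. The calculus of
  \<open>transport\<close> squares replaces these chases by one set of closure rules. Restricting
  the braiding of \<open>A\<close> to the primitives gives only an endomorphism. Its invertibility
  needs the inverse braiding to restrict as well, and this comes from the same sliding identities,
  solved for the other composite. For the two unit insertions those identities rest on the
  consequences of pentagon and triangle for the unit constraints of a tensor product, derived below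
  in Kelly's way. Additivity of \<open>F\<close> is what carries the sum in \<open>prim_sum\<close>
  across. Two independent choices of equalizers are related only by a canonical isomorphism, so the
  conclusion has two halves. Under \<open>compatible_choices\<close> the two inclusions are the same
  arrow; their domains then agree, the braidings agree by uniqueness of the restricted braiding, and
  so do the induced maps. For arbitrary choices there remains the natural isomorphism, which carries
  one inclusion to the other.\<close>

context category
begin

lemma Hom_iff: "f \<in> Hom C X Y \<longleftrightarrow> f \<in> Arr C \<and> Dom C f = X \<and> Cod C f = Y"
  by (simp add: Hom_def)

lemma Ide_simps [simp]:
  assumes "X \<in> Obj C"
  shows "Ide C X \<in> Arr C" "Dom C (Ide C X) = X" "Cod C (Ide C X) = X"
  using Ide_Hom[OF assms] by (simp_all add: Hom_iff)

lemma Comp_simps [simp]: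
  assumes "f \<in> Arr C" "g \<in> Arr C" "Cod C f = Dom C g"
  shows "g \<cdot> f \<in> Arr C" "Dom C (g \<cdot> f) = Dom C f" "Cod C (g \<cdot> f) = Cod C g"
  using Comp_Hom[of f "Dom C f" "Dom C g" g "Cod C g"] assms by (simp_all add: Hom_iff)

lemma Comp_assoc_arr [simp]:
  assumes "f \<in> Arr C" "g \<in> Arr C" "h \<in> Arr C" "Cod C f = Dom C g" "Cod C g = Dom C h"
  shows "(h \<cdot> g) \<cdot> f = h \<cdot> g \<cdot> f"
  using assms by (intro Comp_assoc[of _ "Dom C f" "Dom C g" _ "Dom C h" _ "Cod C h"]) (simp_all add: Hom_iff)

lemma Comp_Ide_arr [simp]:
  assumes "f \<in> Arr C"
  shows "Dom C f = X \<Longrightarrow> f \<cdot> Ide C X = f" "Cod C f = X \<Longrightarrow> Ide C X \<cdot> f = f"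
  using Comp_Ide_right[of f "Dom C f" "Cod C f"] Comp_Ide_left[of f "Dom C f" "Cod C f"] assms
  by (auto simp: Hom_iff)

lemma Dom_Cod_Obj [simp]:
  assumes "f \<in> Arr C"
  shows "Dom C f \<in> Obj C" "Cod C f \<in> Obj C"
  using assms by (simp_all add: Dom_Obj Cod_Obj)

text \<open>The simplifier nests composites to the right, so an equation for
  \<open>h \<cdot> g\<close> does not match inside \<open>h \<cdot> g \<cdot> f\<close>. This form
  rewrites such a prefix.\<close>

lemma Comp_reduce:
  assumes "h \<cdot> g = k" "f \<in> Arr C" "g \<in> Arr C" "h \<in> Arr C" "Cod C f = Dom C g" "Cod C g = Dom C h"
  shows "h \<cdot> g \<cdot> f = k \<cdot> f"
  using assms by (metis Comp_assoc_arr)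

lemma inverse_arrows_unique:
  assumes "inverse_arrows C f g" "inverse_arrows C f h"
  shows "g = h"
proof -
  have "g = (h \<cdot> f) \<cdot> g"
    using assms by (simp add: inverse_arrows_def Hom_iff)
  also have "\<dots> = h"
    using assms unfolding inverse_arrows_def Hom_iff by (subst Comp_assoc_arr) auto
  finally show ?thesis .
qed

lemma inv_arr_eqI: "inverse_arrows C f g \<Longrightarrow> inv_arr C f = g"
  unfolding inv_arr_def using inverse_arrows_unique by blast

lemma inverse_arrows_inv_arr: "iso_arr C f \<Longrightarrow> inverse_arrows C f (inv_arr C f)"
  unfolding iso_arr_def using inv_arr_eqI by blast

lemma iso_arr_inv:
  assumes "iso_arr C f"
  shows iso_arr_Arr: "f \<in> Arr C"
    and inv_arr_Arr [simp]: "inv_arr C f \<in> Arr C"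
    and Dom_inv_arr [simp]: "Dom C (inv_arr C f) = Cod C f"
    and Cod_inv_arr [simp]: "Cod C (inv_arr C f) = Dom C f"
    and Comp_inv_left [simp]: "inv_arr C f \<cdot> f = Ide C (Dom C f)"
    and Comp_inv_right [simp]: "f \<cdot> inv_arr C f = Ide C (Cod C f)"
  using inverse_arrows_inv_arr[OF assms] by (auto simp: inverse_arrows_def Hom_iff)

lemma Comp_inv_cancel [simp]:
  assumes "iso_arr C f" "h \<in> Arr C"
  shows "Cod C h = Dom C f \<Longrightarrow> inv_arr C f \<cdot> f \<cdot> h = h"
    and "Cod C h = Cod C f \<Longrightarrow> f \<cdot> inv_arr C f \<cdot> h = h"
proof -
  note [simp] = iso_arr_Arr[OF assms(1)]
  show "Cod C h = Dom C f \<Longrightarrow> inv_arr C f \<cdot> f \<cdot> h = h"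
    using Comp_reduce[OF Comp_inv_left[OF assms(1)], of h] assms by simp
  show "Cod C h = Cod C f \<Longrightarrow> f \<cdot> inv_arr C f \<cdot> h = h"
    using Comp_reduce[OF Comp_inv_right[OF assms(1)], of h] assms by simp
qed

lemma iso_arrI:
  assumes "f \<in> Hom C X Y" "g \<in> Hom C Y X" "g \<cdot> f = Ide C X" "f \<cdot> g = Ide C Y"
  shows "iso_arr C f" "inv_arr C f = g"
proof -
  have "inverse_arrows C f g"
    using assms by (auto simp: inverse_arrows_def Hom_iff)
  then show "iso_arr C f" "inv_arr C f = g"
    by (auto simp: iso_arr_def intro: inv_arr_eqI)
qed

lemma iso_arr_Ide [simp]: "X \<in> Obj C \<Longrightarrow> iso_arr C (Ide C X)"
  by (rule iso_arrI[of _ X X "Ide C X"]) (simp_all add: Hom_iff)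

lemma iso_arr_Comp:
  assumes "iso_arr C f" "iso_arr C g" "Cod C f = Dom C g"
  shows "iso_arr C (g \<cdot> f)"
  using assms iso_arr_Arr[OF assms(1)] iso_arr_Arr[OF assms(2)]
  by (intro iso_arrI(1)[of _ "Dom C f" "Cod C g" "inv_arr C f \<cdot> inv_arr C g"]) (simp_all add: Hom_iff)

lemma iso_arr_inv_arr [simp]:
  assumes "iso_arr C f"
  shows "iso_arr C (inv_arr C f)"
  using assms iso_arr_Arr[OF assms]
  by (intro iso_arrI(1)[of _ "Cod C f" "Dom C f" f]) (simp_all add: Hom_iff)

lemma inv_arr_Ide: "X \<in> Obj C \<Longrightarrow> inv_arr C (Ide C X) = Ide C X"
  by (rule iso_arrI(2)[of _ X X]) (simp_all add: Hom_iff)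

lemma inv_arr_Comp:
  assumes "iso_arr C f" "iso_arr C g" "Cod C f = Dom C g"
  shows "inv_arr C (g \<cdot> f) = inv_arr C f \<cdot> inv_arr C g"
  using assms iso_arr_Arr[OF assms(1)] iso_arr_Arr[OF assms(2)]
  by (intro iso_arrI(2)[of _ "Dom C f" "Cod C g"]) (simp_all add: Hom_iff)

lemma iso_arr_right_cancel:
  assumes "f \<cdot> e = g \<cdot> e" "iso_arr C e" "f \<in> Arr C" "g \<in> Arr C" "Dom C f = Cod C e" "Dom C g = Cod C e"
  shows "f = g"
proof -
  note [simp] = iso_arr_Arr[OF assms(2)]
  have "f = (f \<cdot> e) \<cdot> inv_arr C e"
    using assms(2-) by simp
  also have "\<dots> = g"
    unfolding assms(1) using assms(2-) by simp
  finally show ?thesis .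
qed

lemma iso_arr_left_cancel:
  assumes "e \<cdot> f = e \<cdot> g" "iso_arr C e" "f \<in> Arr C" "g \<in> Arr C" "Cod C f = Dom C e" "Cod C g = Dom C e"
  shows "f = g"
proof -
  note [simp] = iso_arr_Arr[OF assms(2)]
  have "f = inv_arr C e \<cdot> (e \<cdot> f)"
    using assms(2-) by simp
  also have "\<dots> = g"
    unfolding assms(1) using assms(2-) by simp
  finally show ?thesis .
qed

text \<open>Inverting the vertical sides of a commuting square. It turns naturality of the
  associator and the unit constraints into naturality of their inverses.\<close>

lemma inv_arr_square:
  assumes "b \<cdot> f = g \<cdot> a" "iso_arr C a" "iso_arr C b"
    "f \<in> Hom C (Dom C a) (Dom C b)" "g \<in> Hom C (Cod C a) (Cod C b)"
  shows "inv_arr C b \<cdot> g = f \<cdot> inv_arr C a"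
proof -
  note [simp] = iso_arr_Arr[OF assms(2)] iso_arr_Arr[OF assms(3)] assms(2,3) assms(4,5)[unfolded Hom_iff]
  have "inv_arr C b \<cdot> g = inv_arr C b \<cdot> (g \<cdot> a) \<cdot> inv_arr C a"
    by simp
  also have "\<dots> = f \<cdot> inv_arr C a"
    unfolding assms(1)[symmetric] by simp
  finally show ?thesis .
qed

definition mono_arr :: "'a \<Rightarrow> bool" where
  "mono_arr e \<longleftrightarrow> e \<in> Arr C \<and> (\<forall>f g. f \<in> Arr C \<and> g \<in> Arr C \<and> Dom C f = Dom C g \<and>
     Cod C f = Dom C e \<and> Cod C g = Dom C e \<and> e \<cdot> f = e \<cdot> g \<longrightarrow> f = g)"

lemma mono_arr_Arr: "mono_arr e \<Longrightarrow> e \<in> Arr C"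
  by (simp add: mono_arr_def)

lemma mono_arrD:
  assumes "mono_arr e" "e \<cdot> f = e \<cdot> g" "f \<in> Hom C X Y" "g \<in> Hom C X Y" "Dom C e = Y"
  shows "f = g"
  using assms by (auto simp: mono_arr_def Hom_iff)

lemma mono_arr_iso:
  assumes "iso_arr C f"
  shows "mono_arr f"
  unfolding mono_arr_def
proof (intro conjI allI impI iso_arr_Arr[OF assms])
  fix g h assume *: "g \<in> Arr C \<and> h \<in> Arr C \<and> Dom C g = Dom C h \<and>
     Cod C g = Dom C f \<and> Cod C h = Dom C f \<and> f \<cdot> g = f \<cdot> h"
  then have "inv_arr C f \<cdot> f \<cdot> g = inv_arr C f \<cdot> f \<cdot> h"
    by simp
  moreover have "inv_arr C f \<cdot> f \<cdot> g = g" "inv_arr C f \<cdot> f \<cdot> h = h"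
    using * assms by (blast intro: Comp_inv_cancel)+
  ultimately show "g = h"
    by simp
qed

lemma mono_arr_Comp:
  assumes f: "mono_arr f" and g: "mono_arr g" and "Cod C f = Dom C g"
  shows "mono_arr (g \<cdot> f)"
  unfolding mono_arr_def
proof (intro conjI allI impI)
  note [simp] = mono_arr_Arr[OF f] mono_arr_Arr[OF g] assms(3)
  show "g \<cdot> f \<in> Arr C"
    by simp
  fix h k assume *: "h \<in> Arr C \<and> k \<in> Arr C \<and> Dom C h = Dom C k \<and>
     Cod C h = Dom C (g \<cdot> f) \<and> Cod C k = Dom C (g \<cdot> f) \<and> (g \<cdot> f) \<cdot> h = (g \<cdot> f) \<cdot> k"
  have **: "f \<cdot> h = f \<cdot> k"
    by (insert *, rule mono_arrD[OF g, of _ _ "Dom C h" "Dom C g"]) (auto simp: Hom_iff)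
  show "h = k"
    by (insert * **, rule mono_arrD[OF f, of _ _ "Dom C h" "Dom C f"]) (auto simp: Hom_iff)
qed

lemma equalizerD:
  assumes "is_equalizer C f g e"
  shows "f \<in> Arr C" "g \<in> Arr C" "e \<in> Arr C" "Dom C g = Dom C f" "Cod C g = Cod C f"
    "Cod C e = Dom C f" "f \<cdot> e = g \<cdot> e"
  using assms unfolding is_equalizer_def parallel_def by metis+

lemma equalizer_univ:
  assumes "is_equalizer C f g e" "h \<in> Arr C" "Cod C h = Dom C f" "f \<cdot> h = g \<cdot> h"
  shows "\<exists>!k. k \<in> Hom C (Dom C h) (Dom C e) \<and> e \<cdot> k = h"
  using assms unfolding is_equalizer_def by blast

lemma equalizer_factor:
  assumes "is_equalizer C f g e" "h \<in> Hom C Z (Dom C f)" "f \<cdot> h = g \<cdot> h"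
  obtains k where "k \<in> Hom C Z (Dom C e)" "e \<cdot> k = h"
  using assms unfolding is_equalizer_def Hom_iff by metis

lemma mono_arr_equalizer:
  assumes "is_equalizer C f g e"
  shows "mono_arr e"
  unfolding mono_arr_def
proof (intro conjI allI impI)
  note [simp] = equalizerD(1-6)[OF assms] and eq = equalizerD(7)[OF assms]
  show "e \<in> Arr C"
    by simp
  fix h k assume *: "h \<in> Arr C \<and> k \<in> Arr C \<and> Dom C h = Dom C k \<and>
     Cod C h = Dom C e \<and> Cod C k = Dom C e \<and> e \<cdot> h = e \<cdot> k"
  have "f \<cdot> e \<cdot> h = (f \<cdot> e) \<cdot> h"
    using * by simp
  also have "\<dots> = g \<cdot> e \<cdot> h"
    unfolding eq using * by simp
  finally have **: "f \<cdot> e \<cdot> h = g \<cdot> e \<cdot> h" .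
  have "\<exists>!l. l \<in> Hom C (Dom C (e \<cdot> h)) (Dom C e) \<and> e \<cdot> l = e \<cdot> h"
    using * ** by (intro equalizer_univ[OF assms]) simp_all
  with * show "h = k"
    by (auto simp: Hom_iff)
qed

text \<open>An isomorphism is monic, so both pairs equalize the same arrows. It is applied with
  \<open>i\<close> the inverse of \<open>\<phi>\<^sub>2\<close>, to pass from the
  \<open>F\<close>-image of the pair on \<open>A\<close> to the pair on \<open>F A\<close>.\<close>

lemma equalizer_postcompose_iso:
  assumes e: "is_equalizer C f g e" and i: "iso_arr C i" and "Dom C i = Cod C f"
  shows "is_equalizer C (i \<cdot> f) (i \<cdot> g) e"
proof -
  note [simp] = iso_arr_Arr[OF i] assms(3)
  note [simp] = equalizerD(1-6)[OF e] and eq = equalizerD(7)[OF e]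
  have *: "f \<cdot> h = g \<cdot> h" if "h \<in> Arr C" "Cod C h = Dom C f" "(i \<cdot> f) \<cdot> h = (i \<cdot> g) \<cdot> h" for h
    by (insert that, rule mono_arrD[OF mono_arr_iso[OF i], of _ _ "Dom C h" "Cod C f"]) (simp_all add: Hom_iff)
  show ?thesis
    unfolding is_equalizer_def
  proof (intro conjI ballI impI; (elim conjE)?)
    fix h assume "h \<in> Arr C" "Cod C h = Dom C (i \<cdot> f)" "(i \<cdot> f) \<cdot> h = (i \<cdot> g) \<cdot> h"
    then show "\<exists>!k. k \<in> Hom C (Dom C h) (Dom C e) \<and> e \<cdot> k = h"
      by (intro equalizer_univ[OF e] *) simp_all
  qed (simp_all add: parallel_def eq)
qed

text \<open>The universal property of \<open>e'\<close> supplies an arrow in the other direction;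
  the two composites are identities because \<open>e\<close> and \<open>e'\<close> are
  monic.\<close>

lemma iso_arr_equalizer_comparison:
  assumes e: "is_equalizer C f g e" and e': "is_equalizer C f g e'"
    and k: "k \<in> Hom C (Dom C e') (Dom C e)" "e \<cdot> k = e'"
  shows "iso_arr C k"
proof -
  note [simp] = equalizerD(1-6)[OF e] equalizerD(1-6)[OF e'] k(1)[unfolded Hom_iff]
  obtain k' where k': "k' \<in> Hom C (Dom C e) (Dom C e')" "e' \<cdot> k' = e"
    by (rule equalizer_factor[OF e', of e "Dom C e"]) (auto simp: Hom_iff equalizerD(7)[OF e])
  note [simp] = k'(1)[unfolded Hom_iff]
  have "e \<cdot> k \<cdot> k' = e \<cdot> Ide C (Dom C e)"
    by (simp add: Comp_reduce[OF k(2)] k'(2))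
  then have "k \<cdot> k' = Ide C (Dom C e)"
    by (rule mono_arrD[OF mono_arr_equalizer[OF e]]) (auto simp: Hom_iff)
  moreover have "e' \<cdot> k' \<cdot> k = e' \<cdot> Ide C (Dom C e')"
    by (simp add: Comp_reduce[OF k'(2)] k(2))
  then have "k' \<cdot> k = Ide C (Dom C e')"
    by (rule mono_arrD[OF mono_arr_equalizer[OF e']]) (auto simp: Hom_iff)
  ultimately show ?thesis
    using iso_arrI(1)[OF k(1) k'(1)] by simp
qed

end

section \<open>Coherence in monoidal categories\<close>

context monoidal_category
begin

lemma TenA_simps [simp]:
  assumes "f \<in> Arr M" "g \<in> Arr M"
  shows "f \<boxtimes> g \<in> Arr M" "Dom M (f \<boxtimes> g) = Dom M f \<boxdot> Dom M g" "Cod M (f \<boxtimes> g) = Cod M f \<boxdot> Cod M g"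
  using TenA_Hom[of f "Dom M f" "Cod M f" g "Dom M g" "Cod M g"] assms by (simp_all add: Hom_iff)

lemma Obj_simps [simp]:
  "X \<in> Obj M \<Longrightarrow> Y \<in> Obj M \<Longrightarrow> X \<boxdot> Y \<in> Obj M" "Unit M \<in> Obj M"
  by (simp_all add: TenO_Obj Unit_Obj)

lemma TenA_Ide_simp [simp]: "X \<in> Obj M \<Longrightarrow> Y \<in> Obj M \<Longrightarrow> Ide M X \<boxtimes> Ide M Y = Ide M (X \<boxdot> Y)"
  by (rule TenA_Ide)

lemma Assoc_simps [simp]:
  assumes "X \<in> Obj M" "Y \<in> Obj M" "Z \<in> Obj M"
  shows "Assoc M X Y Z \<in> Arr M" "Dom M (Assoc M X Y Z) = X \<boxdot> Y \<boxdot> Z"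
    "Cod M (Assoc M X Y Z) = X \<boxdot> (Y \<boxdot> Z)" "iso_arr M (Assoc M X Y Z)"
  using Assoc_Hom[OF assms] Assoc_iso[OF assms] by (simp_all add: Hom_iff)

lemma Unit_simps [simp]:
  assumes "X \<in> Obj M"
  shows "LUnit M X \<in> Arr M" "Dom M (LUnit M X) = Unit M \<boxdot> X" "Cod M (LUnit M X) = X" "iso_arr M (LUnit M X)"
    "RUnit M X \<in> Arr M" "Dom M (RUnit M X) = X \<boxdot> Unit M" "Cod M (RUnit M X) = X" "iso_arr M (RUnit M X)"
  using LUnit_Hom[OF assms] LUnit_iso[OF assms] RUnit_Hom[OF assms] RUnit_iso[OF assms]
  by (simp_all add: Hom_iff)

lemma interchange:
  assumes "f \<in> Arr M" "g \<in> Arr M" "f' \<in> Arr M" "g' \<in> Arr M" "Cod M f = Dom M g" "Cod M f' = Dom M g'"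
  shows "(g \<boxtimes> g') \<cdot> (f \<boxtimes> f') = (g \<cdot> f) \<boxtimes> (g' \<cdot> f')"
  using assms by (intro TenA_Comp[symmetric]) (auto simp: Hom_iff)

lemma interchange_Comp:
  assumes "f \<in> Arr M" "g \<in> Arr M" "f' \<in> Arr M" "g' \<in> Arr M" "Cod M f = Dom M g" "Cod M f' = Dom M g'"
    "h \<in> Arr M" "Cod M h = Dom M f \<boxdot> Dom M f'"
  shows "(g \<boxtimes> g') \<cdot> (f \<boxtimes> f') \<cdot> h = ((g \<cdot> f) \<boxtimes> (g' \<cdot> f')) \<cdot> h"
  using assms by (intro Comp_reduce interchange) simp_all

lemma Assoc_naturality:
  assumes "f \<in> Arr M" "g \<in> Arr M" "h \<in> Arr M"
  shows "Assoc M (Cod M f) (Cod M g) (Cod M h) \<cdot> ((f \<boxtimes> g) \<boxtimes> h)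
    = (f \<boxtimes> (g \<boxtimes> h)) \<cdot> Assoc M (Dom M f) (Dom M g) (Dom M h)"
  using assms by (intro Assoc_natural) (auto simp: Hom_iff)

lemma iso_arr_TenA:
  assumes "iso_arr M f" "iso_arr M g"
  shows "iso_arr M (f \<boxtimes> g)"
  using assms iso_arr_Arr[OF assms(1)] iso_arr_Arr[OF assms(2)]
  by (intro iso_arrI(1)[of _ "Dom M f \<boxdot> Dom M g" "Cod M f \<boxdot> Cod M g" "inv_arr M f \<boxtimes> inv_arr M g"])
    (simp_all add: Hom_iff interchange)

lemma whisker_left:
  assumes "f \<in> Arr M" "g \<in> Arr M" "Cod M f = Dom M g" "X \<in> Obj M"
  shows "Ide M X \<boxtimes> (g \<cdot> f) = (Ide M X \<boxtimes> g) \<cdot> (Ide M X \<boxtimes> f)"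
  using assms by (simp add: interchange)

lemma whisker_right:
  assumes "f \<in> Arr M" "g \<in> Arr M" "Cod M f = Dom M g" "X \<in> Obj M"
  shows "(g \<cdot> f) \<boxtimes> Ide M X = (g \<boxtimes> Ide M X) \<cdot> (f \<boxtimes> Ide M X)"
  using assms by (simp add: interchange)

lemma LUnit_naturality: "f \<in> Arr M \<Longrightarrow> LUnit M (Cod M f) \<cdot> (Ide M (Unit M) \<boxtimes> f) = f \<cdot> LUnit M (Dom M f)"
  by (rule LUnit_natural) (simp add: Hom_iff)

lemma RUnit_naturality: "f \<in> Arr M \<Longrightarrow> RUnit M (Cod M f) \<cdot> (f \<boxtimes> Ide M (Unit M)) = f \<cdot> RUnit M (Dom M f)"
  by (rule RUnit_natural) (simp add: Hom_iff)

text \<open>Naturality makes tensoring with the unit object conjugation by the invertible unit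
  constraints, hence faithful. This lets the coherence identities below be checked after tensoring
  with the unit.\<close>

lemma tensor_Unit_left_cancel:
  assumes "Ide M (Unit M) \<boxtimes> f = Ide M (Unit M) \<boxtimes> g"
    "f \<in> Arr M" "g \<in> Arr M" "Dom M f = Dom M g" "Cod M f = Cod M g"
  shows "f = g"
proof (rule iso_arr_right_cancel[of f "LUnit M (Dom M f)"])
  show "f \<cdot> LUnit M (Dom M f) = g \<cdot> LUnit M (Dom M f)"
    using assms LUnit_naturality[of f] LUnit_naturality[of g] by simp
qed (use assms in simp_all)

lemma tensor_Unit_right_cancel:
  assumes "f \<boxtimes> Ide M (Unit M) = g \<boxtimes> Ide M (Unit M)"
    "f \<in> Arr M" "g \<in> Arr M" "Dom M f = Dom M g" "Cod M f = Cod M g"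
  shows "f = g"
proof (rule iso_arr_right_cancel[of f "RUnit M (Dom M f)"])
  show "f \<cdot> RUnit M (Dom M f) = g \<cdot> RUnit M (Dom M f)"
    using assms RUnit_naturality[of f] RUnit_naturality[of g] by simp
qed (use assms in simp_all)

text \<open>Kelly's argument: the two sides are compared after tensoring with the unit on the right
  and composing with an invertible associator. The pentagon for \<open>X\<close>, \<open>Y\<close>,
  unit, unit and two instances of the triangle then identify them.\<close>

lemma RUnit_TenO:
  assumes [simp]: "X \<in> Obj M" "Y \<in> Obj M"
  shows "RUnit M (X \<boxdot> Y) = (Ide M X \<boxtimes> RUnit M Y) \<cdot> Assoc M X Y (Unit M)"
proof -
  let ?I = "Unit M"
  let ?r = "(Ide M X \<boxtimes> RUnit M Y) \<cdot> Assoc M X Y ?I"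
  have n1: "Assoc M X Y ?I \<cdot> ((Ide M X \<boxtimes> RUnit M Y) \<boxtimes> Ide M ?I)
      = (Ide M X \<boxtimes> (RUnit M Y \<boxtimes> Ide M ?I)) \<cdot> Assoc M X (Y \<boxdot> ?I) ?I"
    using Assoc_naturality[of "Ide M X" "RUnit M Y" "Ide M ?I"] by simp
  have n2: "Assoc M X Y ?I \<cdot> (Ide M (X \<boxdot> Y) \<boxtimes> LUnit M ?I)
      = (Ide M X \<boxtimes> (Ide M Y \<boxtimes> LUnit M ?I)) \<cdot> Assoc M X Y (?I \<boxdot> ?I)"
    using Assoc_naturality[of "Ide M X" "Ide M Y" "LUnit M ?I"] by simp
  have p: "(Ide M X \<boxtimes> Assoc M Y ?I ?I) \<cdot> Assoc M X (Y \<boxdot> ?I) ?I \<cdot> (Assoc M X Y ?I \<boxtimes> Ide M ?I)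
      = Assoc M X Y (?I \<boxdot> ?I) \<cdot> Assoc M (X \<boxdot> Y) ?I ?I"
    by (rule pentagon) simp_all
  have t: "RUnit M Y \<boxtimes> Ide M ?I = (Ide M Y \<boxtimes> LUnit M ?I) \<cdot> Assoc M Y ?I ?I"
    by (rule triangle[symmetric]) simp_all
  have "Assoc M X Y ?I \<cdot> (?r \<boxtimes> Ide M ?I)
      = Assoc M X Y ?I \<cdot> ((Ide M X \<boxtimes> RUnit M Y) \<boxtimes> Ide M ?I) \<cdot> (Assoc M X Y ?I \<boxtimes> Ide M ?I)"
    by (subst whisker_right) simp_all
  also have "\<dots> = (Ide M X \<boxtimes> (RUnit M Y \<boxtimes> Ide M ?I)) \<cdot> Assoc M X (Y \<boxdot> ?I) ?I \<cdot> (Assoc M X Y ?I \<boxtimes> Ide M ?I)"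
    by (subst Comp_reduce[OF n1]) simp_all
  also have "\<dots> = (Ide M X \<boxtimes> (Ide M Y \<boxtimes> LUnit M ?I)) \<cdot> (Ide M X \<boxtimes> Assoc M Y ?I ?I)
      \<cdot> Assoc M X (Y \<boxdot> ?I) ?I \<cdot> (Assoc M X Y ?I \<boxtimes> Ide M ?I)"
    unfolding t by (subst whisker_left) simp_all
  also have "\<dots> = (Ide M X \<boxtimes> (Ide M Y \<boxtimes> LUnit M ?I)) \<cdot> Assoc M X Y (?I \<boxdot> ?I) \<cdot> Assoc M (X \<boxdot> Y) ?I ?I"
    unfolding p ..
  also have "\<dots> = Assoc M X Y ?I \<cdot> (Ide M (X \<boxdot> Y) \<boxtimes> LUnit M ?I) \<cdot> Assoc M (X \<boxdot> Y) ?I ?I"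
    by (subst Comp_reduce[OF n2]) simp_all
  also have "\<dots> = Assoc M X Y ?I \<cdot> (RUnit M (X \<boxdot> Y) \<boxtimes> Ide M ?I)"
    using triangle[of "X \<boxdot> Y" ?I] by simp
  finally have "?r \<boxtimes> Ide M ?I = RUnit M (X \<boxdot> Y) \<boxtimes> Ide M ?I"
    by (rule iso_arr_left_cancel) simp_all
  then have "?r = RUnit M (X \<boxdot> Y)"
    by (rule tensor_Unit_right_cancel) simp_all
  then show ?thesis
    by (rule sym)
qed

text \<open>The mirror argument: tensor with the unit on the left and use the pentagon for unit,
  unit, \<open>X\<close>, \<open>Y\<close>. The invertible composite \<open>?e\<close> common to
  both sides is cancelled on the right.\<close>

lemma LUnit_TenO:
  assumes [simp]: "X \<in> Obj M" "Y \<in> Obj M"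
  shows "LUnit M (X \<boxdot> Y) \<cdot> Assoc M (Unit M) X Y = LUnit M X \<boxtimes> Ide M Y"
proof -
  let ?I = "Unit M"
  let ?l = "LUnit M (X \<boxdot> Y) \<cdot> Assoc M ?I X Y" and ?e = "Assoc M ?I (?I \<boxdot> X) Y \<cdot> (Assoc M ?I ?I X \<boxtimes> Ide M Y)"
  have n1: "Assoc M ?I X Y \<cdot> ((Ide M ?I \<boxtimes> LUnit M X) \<boxtimes> Ide M Y)
      = (Ide M ?I \<boxtimes> (LUnit M X \<boxtimes> Ide M Y)) \<cdot> Assoc M ?I (?I \<boxdot> X) Y"
    using Assoc_naturality[of "Ide M ?I" "LUnit M X" "Ide M Y"] by simp
  have n2: "Assoc M ?I X Y \<cdot> ((RUnit M ?I \<boxtimes> Ide M X) \<boxtimes> Ide M Y)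
      = (RUnit M ?I \<boxtimes> Ide M (X \<boxdot> Y)) \<cdot> Assoc M (?I \<boxdot> ?I) X Y"
    using Assoc_naturality[of "RUnit M ?I" "Ide M X" "Ide M Y"] by simp
  have p: "(Ide M ?I \<boxtimes> Assoc M ?I X Y) \<cdot> ?e = Assoc M ?I ?I (X \<boxdot> Y) \<cdot> Assoc M (?I \<boxdot> ?I) X Y"
    by (rule pentagon) simp_all
  have t: "(Ide M ?I \<boxtimes> LUnit M X) \<cdot> Assoc M ?I ?I X = RUnit M ?I \<boxtimes> Ide M X"
     "(Ide M ?I \<boxtimes> LUnit M (X \<boxdot> Y)) \<cdot> Assoc M ?I ?I (X \<boxdot> Y) = RUnit M ?I \<boxtimes> Ide M (X \<boxdot> Y)"
    by (rule triangle; simp)+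
  have "(Ide M ?I \<boxtimes> ?l) \<cdot> ?e = (Ide M ?I \<boxtimes> LUnit M (X \<boxdot> Y)) \<cdot> (Ide M ?I \<boxtimes> Assoc M ?I X Y) \<cdot> ?e"
    by (subst whisker_left) simp_all
  also have "\<dots> = (RUnit M ?I \<boxtimes> Ide M (X \<boxdot> Y)) \<cdot> Assoc M (?I \<boxdot> ?I) X Y"
    unfolding p by (subst Comp_reduce[OF t(2)]) simp_all
  also have "\<dots> = Assoc M ?I X Y \<cdot> ((Ide M ?I \<boxtimes> LUnit M X) \<boxtimes> Ide M Y) \<cdot> (Assoc M ?I ?I X \<boxtimes> Ide M Y)"
    unfolding n2[symmetric] t(1)[symmetric] by (subst whisker_right) simp_all
  also have "\<dots> = (Ide M ?I \<boxtimes> (LUnit M X \<boxtimes> Ide M Y)) \<cdot> ?e"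
    by (subst Comp_reduce[OF n1]) simp_all
  finally have "Ide M ?I \<boxtimes> ?l = Ide M ?I \<boxtimes> (LUnit M X \<boxtimes> Ide M Y)"
    by (rule iso_arr_right_cancel) (auto intro!: iso_arr_Comp iso_arr_TenA)
  then show ?thesis
    by (rule tensor_Unit_left_cancel) simp_all
qed

lemma Assoc_inv_naturality:
  assumes "f \<in> Arr M" "g \<in> Arr M" "h \<in> Arr M"
  shows "inv_arr M (Assoc M (Cod M f) (Cod M g) (Cod M h)) \<cdot> (f \<boxtimes> (g \<boxtimes> h))
    = ((f \<boxtimes> g) \<boxtimes> h) \<cdot> inv_arr M (Assoc M (Dom M f) (Dom M g) (Dom M h))"
  using assms by (intro inv_arr_square Assoc_naturality) (simp_all add: Hom_iff)

lemma LUnit_inv_naturality: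
  "f \<in> Arr M \<Longrightarrow> inv_arr M (LUnit M (Cod M f)) \<cdot> f = (Ide M (Unit M) \<boxtimes> f) \<cdot> inv_arr M (LUnit M (Dom M f))"
  by (intro inv_arr_square LUnit_naturality) (simp_all add: Hom_iff)

lemma RUnit_inv_naturality:
  "f \<in> Arr M \<Longrightarrow> inv_arr M (RUnit M (Cod M f)) \<cdot> f = (f \<boxtimes> Ide M (Unit M)) \<cdot> inv_arr M (RUnit M (Dom M f))"
  by (intro inv_arr_square RUnit_naturality) (simp_all add: Hom_iff)

lemma inv_arr_TenA:
  assumes "iso_arr M f" "iso_arr M g"
  shows "inv_arr M (f \<boxtimes> g) = inv_arr M f \<boxtimes> inv_arr M g"
  using assms iso_arr_Arr[OF assms(1)] iso_arr_Arr[OF assms(2)]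
  by (intro iso_arrI(2)[of _ "Dom M f \<boxdot> Dom M g" "Cod M f \<boxdot> Cod M g"]) (simp_all add: Hom_iff interchange)

text \<open>The coherence identities in the direction in which the unit of an algebra is inserted,
  since those insertions begin with an inverse unit constraint.\<close>

lemma coherence_inv:
  assumes [simp]: "X \<in> Obj M" "Y \<in> Obj M"
  shows RUnit_TenO_inv: "inv_arr M (Assoc M X Y (Unit M)) \<cdot> (Ide M X \<boxtimes> inv_arr M (RUnit M Y))
      = inv_arr M (RUnit M (X \<boxdot> Y))"
    and LUnit_TenO_inv: "inv_arr M (LUnit M X) \<boxtimes> Ide M Y
      = inv_arr M (Assoc M (Unit M) X Y) \<cdot> inv_arr M (LUnit M (X \<boxdot> Y))"
    and triangle_inv: "inv_arr M (Assoc M X (Unit M) Y) \<cdot> (Ide M X \<boxtimes> inv_arr M (LUnit M Y))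
      = inv_arr M (RUnit M X) \<boxtimes> Ide M Y"
proof -
  show "inv_arr M (Assoc M X Y (Unit M)) \<cdot> (Ide M X \<boxtimes> inv_arr M (RUnit M Y)) = inv_arr M (RUnit M (X \<boxdot> Y))"
    unfolding RUnit_TenO[OF assms] by (simp add: inv_arr_Comp inv_arr_TenA inv_arr_Ide iso_arr_TenA)
  show "inv_arr M (LUnit M X) \<boxtimes> Ide M Y = inv_arr M (Assoc M (Unit M) X Y) \<cdot> inv_arr M (LUnit M (X \<boxdot> Y))"
    using arg_cong[OF LUnit_TenO[OF assms], of "inv_arr M"]
    by (simp add: inv_arr_Comp inv_arr_TenA inv_arr_Ide)
  show "inv_arr M (Assoc M X (Unit M) Y) \<cdot> (Ide M X \<boxtimes> inv_arr M (LUnit M Y)) = inv_arr M (RUnit M X) \<boxtimes> Ide M Y"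
    using arg_cong[OF triangle[OF assms], of "inv_arr M"]
    by (simp add: inv_arr_Comp inv_arr_TenA inv_arr_Ide iso_arr_TenA)
qed

end

section \<open>Transport along a monoidal functor\<close>

context is_functor
begin

lemma on_arr_simps [simp]:
  assumes "f \<in> Arr C"
  shows "on_arr F f \<in> Arr D" "Dom D (on_arr F f) = on_obj F (Dom C f)" "Cod D (on_arr F f) = on_obj F (Cod C f)"
  using on_arr_Hom[of f "Dom C f" "Cod C f"] assms by (simp_all add: dom.Hom_iff cod.Hom_iff)

lemma on_obj_simp [simp]: "X \<in> Obj C \<Longrightarrow> on_obj F X \<in> Obj D"
  by (rule on_obj_Obj)

lemma on_arr_Ide_simp [simp]: "X \<in> Obj C \<Longrightarrow> on_arr F (Ide C X) = Ide D (on_obj F X)"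
  by (rule on_arr_Ide)

lemma on_arr_Comp_arr:
  assumes "f \<in> Arr C" "g \<in> Arr C" "Cod C f = Dom C g"
  shows "on_arr F (g \<cdot>\<^bsub>C\<^esub> f) = on_arr F g \<cdot>\<^bsub>D\<^esub> on_arr F f"
  using assms by (intro on_arr_Comp) (auto simp: dom.Hom_iff)

lemma iso_arr_on_arr:
  assumes "iso_arr C f"
  shows "iso_arr D (on_arr F f)" "inv_arr D (on_arr F f) = on_arr F (inv_arr C f)"
proof -
  note [simp] = dom.iso_arr_Arr[OF assms]
  have "on_arr F (inv_arr C f) \<cdot>\<^bsub>D\<^esub> on_arr F f = Ide D (on_obj F (Dom C f))"
       "on_arr F f \<cdot>\<^bsub>D\<^esub> on_arr F (inv_arr C f) = Ide D (on_obj F (Cod C f))"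
    using assms by (simp_all flip: on_arr_Comp_arr)
  then show "iso_arr D (on_arr F f)" "inv_arr D (on_arr F f) = on_arr F (inv_arr C f)"
    by (rule cod.iso_arrI[rotated 2]; use assms in \<open>simp add: cod.Hom_iff\<close>)+
qed

end

context monoidal_functor
begin

lemma \<phi>0_simps [simp]:
  "\<phi>\<^sub>0 \<in> Arr N" "Dom N \<phi>\<^sub>0 = Unit N" "Cod N \<phi>\<^sub>0 = on_obj F (Unit M)" "iso_arr N \<phi>\<^sub>0"
  using \<phi>0_Hom \<phi>0_iso by (simp_all add: tgt.Hom_iff)

lemma \<phi>2_simps [simp]:
  assumes "X \<in> Obj M" "Y \<in> Obj M"
  shows "\<phi>\<^sub>2 X Y \<in> Arr N" "Dom N (\<phi>\<^sub>2 X Y) = on_obj F X \<boxdot>\<^bsub>N\<^esub> on_obj F Y"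
    "Cod N (\<phi>\<^sub>2 X Y) = on_obj F (X \<boxdot>\<^bsub>M\<^esub> Y)" "iso_arr N (\<phi>\<^sub>2 X Y)"
  using \<phi>2_Hom[OF assms] \<phi>2_iso[OF assms] by (simp_all add: tgt.Hom_iff)

lemma \<phi>2_naturality:
  assumes "f \<in> Arr M" "g \<in> Arr M"
  shows "on_arr F (f \<boxtimes>\<^bsub>M\<^esub> g) \<cdot>\<^bsub>N\<^esub> \<phi>\<^sub>2 (Dom M f) (Dom M g)
    = \<phi>\<^sub>2 (Cod M f) (Cod M g) \<cdot>\<^bsub>N\<^esub> (on_arr F f \<boxtimes>\<^bsub>N\<^esub> on_arr F g)"
  using assms by (intro \<phi>2_natural[symmetric]) (auto simp: src.Hom_iff)

text \<open>
  Every axiom of a (co)algebra or braiding is an equation between composites and tensor products of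
  structure maps and constraints. A frame \<open>a = (X, \<alpha>)\<close> is an arrow \<open>\<alpha> : X' \<rightarrow> F X\<close>, and
  \<open>transport a f f' b\<close> is the commuting square \<open>F f \<circ> \<alpha> = \<beta> \<circ> f'\<close>. Such squares are closed
  under all these operations, so an equation in \<open>M\<close> yields the corresponding equation in \<open>N\<close> as
  soon as \<open>\<beta>\<close> is monic. With \<open>\<alpha>\<close> an identity this gives the functors induced by \<open>F\<close>; with \<open>F\<close>
  the identity functor and \<open>\<alpha>\<close> a monomorphism it gives structures on subobjects.
\<close>

definition frame :: "'o \<times> 'b \<Rightarrow> 'o \<Rightarrow> 'p \<Rightarrow> bool" where
  "frame a X X' \<longleftrightarrow> X \<in> Obj M \<and> fst a = X \<and> snd a \<in> Hom N X' (on_obj F X)"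

text \<open>A frame stores its object of \<open>M\<close> beside the arrow because
  \<open>on_obj F\<close> need not be injective: the codomain of the arrow does not determine the
  indices of \<open>\<phi>\<^sub>2\<close>.\<close>

definition frame_tensor :: "'o \<times> 'b \<Rightarrow> 'o \<times> 'b \<Rightarrow> 'o \<times> 'b"  (infixl "\<star>" 65) where
  "a \<star> b = (fst a \<boxdot>\<^bsub>M\<^esub> fst b, \<phi>\<^sub>2 (fst a) (fst b) \<cdot>\<^bsub>N\<^esub> (snd a \<boxtimes>\<^bsub>N\<^esub> snd b))"

definition frame_unit :: "'o \<times> 'b" where
  "frame_unit = (Unit M, \<phi>\<^sub>0)"

definition transport :: "'o \<times> 'b \<Rightarrow> 'a \<Rightarrow> 'b \<Rightarrow> 'o \<times> 'b \<Rightarrow> bool" where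
  "transport a f f' b \<longleftrightarrow> frame a (Dom M f) (Dom N f') \<and> frame b (Cod M f) (Cod N f') \<and>
     f \<in> Arr M \<and> f' \<in> Arr N \<and> on_arr F f \<cdot>\<^bsub>N\<^esub> snd a = snd b \<cdot>\<^bsub>N\<^esub> f'"

lemma frameD:
  assumes "frame a X X'"
  shows "X \<in> Obj M" "fst a = X" "snd a \<in> Arr N" "Dom N (snd a) = X'" "Cod N (snd a) = on_obj F X" "X' \<in> Obj N"
  using assms by (auto simp: frame_def tgt.Hom_iff)

lemma frame_tensor_frame:
  assumes "frame a X X'" "frame b Y Y'"
  shows "frame (a \<star> b) (X \<boxdot>\<^bsub>M\<^esub> Y) (X' \<boxdot>\<^bsub>N\<^esub> Y')"
  using frameD[OF assms(1)] frameD[OF assms(2)] by (simp add: frame_def frame_tensor_def tgt.Hom_iff)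

lemma frame_unit_frame: "frame frame_unit (Unit M) (Unit N)"
  by (simp add: frame_def frame_unit_def tgt.Hom_iff)

lemma transport_Hom:
  assumes "transport a f f' b" "frame a X X'" "frame b Y Y'"
  shows "f' \<in> Hom N X' Y'"
proof -
  have "frame a (Dom M f) (Dom N f')" "frame b (Cod M f) (Cod N f')" "f' \<in> Arr N"
    using assms(1) by (simp_all add: transport_def)
  with frameD(4)[OF assms(2)] frameD(4)[OF assms(3)] show ?thesis
    by (simp add: tgt.Hom_iff frame_def)
qed

text \<open>Both squares have the same upper composite once \<open>f = g\<close>, so
  \<open>f'\<close> and \<open>g'\<close> are factorizations of one arrow through the monic
  \<open>snd b\<close>. This is the step that brings an axiom from \<open>M\<close> to
  \<open>N\<close>.\<close>

lemma transport_eqI: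
  assumes "transport a f f' b" "transport a g g' b" "tgt.mono_arr (snd b)" "f = g"
  shows "f' = g'"
proof -
  have "frame a (Dom M f) (Dom N f')" "frame b (Cod M f) (Cod N f')" "frame a (Dom M g) (Dom N g')"
    "frame b (Cod M g) (Cod N g')" and [simp]: "f' \<in> Arr N" "g' \<in> Arr N"
    and eq: "snd b \<cdot>\<^bsub>N\<^esub> f' = snd b \<cdot>\<^bsub>N\<^esub> g'"
    using assms by (auto simp: transport_def)
  note D = this(1-4)[THEN frameD(4)]
  show ?thesis
    using D by (auto intro: tgt.mono_arrD[OF assms(3) eq, of "Dom N f'" "Cod N f'"] simp: tgt.Hom_iff)
qed

lemma transport_Comp:
  assumes "transport a f f' b" "transport b g g' c"
  shows "transport a (g \<cdot>\<^bsub>M\<^esub> f) (g' \<cdot>\<^bsub>N\<^esub> f') c"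
proof -
  have a: "frame a (Dom M f) (Dom N f')" and b: "frame b (Cod M f) (Cod N f')"
    and b': "frame b (Dom M g) (Dom N g')" and c: "frame c (Cod M g) (Cod N g')"
    and [simp]: "f \<in> Arr M" "f' \<in> Arr N" "g \<in> Arr M" "g' \<in> Arr N"
    and f: "on_arr F f \<cdot>\<^bsub>N\<^esub> snd a = snd b \<cdot>\<^bsub>N\<^esub> f'" and g: "on_arr F g \<cdot>\<^bsub>N\<^esub> snd b = snd c \<cdot>\<^bsub>N\<^esub> g'"
    using assms by (auto simp: transport_def)
  note [simp] = frameD(3-5)[OF a] frameD(3-5)[OF b] frameD(3-5)[OF c]
  \<comment> \<open>The shared frame \<open>b\<close> fixes both middle objects: the stored object
    in \<open>M\<close> and the domain of its arrow in \<open>N\<close>. Composability is therefore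
    not a separate premise.\<close>
  have [simp]: "Dom M g = Cod M f" "Dom N g' = Cod N f'"
    using frameD(2,4)[OF b] frameD(2,4)[OF b'] by simp_all
  have "on_arr F (g \<cdot>\<^bsub>M\<^esub> f) \<cdot>\<^bsub>N\<^esub> snd a = on_arr F g \<cdot>\<^bsub>N\<^esub> snd b \<cdot>\<^bsub>N\<^esub> f'"
    by (simp add: on_arr_Comp_arr f)
  also have "\<dots> = snd c \<cdot>\<^bsub>N\<^esub> g' \<cdot>\<^bsub>N\<^esub> f'"
    by (subst tgt.Comp_reduce[OF g]) simp_all
  finally show ?thesis
    using a c by (simp add: transport_def)
qed

lemma transport_Ide:
  assumes "frame a X X'"
  shows "transport a (Ide M X) (Ide N X') a"
  using assms frameD[OF assms] by (simp add: transport_def)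

text \<open>Naturality of \<open>\<phi>\<^sub>2\<close> moves the tensor product inside, and
  interchange applies the two given squares factor by factor.\<close>

lemma transport_TenA:
  assumes "transport a f f' b" "transport c g g' d"
  shows "transport (a \<star> c) (f \<boxtimes>\<^bsub>M\<^esub> g) (f' \<boxtimes>\<^bsub>N\<^esub> g') (b \<star> d)"
proof -
  have fr: "frame a (Dom M f) (Dom N f')" "frame b (Cod M f) (Cod N f')"
     "frame c (Dom M g) (Dom N g')" "frame d (Cod M g) (Cod N g')"
    and [simp]: "f \<in> Arr M" "f' \<in> Arr N" "g \<in> Arr M" "g' \<in> Arr N"
    and f: "on_arr F f \<cdot>\<^bsub>N\<^esub> snd a = snd b \<cdot>\<^bsub>N\<^esub> f'" and g: "on_arr F g \<cdot>\<^bsub>N\<^esub> snd c = snd d \<cdot>\<^bsub>N\<^esub> g'"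
    using assms by (auto simp: transport_def)
  note [simp] = fr[THEN frameD(2)] fr[THEN frameD(3)] fr[THEN frameD(4)] fr[THEN frameD(5)]
  have "on_arr F (f \<boxtimes>\<^bsub>M\<^esub> g) \<cdot>\<^bsub>N\<^esub> snd (a \<star> c)
      = \<phi>\<^sub>2 (Cod M f) (Cod M g) \<cdot>\<^bsub>N\<^esub> (on_arr F f \<boxtimes>\<^bsub>N\<^esub> on_arr F g) \<cdot>\<^bsub>N\<^esub> (snd a \<boxtimes>\<^bsub>N\<^esub> snd c)"
    by (simp add: frame_tensor_def tgt.Comp_reduce[OF \<phi>2_naturality])
  also have "\<dots> = snd (b \<star> d) \<cdot>\<^bsub>N\<^esub> (f' \<boxtimes>\<^bsub>N\<^esub> g')"
    by (simp add: frame_tensor_def tgt.interchange f g)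
  finally show ?thesis
    using fr by (simp add: transport_def frame_tensor_frame)
qed

lemma transport_inv_arr:
  assumes "transport a f f' b" "iso_arr M f" "iso_arr N f'"
  shows "transport b (inv_arr M f) (inv_arr N f') a"
proof -
  have fr: "frame a (Dom M f) (Dom N f')" "frame b (Cod M f) (Cod N f')"
    and [simp]: "f \<in> Arr M" "f' \<in> Arr N" "iso_arr M f" "iso_arr N f'"
    and f: "on_arr F f \<cdot>\<^bsub>N\<^esub> snd a = snd b \<cdot>\<^bsub>N\<^esub> f'"
    using assms by (auto simp: transport_def)
  note [simp] = fr[THEN frameD(2)] fr[THEN frameD(3)] fr[THEN frameD(4)] fr[THEN frameD(5)]
  have "on_arr F (inv_arr M f) \<cdot>\<^bsub>N\<^esub> snd b = on_arr F (inv_arr M f) \<cdot>\<^bsub>N\<^esub> (snd b \<cdot>\<^bsub>N\<^esub> f') \<cdot>\<^bsub>N\<^esub> inv_arr N f'"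
    by simp
  also have "\<dots> = snd a \<cdot>\<^bsub>N\<^esub> inv_arr N f'"
    by (simp add: iso_arr_on_arr flip: f iso_arr_on_arr(2))
  finally show ?thesis
    using fr by (simp add: transport_def)
qed

text \<open>The associativity axiom of \<open>\<phi>\<^sub>2\<close> gives the square for identity
  frames; naturality of the associator of \<open>N\<close> then lets arbitrary frames slide past
  it.\<close>

lemma transport_Assoc:
  assumes "frame a X X'" "frame b Y Y'" "frame c Z Z'"
  shows "transport (a \<star> b \<star> c) (Assoc M X Y Z) (Assoc N X' Y' Z') (a \<star> (b \<star> c))"
proof -
  note [simp] = frameD[OF assms(1)] frameD[OF assms(2)] frameD[OF assms(3)]
  have nat: "Assoc N (on_obj F X) (on_obj F Y) (on_obj F Z) \<cdot>\<^bsub>N\<^esub> (snd a \<boxtimes>\<^bsub>N\<^esub> snd b \<boxtimes>\<^bsub>N\<^esub> snd c)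
      = (snd a \<boxtimes>\<^bsub>N\<^esub> (snd b \<boxtimes>\<^bsub>N\<^esub> snd c)) \<cdot>\<^bsub>N\<^esub> Assoc N X' Y' Z'"
    using tgt.Assoc_naturality[of "snd a" "snd b" "snd c"] by simp
  have "on_arr F (Assoc M X Y Z) \<cdot>\<^bsub>N\<^esub> snd (a \<star> b \<star> c)
    = (on_arr F (Assoc M X Y Z) \<cdot>\<^bsub>N\<^esub> \<phi>\<^sub>2 (X \<boxdot>\<^bsub>M\<^esub> Y) Z \<cdot>\<^bsub>N\<^esub> (\<phi>\<^sub>2 X Y \<boxtimes>\<^bsub>N\<^esub> Ide N (on_obj F Z)))
       \<cdot>\<^bsub>N\<^esub> (snd a \<boxtimes>\<^bsub>N\<^esub> snd b \<boxtimes>\<^bsub>N\<^esub> snd c)"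
    by (simp add: frame_tensor_def tgt.interchange)
  also have "\<dots> = \<phi>\<^sub>2 X (Y \<boxdot>\<^bsub>M\<^esub> Z) \<cdot>\<^bsub>N\<^esub> (Ide N (on_obj F X) \<boxtimes>\<^bsub>N\<^esub> \<phi>\<^sub>2 Y Z)
       \<cdot>\<^bsub>N\<^esub> Assoc N (on_obj F X) (on_obj F Y) (on_obj F Z) \<cdot>\<^bsub>N\<^esub> (snd a \<boxtimes>\<^bsub>N\<^esub> snd b \<boxtimes>\<^bsub>N\<^esub> snd c)"
    by (subst \<phi>2_Assoc) simp_all
  also have "\<dots> = snd (a \<star> (b \<star> c)) \<cdot>\<^bsub>N\<^esub> Assoc N X' Y' Z'"
    unfolding nat by (simp add: frame_tensor_def tgt.interchange_Comp)
  finally show ?thesis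
    using assms by (simp add: transport_def frame_tensor_frame)
qed

lemma transport_LUnit:
  assumes "frame a X X'"
  shows "transport (frame_unit \<star> a) (LUnit M X) (LUnit N X') a"
proof -
  note [simp] = frameD[OF assms]
  have "on_arr F (LUnit M X) \<cdot>\<^bsub>N\<^esub> snd (frame_unit \<star> a)
    = (on_arr F (LUnit M X) \<cdot>\<^bsub>N\<^esub> \<phi>\<^sub>2 (Unit M) X \<cdot>\<^bsub>N\<^esub> (\<phi>\<^sub>0 \<boxtimes>\<^bsub>N\<^esub> Ide N (on_obj F X))) \<cdot>\<^bsub>N\<^esub> (Ide N (Unit N) \<boxtimes>\<^bsub>N\<^esub> snd a)"
    by (simp add: frame_tensor_def frame_unit_def tgt.interchange)
  also have "\<dots> = snd a \<cdot>\<^bsub>N\<^esub> LUnit N X'"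
    using tgt.LUnit_naturality[of "snd a"] by (simp add: \<phi>2_LUnit)
  finally show ?thesis
    using assms by (simp add: transport_def frame_tensor_frame frame_unit_frame)
qed

lemma transport_RUnit:
  assumes "frame a X X'"
  shows "transport (a \<star> frame_unit) (RUnit M X) (RUnit N X') a"
proof -
  note [simp] = frameD[OF assms]
  have "on_arr F (RUnit M X) \<cdot>\<^bsub>N\<^esub> snd (a \<star> frame_unit)
    = (on_arr F (RUnit M X) \<cdot>\<^bsub>N\<^esub> \<phi>\<^sub>2 X (Unit M) \<cdot>\<^bsub>N\<^esub> (Ide N (on_obj F X) \<boxtimes>\<^bsub>N\<^esub> \<phi>\<^sub>0)) \<cdot>\<^bsub>N\<^esub> (snd a \<boxtimes>\<^bsub>N\<^esub> Ide N (Unit N))"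
    by (simp add: frame_tensor_def frame_unit_def tgt.interchange)
  also have "\<dots> = snd a \<cdot>\<^bsub>N\<^esub> RUnit N X'"
    using tgt.RUnit_naturality[of "snd a"] by (simp add: \<phi>2_RUnit)
  finally show ?thesis
    using assms by (simp add: transport_def frame_tensor_frame frame_unit_frame)
qed

lemma transport_coherence_inv:
  shows transport_Assoc_inv: "frame a X X' \<Longrightarrow> frame b Y Y' \<Longrightarrow> frame c Z Z'
      \<Longrightarrow> transport (a \<star> (b \<star> c)) (inv_arr M (Assoc M X Y Z)) (inv_arr N (Assoc N X' Y' Z')) (a \<star> b \<star> c)"
    and transport_LUnit_inv: "frame a X X'
      \<Longrightarrow> transport a (inv_arr M (LUnit M X)) (inv_arr N (LUnit N X')) (frame_unit \<star> a)"
    and transport_RUnit_inv: "frame a X X'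
      \<Longrightarrow> transport a (inv_arr M (RUnit M X)) (inv_arr N (RUnit N X')) (a \<star> frame_unit)"
  by (intro transport_inv_arr transport_Assoc transport_LUnit transport_RUnit; simp add: frameD)+

lemmas transport_intros = transport_Comp transport_Ide transport_TenA transport_Assoc transport_LUnit
  transport_RUnit transport_coherence_inv frame_tensor_frame frame_unit_frame

text \<open>All three are composites and tensor products of \<open>c\<close> with identities,
  associators and their inverses, so the closure rules apply after unfolding.\<close>

lemma transport_braidings:
  assumes "frame a V V'" "transport (a \<star> a) c c' (a \<star> a)"
  shows transport_br12: "transport (a \<star> a \<star> a) (br12 M V c) (br12 N V' c') (a \<star> a \<star> a)"
    and transport_br23: "transport (a \<star> a \<star> a) (br23 M V c) (br23 N V' c') (a \<star> a \<star> a)"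
    and transport_mid_braid: "transport (a \<star> a \<star> (a \<star> a)) (mid_braid M V c) (mid_braid N V' c') (a \<star> a \<star> (a \<star> a))"
  unfolding mid_braid_def br23_def br12_def by ((rule assms transport_intros)+)

end

section \<open>Categories of braided objects and braided bialgebras\<close>

context monoidal_category
begin

lemma braided_objectD:
  assumes "braided_object M V c"
  shows "V \<in> Obj M" "c \<in> Arr M" "Dom M c = V \<boxdot> V" "Cod M c = V \<boxdot> V" "iso_arr M c"
  using assms by (auto simp: braided_object_def Hom_iff)

lemma braided_morphismD:
  assumes "braided_morphism M V f W"
  shows "f \<in> Arr M" "Dom M f = fst V" "Cod M f = fst W" "snd W \<cdot> (f \<boxtimes> f) = (f \<boxtimes> f) \<cdot> snd V"
  using assms by (auto simp: braided_morphism_def Hom_iff)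

lemma braided_morphism_Ide:
  assumes "braided_object M (fst V) (snd V)"
  shows "braided_morphism M V (Ide M (fst V)) V"
  using braided_objectD[OF assms] by (simp add: braided_morphism_def Hom_iff)

lemma braided_morphism_Comp:
  assumes f: "braided_morphism M U f V" and g: "braided_morphism M V g W"
    and "braided_object M (fst U) (snd U)" "braided_object M (fst V) (snd V)" "braided_object M (fst W) (snd W)"
  shows "braided_morphism M U (g \<cdot> f) W"
proof -
  note [simp] = braided_objectD[OF assms(3)] braided_objectD[OF assms(4)] braided_objectD[OF assms(5)]
    braided_morphismD(1-3)[OF f] braided_morphismD(1-3)[OF g]
  have "snd W \<cdot> ((g \<cdot> f) \<boxtimes> (g \<cdot> f)) = snd W \<cdot> (g \<boxtimes> g) \<cdot> (f \<boxtimes> f)"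
    by (simp add: interchange)
  also have "\<dots> = (g \<boxtimes> g) \<cdot> (f \<boxtimes> f) \<cdot> snd U"
    by (simp add: Comp_reduce[OF braided_morphismD(4)[OF g]] braided_morphismD(4)[OF f])
  also have "\<dots> = ((g \<cdot> f) \<boxtimes> (g \<cdot> f)) \<cdot> snd U"
    by (simp add: interchange_Comp)
  finally show ?thesis
    by (simp add: braided_morphism_def Hom_iff)
qed

text \<open>Compatibility with the braidings can be tested after the monic
  \<open>e \<boxtimes> e\<close>. It is used for maps induced between primitives, for the comparison
  arrow, and for inverses of braided morphisms.\<close>

lemma braided_morphism_factor:
  assumes e: "braided_morphism M V e W" and eg: "braided_morphism M U (e \<cdot> g) W"
    and mono: "mono_arr (e \<boxtimes> e)" and g: "g \<in> Hom M (fst U) (fst V)"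
    and "braided_object M (fst U) (snd U)" "braided_object M (fst V) (snd V)" "braided_object M (fst W) (snd W)"
  shows "braided_morphism M U g V"
proof -
  note [simp] = braided_objectD[OF assms(5)] braided_objectD[OF assms(6)] braided_objectD[OF assms(7)]
    braided_morphismD(1-3)[OF e] g[unfolded Hom_iff]
  have "(e \<boxtimes> e) \<cdot> snd V \<cdot> (g \<boxtimes> g) = snd W \<cdot> (e \<boxtimes> e) \<cdot> (g \<boxtimes> g)"
    by (simp add: Comp_reduce[OF braided_morphismD(4)[OF e, symmetric]])
  also have "\<dots> = ((e \<cdot> g) \<boxtimes> (e \<cdot> g)) \<cdot> snd U"
    using braided_morphismD(4)[OF eg] by (simp add: interchange)
  also have "\<dots> = (e \<boxtimes> e) \<cdot> (g \<boxtimes> g) \<cdot> snd U"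
    by (simp add: interchange_Comp)
  finally have "snd V \<cdot> (g \<boxtimes> g) = (g \<boxtimes> g) \<cdot> snd U"
    by (rule mono_arrD[OF mono, of _ _ "fst U \<boxdot> fst U" "fst V \<boxdot> fst V"]) (simp_all add: Hom_iff)
  then show ?thesis
    by (simp add: braided_morphism_def Hom_iff)
qed

lemma Hom_Br:
  "f \<in> Hom (Br M) V W \<longleftrightarrow> (\<exists>g. f = (V, g, W) \<and> braided_object M (fst V) (snd V) \<and>
     braided_object M (fst W) (snd W) \<and> braided_morphism M V g W)"
  by (auto simp: Br_def Hom_def)

lemma Br_simps [simp]:
  "V \<in> Obj (Br M) \<longleftrightarrow> braided_object M (fst V) (snd V)"
  "Ide (Br M) V = (V, Ide M (fst V), V)"
  "(V', g, W) \<cdot>\<^bsub>Br M\<^esub> (V, f, W') = (V, g \<cdot> f, W)"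
  "Dom (Br M) (V, f, W) = V" "Cod (Br M) (V, f, W) = W"
  by (auto simp: Br_def)

lemma braided_morphism_Hom: "braided_morphism M (V, c) f (W, d) \<Longrightarrow> f \<in> Hom M V W"
  by (simp add: braided_morphism_def)

lemma category_Br: "category (Br M)"
proof
  fix f assume "f \<in> Arr (Br M)"
  then show "Dom (Br M) f \<in> Obj (Br M)" "Cod (Br M) f \<in> Obj (Br M)"
    by (auto simp: Br_def)
qed (auto simp: Hom_Br braided_morphism_Comp braided_morphism_Ide
    intro!: Comp_assoc[OF braided_morphism_Hom braided_morphism_Hom braided_morphism_Hom]
    Comp_Ide_right[OF braided_morphism_Hom] Comp_Ide_left[OF braided_morphism_Hom])

lemma braided_bialgebraD:
  assumes "braided_bialgebra M B"
  shows "carr B \<in> Obj M"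
    "mul B \<in> Arr M" "Dom M (mul B) = carr B \<boxdot> carr B" "Cod M (mul B) = carr B"
    "unt B \<in> Arr M" "Dom M (unt B) = Unit M" "Cod M (unt B) = carr B"
    "comul B \<in> Arr M" "Dom M (comul B) = carr B" "Cod M (comul B) = carr B \<boxdot> carr B"
    "counit B \<in> Arr M" "Dom M (counit B) = carr B" "Cod M (counit B) = Unit M"
    "braided_object M (carr B) (braid B)"
  using assms unfolding braided_bialgebra_def braided_algebra_def braided_coalgebra_def algebra_in_def
    coalgebra_in_def Hom_iff by blast+

lemma bialgebra_morphismD:
  assumes "bialgebra_morphism M A f B"
  shows "f \<in> Arr M" "Dom M f = carr A" "Cod M f = carr B"
    "braided_morphism M (carr A, braid A) f (carr B, braid B)"
    "f \<cdot> mul A = mul B \<cdot> (f \<boxtimes> f)" "f \<cdot> unt A = unt B"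
    "comul B \<cdot> f = (f \<boxtimes> f) \<cdot> comul A" "counit B \<cdot> f = counit A"
  using assms by (auto simp: bialgebra_morphism_def dest: braided_morphismD)

lemma bialgebra_morphism_Ide:
  assumes "braided_bialgebra M B"
  shows "bialgebra_morphism M B (Ide M (carr B)) B"
  using braided_bialgebraD[OF assms] braided_morphism_Ide[of "(carr B, braid B)"]
  by (simp add: bialgebra_morphism_def)

lemma bialgebra_morphism_Comp:
  assumes f: "bialgebra_morphism M A f B" and g: "bialgebra_morphism M B g C"
    and "braided_bialgebra M A" "braided_bialgebra M B" "braided_bialgebra M C"
  shows "bialgebra_morphism M A (g \<cdot> f) C"
proof -
  note [simp] = braided_bialgebraD[OF assms(3)] braided_bialgebraD[OF assms(4)] braided_bialgebraD[OF assms(5)]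
    bialgebra_morphismD(1-3)[OF f] bialgebra_morphismD(1-3)[OF g]
  have "(g \<cdot> f) \<cdot> mul A = mul C \<cdot> ((g \<cdot> f) \<boxtimes> (g \<cdot> f))"
    using bialgebra_morphismD(5)[OF f] Comp_reduce[OF bialgebra_morphismD(5)[OF g], of "f \<boxtimes> f"]
    by (simp add: interchange)
  moreover have "comul C \<cdot> g \<cdot> f = ((g \<cdot> f) \<boxtimes> (g \<cdot> f)) \<cdot> comul A"
    using bialgebra_morphismD(7)[OF f] Comp_reduce[OF bialgebra_morphismD(7)[OF g], of f]
    by (simp add: interchange_Comp)
  moreover have "counit C \<cdot> g \<cdot> f = counit A"
    using bialgebra_morphismD(8)[OF f] Comp_reduce[OF bialgebra_morphismD(8)[OF g], of f] by simp
  moreover have "braided_morphism M (carr A, braid A) (g \<cdot> f) (carr C, braid C)"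
    by (rule braided_morphism_Comp[OF bialgebra_morphismD(4)[OF f] bialgebra_morphismD(4)[OF g]]) simp_all
  ultimately show ?thesis
    using bialgebra_morphismD(6)[OF f] bialgebra_morphismD(6)[OF g] by (simp add: bialgebra_morphism_def)
qed

lemma Hom_BrBialg:
  "f \<in> Hom (BrBialg M) A B \<longleftrightarrow> (\<exists>g. f = (A, g, B) \<and> braided_bialgebra M A \<and> braided_bialgebra M B \<and>
     bialgebra_morphism M A g B)"
  by (auto simp: BrBialg_def Hom_def)

lemma BrBialg_simps [simp]:
  "A \<in> Obj (BrBialg M) \<longleftrightarrow> braided_bialgebra M A"
  "Ide (BrBialg M) A = (A, Ide M (carr A), A)"
  "(A', g, B) \<cdot>\<^bsub>BrBialg M\<^esub> (A, f, B') = (A, g \<cdot> f, B)"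
  "Dom (BrBialg M) (A, f, B) = A" "Cod (BrBialg M) (A, f, B) = B"
  by (auto simp: BrBialg_def)

lemma bialgebra_morphism_Hom: "bialgebra_morphism M A f B \<Longrightarrow> f \<in> Hom M (carr A) (carr B)"
  by (simp add: bialgebra_morphism_def braided_morphism_def)

lemma category_BrBialg: "category (BrBialg M)"
proof
  fix f assume "f \<in> Arr (BrBialg M)"
  then show "Dom (BrBialg M) f \<in> Obj (BrBialg M)" "Cod (BrBialg M) f \<in> Obj (BrBialg M)"
    by (auto simp: BrBialg_def)
qed (auto simp: Hom_BrBialg bialgebra_morphism_Comp bialgebra_morphism_Ide
    intro!: Comp_assoc[OF bialgebra_morphism_Hom bialgebra_morphism_Hom bialgebra_morphism_Hom]
    Comp_Ide_right[OF bialgebra_morphism_Hom] Comp_Ide_left[OF bialgebra_morphism_Hom])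

end

section \<open>Transport of braided structures and the functors induced by \<open>F\<close>\<close>

context monoidal_functor
begin

lemma iso_arr_frame_tensor:
  assumes "frame a X X'" "frame b Y Y'" "iso_arr N (snd a)" "iso_arr N (snd b)"
  shows "iso_arr N (snd (a \<star> b))"
  using frameD[OF assms(1)] frameD[OF assms(2)] assms(3,4)
  by (auto simp: frame_tensor_def intro!: tgt.iso_arr_Comp tgt.iso_arr_TenA)

text \<open>Both sides of the braid equation are built from transported arrows, so a monic triple
  frame suffices to pull the equation back. Invertibility of \<open>c'\<close> is a premise because
  a non-invertible frame does not supply it; for primitives it is proved separately.\<close>

lemma braided_object_transport:
  assumes V: "braided_object M V c" and a: "frame a V V'" and c: "transport (a \<star> a) c c' (a \<star> a)"
    and "iso_arr N c'" and mono: "tgt.mono_arr (snd (a \<star> a \<star> a))"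
  shows "braided_object N V' c'"
proof -
  have "br12 N V' c' \<cdot>\<^bsub>N\<^esub> br23 N V' c' \<cdot>\<^bsub>N\<^esub> br12 N V' c' = br23 N V' c' \<cdot>\<^bsub>N\<^esub> br12 N V' c' \<cdot>\<^bsub>N\<^esub> br23 N V' c'"
  proof (rule transport_eqI)
    show "transport (a \<star> a \<star> a) (br12 M V c \<cdot>\<^bsub>M\<^esub> br23 M V c \<cdot>\<^bsub>M\<^esub> br12 M V c)
        (br12 N V' c' \<cdot>\<^bsub>N\<^esub> br23 N V' c' \<cdot>\<^bsub>N\<^esub> br12 N V' c') (a \<star> a \<star> a)"
      "transport (a \<star> a \<star> a) (br23 M V c \<cdot>\<^bsub>M\<^esub> br12 M V c \<cdot>\<^bsub>M\<^esub> br23 M V c)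
        (br23 N V' c' \<cdot>\<^bsub>N\<^esub> br12 N V' c' \<cdot>\<^bsub>N\<^esub> br23 N V' c') (a \<star> a \<star> a)"
      by (rule transport_Comp transport_br12 transport_br23 a c)+
    show "br12 M V c \<cdot>\<^bsub>M\<^esub> br23 M V c \<cdot>\<^bsub>M\<^esub> br12 M V c = br23 M V c \<cdot>\<^bsub>M\<^esub> br12 M V c \<cdot>\<^bsub>M\<^esub> br23 M V c"
      using V by (simp add: braided_object_def)
  qed (rule mono)
  then show ?thesis
    using assms(4) frameD(6)[OF a] transport_Hom[OF c frame_tensor_frame[OF a a] frame_tensor_frame[OF a a]]
    by (simp add: braided_object_def)
qed

lemma braided_morphism_transport:
  assumes f: "braided_morphism M (V, c) f (W, d)" and tf: "transport a f f' b"
    and a: "frame a V V'" and b: "frame b W W'"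
    and c: "transport (a \<star> a) c c' (a \<star> a)" and d: "transport (b \<star> b) d d' (b \<star> b)"
    and mono: "tgt.mono_arr (snd (b \<star> b))"
  shows "braided_morphism N (V', c') f' (W', d')"
proof -
  have "d' \<cdot>\<^bsub>N\<^esub> (f' \<boxtimes>\<^bsub>N\<^esub> f') = (f' \<boxtimes>\<^bsub>N\<^esub> f') \<cdot>\<^bsub>N\<^esub> c'"
  proof (rule transport_eqI)
    show "transport (a \<star> a) (d \<cdot>\<^bsub>M\<^esub> (f \<boxtimes>\<^bsub>M\<^esub> f)) (d' \<cdot>\<^bsub>N\<^esub> (f' \<boxtimes>\<^bsub>N\<^esub> f')) (b \<star> b)"
      "transport (a \<star> a) ((f \<boxtimes>\<^bsub>M\<^esub> f) \<cdot>\<^bsub>M\<^esub> c) ((f' \<boxtimes>\<^bsub>N\<^esub> f') \<cdot>\<^bsub>N\<^esub> c') (b \<star> b)"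
      by (rule transport_Comp transport_TenA tf c d)+
    show "d \<cdot>\<^bsub>M\<^esub> (f \<boxtimes>\<^bsub>M\<^esub> f) = (f \<boxtimes>\<^bsub>M\<^esub> f) \<cdot>\<^bsub>M\<^esub> c"
      using f by (simp add: braided_morphism_def)
  qed (rule mono)
  then show ?thesis
    using transport_Hom[OF tf a b] by (simp add: braided_morphism_def)
qed

definition bialg_transport :: "'o \<times> 'b \<Rightarrow> ('o, 'a) bialg \<Rightarrow> ('p, 'b) bialg \<Rightarrow> bool" where
  "bialg_transport a B B' \<longleftrightarrow> frame a (carr B) (carr B') \<and>
     transport (a \<star> a) (mul B) (mul B') a \<and> transport frame_unit (unt B) (unt B') a \<and>
     transport a (comul B) (comul B') (a \<star> a) \<and> transport a (counit B) (counit B') frame_unit \<and>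
     transport (a \<star> a) (braid B) (braid B') (a \<star> a)"

text \<open>Here the frame is invertible, and hence so are its tensor powers. The targets of all
  axioms, of whatever tensor degree, are therefore reached by monic frames.\<close>

lemma braided_bialgebra_transport:
  assumes B: "braided_bialgebra M B" and T: "bialg_transport a B B'"
    and iso: "iso_arr N (snd a)" and iso_c: "iso_arr N (braid B')"
  shows "braided_bialgebra N B'"
proof -
  have fr: "frame a (carr B) (carr B')"
    and T: "transport (a \<star> a) (mul B) (mul B') a" "transport frame_unit (unt B) (unt B') a"
     "transport a (comul B) (comul B') (a \<star> a)" "transport a (counit B) (counit B') frame_unit"
     "transport (a \<star> a) (braid B) (braid B') (a \<star> a)"
    using T by (auto simp: bialg_transport_def)
  note fr_intros = fr frame_tensor_frame frame_unit_frame
  have iso_u: "iso_arr N (snd frame_unit)"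
    by (simp add: frame_unit_def)
  note mono = tgt.mono_arr_iso iso iso_u iso_arr_frame_tensor fr_intros
  note intros = T transport_br12 transport_br23 transport_mid_braid fr transport_intros
  note eqs = B[unfolded braided_bialgebra_def braided_algebra_def braided_coalgebra_def algebra_in_def
    coalgebra_in_def]
  let ?I = "Ide N (carr B')" and ?a = "Assoc N (carr B') (carr B') (carr B')"
    and ?l = "LUnit N (carr B')" and ?r = "RUnit N (carr B')"
    and ?c1 = "br12 N (carr B') (braid B')" and ?c2 = "br23 N (carr B') (braid B')"
  have "braided_object N (carr B') (braid B')"
    by (rule braided_object_transport[OF src.braided_bialgebraD(14)[OF B] fr T(5) iso_c]) (rule mono)+
  moreover have "carr B' \<in> Obj N" "mul B' \<in> Hom N (carr B' \<boxdot>\<^bsub>N\<^esub> carr B') (carr B')"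
    "unt B' \<in> Hom N (Unit N) (carr B')" "comul B' \<in> Hom N (carr B') (carr B' \<boxdot>\<^bsub>N\<^esub> carr B')"
    "counit B' \<in> Hom N (carr B') (Unit N)"
    by (rule frameD(6)[OF fr] T[THEN transport_Hom] fr_intros)+
  \<comment> \<open>In this and the following goals the arrows of \<open>M\<close> in
    \<open>transport_eqI\<close> stay schematic. The transport rules construct them from the shape
    of the two sides in \<open>N\<close>; the remaining equation in \<open>M\<close> is then an
    axiom of \<open>B\<close>.\<close>
  moreover have "mul B' \<cdot>\<^bsub>N\<^esub> (mul B' \<boxtimes>\<^bsub>N\<^esub> ?I) = mul B' \<cdot>\<^bsub>N\<^esub> (?I \<boxtimes>\<^bsub>N\<^esub> mul B') \<cdot>\<^bsub>N\<^esub> ?a"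
    by (rule transport_eqI[where a = "a \<star> a \<star> a" and b = "a"], (rule intros mono)+, use eqs in blast)
  moreover have "mul B' \<cdot>\<^bsub>N\<^esub> (unt B' \<boxtimes>\<^bsub>N\<^esub> ?I) = ?l"
    by (rule transport_eqI[where a = "frame_unit \<star> a" and b = "a"], (rule intros mono)+, use eqs in blast)
  moreover have "mul B' \<cdot>\<^bsub>N\<^esub> (?I \<boxtimes>\<^bsub>N\<^esub> unt B') = ?r"
    by (rule transport_eqI[where a = "a \<star> frame_unit" and b = "a"], (rule intros mono)+, use eqs in blast)
  moreover have "?a \<cdot>\<^bsub>N\<^esub> (comul B' \<boxtimes>\<^bsub>N\<^esub> ?I) \<cdot>\<^bsub>N\<^esub> comul B' = (?I \<boxtimes>\<^bsub>N\<^esub> comul B') \<cdot>\<^bsub>N\<^esub> comul B'"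
    by (rule transport_eqI[where a = "a" and b = "a \<star> (a \<star> a)"], (rule intros mono)+, use eqs in blast)
  moreover have "?l \<cdot>\<^bsub>N\<^esub> (counit B' \<boxtimes>\<^bsub>N\<^esub> ?I) \<cdot>\<^bsub>N\<^esub> comul B' = ?I"
    and "?r \<cdot>\<^bsub>N\<^esub> (?I \<boxtimes>\<^bsub>N\<^esub> counit B') \<cdot>\<^bsub>N\<^esub> comul B' = ?I"
    by (rule transport_eqI[where a = "a" and b = "a"], (rule intros mono)+, use eqs in blast)+
  moreover have "braid B' \<cdot>\<^bsub>N\<^esub> (mul B' \<boxtimes>\<^bsub>N\<^esub> ?I) = (?I \<boxtimes>\<^bsub>N\<^esub> mul B') \<cdot>\<^bsub>N\<^esub> ?a \<cdot>\<^bsub>N\<^esub> ?c1 \<cdot>\<^bsub>N\<^esub> ?c2"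
    and "braid B' \<cdot>\<^bsub>N\<^esub> (?I \<boxtimes>\<^bsub>N\<^esub> mul B') \<cdot>\<^bsub>N\<^esub> ?a = (mul B' \<boxtimes>\<^bsub>N\<^esub> ?I) \<cdot>\<^bsub>N\<^esub> ?c2 \<cdot>\<^bsub>N\<^esub> ?c1"
    by (rule transport_eqI[where a = "a \<star> a \<star> a" and b = "a \<star> a"], (rule intros mono)+, use eqs in blast)+
  moreover have "braid B' \<cdot>\<^bsub>N\<^esub> (unt B' \<boxtimes>\<^bsub>N\<^esub> ?I) \<cdot>\<^bsub>N\<^esub> inv_arr N (?l)
      = (?I \<boxtimes>\<^bsub>N\<^esub> unt B') \<cdot>\<^bsub>N\<^esub> inv_arr N (?r)"
    and "braid B' \<cdot>\<^bsub>N\<^esub> (?I \<boxtimes>\<^bsub>N\<^esub> unt B') \<cdot>\<^bsub>N\<^esub> inv_arr N (?r) = (unt B' \<boxtimes>\<^bsub>N\<^esub> ?I) \<cdot>\<^bsub>N\<^esub> inv_arr N (?l)"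
    by (rule transport_eqI[where a = "a" and b = "a \<star> a"], (rule intros mono)+, use eqs in blast)+
  moreover have "(comul B' \<boxtimes>\<^bsub>N\<^esub> ?I) \<cdot>\<^bsub>N\<^esub> braid B'
      = ?c2 \<cdot>\<^bsub>N\<^esub> ?c1 \<cdot>\<^bsub>N\<^esub> inv_arr N (?a) \<cdot>\<^bsub>N\<^esub> (?I \<boxtimes>\<^bsub>N\<^esub> comul B')"
    and "inv_arr N (?a) \<cdot>\<^bsub>N\<^esub> (?I \<boxtimes>\<^bsub>N\<^esub> comul B') \<cdot>\<^bsub>N\<^esub> braid B'
      = ?c1 \<cdot>\<^bsub>N\<^esub> ?c2 \<cdot>\<^bsub>N\<^esub> (comul B' \<boxtimes>\<^bsub>N\<^esub> ?I)"
    by (rule transport_eqI[where a = "a \<star> a" and b = "a \<star> a \<star> a"], (rule intros mono)+, use eqs in blast)+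
  moreover have "?l \<cdot>\<^bsub>N\<^esub> (counit B' \<boxtimes>\<^bsub>N\<^esub> ?I) \<cdot>\<^bsub>N\<^esub> braid B' = ?r \<cdot>\<^bsub>N\<^esub> (?I \<boxtimes>\<^bsub>N\<^esub> counit B')"
    and "?r \<cdot>\<^bsub>N\<^esub> (?I \<boxtimes>\<^bsub>N\<^esub> counit B') \<cdot>\<^bsub>N\<^esub> braid B' = ?l \<cdot>\<^bsub>N\<^esub> (counit B' \<boxtimes>\<^bsub>N\<^esub> ?I)"
    by (rule transport_eqI[where a = "a \<star> a" and b = "a"], (rule intros mono)+, use eqs in blast)+
  moreover have "comul B' \<cdot>\<^bsub>N\<^esub> mul B'
      = (mul B' \<boxtimes>\<^bsub>N\<^esub> mul B') \<cdot>\<^bsub>N\<^esub> mid_braid N (carr B') (braid B') \<cdot>\<^bsub>N\<^esub> (comul B' \<boxtimes>\<^bsub>N\<^esub> comul B')"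
    by (rule transport_eqI[where a = "a \<star> a" and b = "a \<star> a"], (rule intros mono)+, use eqs in blast)
  moreover have "comul B' \<cdot>\<^bsub>N\<^esub> unt B' = (unt B' \<boxtimes>\<^bsub>N\<^esub> unt B') \<cdot>\<^bsub>N\<^esub> inv_arr N (LUnit N (Unit N))"
    by (rule transport_eqI[where a = "frame_unit" and b = "a \<star> a"], (rule intros mono)+, use eqs in blast)
  moreover have "counit B' \<cdot>\<^bsub>N\<^esub> mul B' = LUnit N (Unit N) \<cdot>\<^bsub>N\<^esub> (counit B' \<boxtimes>\<^bsub>N\<^esub> counit B')"
    by (rule transport_eqI[where a = "a \<star> a" and b = "frame_unit"], (rule intros mono)+, use eqs in blast)
  moreover have "counit B' \<cdot>\<^bsub>N\<^esub> unt B' = Ide N (Unit N)"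
    by (rule transport_eqI[where a = "frame_unit" and b = "frame_unit"], (rule intros mono)+, use eqs in blast)
  ultimately show ?thesis
    unfolding braided_bialgebra_def braided_algebra_def braided_coalgebra_def algebra_in_def coalgebra_in_def
    by (intro conjI)
qed

lemma bialg_transportD:
  assumes "bialg_transport a B B'"
  shows "frame a (carr B) (carr B')" "transport (a \<star> a) (mul B) (mul B') a"
    "transport frame_unit (unt B) (unt B') a" "transport a (comul B) (comul B') (a \<star> a)"
    "transport a (counit B) (counit B') frame_unit" "transport (a \<star> a) (braid B) (braid B') (a \<star> a)"
  using assms by (simp_all add: bialg_transport_def)

lemma bialgebra_morphism_transport:
  assumes f: "bialgebra_morphism M A f B" and tf: "transport a f f' b"
    and A: "bialg_transport a A A'" and B: "bialg_transport b B B'" and iso: "iso_arr N (snd b)"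
  shows "bialgebra_morphism N A' f' B'"
proof -
  have iso_u: "iso_arr N (snd frame_unit)"
    by (simp add: frame_unit_def)
  note mono = tgt.mono_arr_iso iso iso_u iso_arr_frame_tensor bialg_transportD(1)[OF B]
  note intros = tf bialg_transportD[OF A] bialg_transportD[OF B] transport_intros
  note eqs = f[unfolded bialgebra_morphism_def]
  have "braided_morphism N (carr A', braid A') f' (carr B', braid B')"
    by (rule braided_morphism_transport[OF src.bialgebra_morphismD(4)[OF f] tf]) (rule intros mono)+
  moreover have "f' \<cdot>\<^bsub>N\<^esub> mul A' = mul B' \<cdot>\<^bsub>N\<^esub> (f' \<boxtimes>\<^bsub>N\<^esub> f')"
    by (rule transport_eqI[where a = "a \<star> a" and b = b], (rule intros mono)+, use eqs in blast)
  moreover have "f' \<cdot>\<^bsub>N\<^esub> unt A' = unt B'"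
    by (rule transport_eqI[where a = frame_unit and b = b], (rule intros mono)+, use eqs in blast)
  moreover have "comul B' \<cdot>\<^bsub>N\<^esub> f' = (f' \<boxtimes>\<^bsub>N\<^esub> f') \<cdot>\<^bsub>N\<^esub> comul A'"
    by (rule transport_eqI[where a = a and b = "b \<star> b"], (rule intros mono)+, use eqs in blast)
  moreover have "counit B' \<cdot>\<^bsub>N\<^esub> f' = counit A'"
    by (rule transport_eqI[where a = a and b = frame_unit], (rule intros mono)+, use eqs in blast)
  ultimately show ?thesis
    by (simp add: bialgebra_morphism_def)
qed

definition frame_obj :: "'o \<Rightarrow> 'o \<times> 'b" where
  "frame_obj X = (X, Ide N (on_obj F X))"

lemma frame_obj_frame: "X \<in> Obj M \<Longrightarrow> frame (frame_obj X) X (on_obj F X)"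
  by (simp add: frame_def frame_obj_def tgt.Hom_iff)

lemma iso_arr_frame_obj: "X \<in> Obj M \<Longrightarrow> iso_arr N (snd (frame_obj X))"
  by (simp add: frame_obj_def)

lemma transport_on_arr:
  "f \<in> Arr M \<Longrightarrow> transport (frame_obj (Dom M f)) f (on_arr F f) (frame_obj (Cod M f))"
  by (simp add: transport_def frame_obj_frame) (simp add: frame_obj_def)

text \<open>With identity frames a twofold tensor frame is \<open>\<phi>\<^sub>2\<close> itself, so
  the transport squares of the structure maps amount to the defining formulas of the induced
  structure on \<open>F B\<close>.\<close>

lemma snd_frame_tensor_obj:
  "X \<in> Obj M \<Longrightarrow> Y \<in> Obj M \<Longrightarrow> snd (frame_obj X \<star> frame_obj Y) = \<phi>\<^sub>2 X Y"
  by (simp add: frame_tensor_def frame_obj_def)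

lemma frame_tensor_obj_frame:
  "X \<in> Obj M \<Longrightarrow> Y \<in> Obj M
    \<Longrightarrow> frame (frame_obj X \<star> frame_obj Y) (X \<boxdot>\<^bsub>M\<^esub> Y) (on_obj F X \<boxdot>\<^bsub>N\<^esub> on_obj F Y)"
  by (intro frame_tensor_frame frame_obj_frame)

lemma Br_map_obj_Pair [simp]:
  "Br_map_obj N F \<phi>\<^sub>2 (V, c) = (on_obj F V, inv_arr N (\<phi>\<^sub>2 V V) \<cdot>\<^bsub>N\<^esub> on_arr F c \<cdot>\<^bsub>N\<^esub> \<phi>\<^sub>2 V V)"
  by (simp add: Br_map_obj_def)

lemma transport_Br_map_obj:
  assumes "braided_object M V c"
  shows "transport (frame_obj V \<star> frame_obj V) c (snd (Br_map_obj N F \<phi>\<^sub>2 (V, c))) (frame_obj V \<star> frame_obj V)"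
  using src.braided_objectD[OF assms] frame_tensor_obj_frame[of V V]
  by (simp add: transport_def snd_frame_tensor_obj)

lemma braided_object_Br_map_obj:
  assumes "braided_object M (fst V) (snd V)"
  shows "braided_object N (fst (Br_map_obj N F \<phi>\<^sub>2 V)) (snd (Br_map_obj N F \<phi>\<^sub>2 V))"
proof -
  obtain V' c where V: "V = (V', c)" by force
  note c = assms[unfolded V fst_conv snd_conv]
  note [simp] = src.braided_objectD[OF c]
  note fr = frame_obj_frame[OF src.braided_objectD(1)[OF c]]
  have "braided_object N (on_obj F V') (snd (Br_map_obj N F \<phi>\<^sub>2 (V', c)))"
  proof (rule braided_object_transport[OF c fr transport_Br_map_obj[OF c]])
    show "iso_arr N (snd (Br_map_obj N F \<phi>\<^sub>2 (V', c)))"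
      by (auto intro!: tgt.iso_arr_Comp iso_arr_on_arr)
    show "tgt.mono_arr (snd (frame_obj V' \<star> frame_obj V' \<star> frame_obj V'))"
      by (rule tgt.mono_arr_iso iso_arr_frame_tensor frame_tensor_frame fr
          iso_arr_frame_obj src.braided_objectD(1)[OF c])+
  qed
  then show ?thesis
    by (simp add: V)
qed

lemma braided_morphism_on_arr:
  assumes f: "braided_morphism M V f W"
    and V: "braided_object M (fst V) (snd V)" and W: "braided_object M (fst W) (snd W)"
  shows "braided_morphism N (Br_map_obj N F \<phi>\<^sub>2 V) (on_arr F f) (Br_map_obj N F \<phi>\<^sub>2 W)"
proof -
  have [simp]: "fst (Br_map_obj N F \<phi>\<^sub>2 U) = on_obj F (fst U)" for U
    by (cases U) simp
  have f': "braided_morphism M (fst V, snd V) f (fst W, snd W)"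
    using f by simp
  have tf: "transport (frame_obj (fst V)) f (on_arr F f) (frame_obj (fst W))"
    using transport_on_arr[of f] src.braided_morphismD(1-3)[OF f] by simp
  note VO = src.braided_objectD(1)[OF V] and WO = src.braided_objectD(1)[OF W]
  have "braided_morphism N (on_obj F (fst V), snd (Br_map_obj N F \<phi>\<^sub>2 (fst V, snd V))) (on_arr F f)
      (on_obj F (fst W), snd (Br_map_obj N F \<phi>\<^sub>2 (fst W, snd W)))"
    by (rule braided_morphism_transport[OF f' tf frame_obj_frame[OF VO] frame_obj_frame[OF WO]
        transport_Br_map_obj[OF V] transport_Br_map_obj[OF W]])
      (simp add: snd_frame_tensor_obj WO tgt.mono_arr_iso)
  then show ?thesis
    by (cases V; cases W) simp
qed

lemma is_functor_Br_map: "is_functor (Br M) (Br N) (Br_map N F \<phi>\<^sub>2)"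
proof (intro is_functor.intro is_functor_axioms.intro src.category_Br tgt.category_Br)
  show "on_obj (Br_map N F \<phi>\<^sub>2) V \<in> Obj (Br N)" if "V \<in> Obj (Br M)" for V
    using that by (simp add: Br_map_def braided_object_Br_map_obj)
  show "on_arr (Br_map N F \<phi>\<^sub>2) f \<in> Hom (Br N) (on_obj (Br_map N F \<phi>\<^sub>2) V) (on_obj (Br_map N F \<phi>\<^sub>2) W)"
    if "f \<in> Hom (Br M) V W" for f V W
    using that unfolding src.Hom_Br tgt.Hom_Br
    by (auto simp: Br_map_def braided_object_Br_map_obj braided_morphism_on_arr)
  show "on_arr (Br_map N F \<phi>\<^sub>2) (Ide (Br M) V) = Ide (Br N) (on_obj (Br_map N F \<phi>\<^sub>2) V)" if "V \<in> Obj (Br M)" for V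
    using that by (cases V) (auto simp: Br_map_def dest: src.braided_objectD)
  show "on_arr (Br_map N F \<phi>\<^sub>2) (g \<cdot>\<^bsub>Br M\<^esub> f) = on_arr (Br_map N F \<phi>\<^sub>2) g \<cdot>\<^bsub>Br N\<^esub> on_arr (Br_map N F \<phi>\<^sub>2) f"
    if "f \<in> Hom (Br M) U V" "g \<in> Hom (Br M) V W" for f g U V W
    using that by (auto simp: src.Hom_Br Br_map_def braided_morphism_def intro!: on_arr_Comp)
qed

lemma BrBialg_map_obj_simps [simp]:
  fixes B :: "('o, 'a) bialg"
  shows "carr (BrBialg_map_obj N F \<phi>\<^sub>0 \<phi>\<^sub>2 B) = on_obj F (carr B)"
  "mul (BrBialg_map_obj N F \<phi>\<^sub>0 \<phi>\<^sub>2 B) = on_arr F (mul B) \<cdot>\<^bsub>N\<^esub> \<phi>\<^sub>2 (carr B) (carr B)"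
  "unt (BrBialg_map_obj N F \<phi>\<^sub>0 \<phi>\<^sub>2 B) = on_arr F (unt B) \<cdot>\<^bsub>N\<^esub> \<phi>\<^sub>0"
  "comul (BrBialg_map_obj N F \<phi>\<^sub>0 \<phi>\<^sub>2 B) = inv_arr N (\<phi>\<^sub>2 (carr B) (carr B)) \<cdot>\<^bsub>N\<^esub> on_arr F (comul B)"
  "counit (BrBialg_map_obj N F \<phi>\<^sub>0 \<phi>\<^sub>2 B) = inv_arr N \<phi>\<^sub>0 \<cdot>\<^bsub>N\<^esub> on_arr F (counit B)"
  "braid (BrBialg_map_obj N F \<phi>\<^sub>0 \<phi>\<^sub>2 B)
    = inv_arr N (\<phi>\<^sub>2 (carr B) (carr B)) \<cdot>\<^bsub>N\<^esub> on_arr F (braid B) \<cdot>\<^bsub>N\<^esub> \<phi>\<^sub>2 (carr B) (carr B)"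
  by (simp_all add: BrBialg_map_obj_def Let_def)

lemma bialg_transport_BrBialg_map_obj:
  assumes "braided_bialgebra M B"
  shows "bialg_transport (frame_obj (carr B)) B (BrBialg_map_obj N F \<phi>\<^sub>0 \<phi>\<^sub>2 B)"
proof -
  note [simp] = src.braided_bialgebraD[OF assms]
  note [simp] = src.braided_objectD[OF src.braided_bialgebraD(14)[OF assms]]
  show ?thesis
    unfolding bialg_transport_def transport_def
    using frame_obj_frame[of "carr B"] frame_tensor_obj_frame[of "carr B" "carr B"] frame_unit_frame
    by (simp add: snd_frame_tensor_obj) (simp add: frame_obj_def frame_unit_def)
qed

lemma braided_bialgebra_BrBialg_map_obj:
  assumes "braided_bialgebra M B"
  shows "braided_bialgebra N (BrBialg_map_obj N F \<phi>\<^sub>0 \<phi>\<^sub>2 B)"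
proof (rule braided_bialgebra_transport[OF assms bialg_transport_BrBialg_map_obj[OF assms]])
  show "iso_arr N (snd (frame_obj (carr B)))"
    by (rule iso_arr_frame_obj[OF src.braided_bialgebraD(1)[OF assms]])
  show "iso_arr N (braid (BrBialg_map_obj N F \<phi>\<^sub>0 \<phi>\<^sub>2 B))"
    using tgt.braided_objectD(5)[OF braided_object_Br_map_obj[of "(carr B, braid B)"]]
      src.braided_bialgebraD(14)[OF assms]
    by simp
qed

lemma bialgebra_morphism_on_arr:
  assumes f: "bialgebra_morphism M A f B" and "braided_bialgebra M A" "braided_bialgebra M B"
  shows "bialgebra_morphism N (BrBialg_map_obj N F \<phi>\<^sub>0 \<phi>\<^sub>2 A) (on_arr F f) (BrBialg_map_obj N F \<phi>\<^sub>0 \<phi>\<^sub>2 B)"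
proof (rule bialgebra_morphism_transport[OF f])
  show "transport (frame_obj (carr A)) f (on_arr F f) (frame_obj (carr B))"
    using transport_on_arr[of f] src.bialgebra_morphismD(1-3)[OF f] by simp
qed (use assms in \<open>simp_all add: bialg_transport_BrBialg_map_obj iso_arr_frame_obj src.braided_bialgebraD(1)\<close>)

lemma is_functor_BrBialg_map: "is_functor (BrBialg M) (BrBialg N) (BrBialg_map N F \<phi>\<^sub>0 \<phi>\<^sub>2)"
proof (intro is_functor.intro is_functor_axioms.intro src.category_BrBialg tgt.category_BrBialg)
  let ?G = "BrBialg_map N F \<phi>\<^sub>0 \<phi>\<^sub>2"
  show "on_obj ?G A \<in> Obj (BrBialg N)" if "A \<in> Obj (BrBialg M)" for A
    using that by (simp add: BrBialg_map_def braided_bialgebra_BrBialg_map_obj)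
  show "on_arr ?G f \<in> Hom (BrBialg N) (on_obj ?G A) (on_obj ?G B)" if "f \<in> Hom (BrBialg M) A B" for f A B
    using that unfolding src.Hom_BrBialg tgt.Hom_BrBialg
    by (auto simp: BrBialg_map_def braided_bialgebra_BrBialg_map_obj bialgebra_morphism_on_arr)
  show "on_arr ?G (Ide (BrBialg M) A) = Ide (BrBialg N) (on_obj ?G A)" if "A \<in> Obj (BrBialg M)" for A
    using that by (auto simp: BrBialg_map_def dest: src.braided_bialgebraD)
  show "on_arr ?G (g \<cdot>\<^bsub>BrBialg M\<^esub> f) = on_arr ?G g \<cdot>\<^bsub>BrBialg N\<^esub> on_arr ?G f"
    if "f \<in> Hom (BrBialg M) A B" "g \<in> Hom (BrBialg M) B C" for f g A B C
    using that by (auto simp: src.Hom_BrBialg BrBialg_map_def intro!: on_arr_Comp src.bialgebra_morphism_Hom)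
qed

end

section \<open>Sums of arrows and their transport\<close>

context preadditive_monoidal_category
begin

lemma HAdd_Hom:
  assumes "f \<in> Hom M X Y" "g \<in> Hom M X Y"
  shows "HAdd M f g \<in> Hom M X Y"
proof -
  have "X \<in> Obj M" "Y \<in> Obj M"
    using assms(1) by (auto simp: Hom_iff)
  then obtain z where "comm_group \<lparr>carrier = Hom M X Y, monoid.mult = HAdd M, one = z\<rparr>"
    using Hom_comm_group by blast
  then interpret comm_group "\<lparr>carrier = Hom M X Y, monoid.mult = HAdd M, one = z\<rparr>" .
  show ?thesis
    using m_closed assms by simp
qed

lemma HAdd_simps [simp]:
  assumes "f \<in> Arr M" "g \<in> Arr M" "Dom M g = Dom M f" "Cod M g = Cod M f"
  shows "HAdd M f g \<in> Arr M" "Dom M (HAdd M f g) = Dom M f" "Cod M (HAdd M f g) = Cod M f"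
  using HAdd_Hom[of f "Dom M f" "Cod M f" g] assms by (simp_all add: Hom_iff)

lemma HAdd_Comp:
  assumes "f \<in> Arr M" "g \<in> Arr M" "Dom M g = Dom M f" "Cod M g = Cod M f" "h \<in> Arr M"
  shows "Cod M h = Dom M f \<Longrightarrow> HAdd M f g \<cdot> h = HAdd M (f \<cdot> h) (g \<cdot> h)"
    and "Dom M h = Cod M f \<Longrightarrow> h \<cdot> HAdd M f g = HAdd M (h \<cdot> f) (h \<cdot> g)"
  using assms Comp_HAdd_left[of h "Dom M h" "Cod M h" f "Cod M f" g]
    Comp_HAdd_right[of f "Dom M f" "Cod M f" g h "Cod M h"] by (simp_all add: Hom_iff)

end

locale additive_monoidal_functor =
  src: preadditive_monoidal_category M + tgt: preadditive_monoidal_category N + monoidal_functor M N F \<phi>\<^sub>0 \<phi>\<^sub>2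
  for M :: "('o, 'a, 'x) addmoncat_scheme" and N :: "('p, 'b, 'y) addmoncat_scheme"
  and F :: "('o, 'a, 'p, 'b) cfunctor" and \<phi>\<^sub>0 :: 'b and \<phi>\<^sub>2 :: "'o \<Rightarrow> 'o \<Rightarrow> 'b" +
  assumes additive: "additive M N F"
begin

lemma transport_HAdd:
  assumes "transport a f f' b" "transport a g g' b"
  shows "transport a (HAdd M f g) (HAdd N f' g') b"
proof -
  have fr: "frame a (Dom M f) (Dom N f')" "frame b (Cod M f) (Cod N f')"
     "frame a (Dom M g) (Dom N g')" "frame b (Cod M g) (Cod N g')"
    and [simp]: "f \<in> Arr M" "f' \<in> Arr N" "g \<in> Arr M" "g' \<in> Arr N"
    and f: "on_arr F f \<cdot>\<^bsub>N\<^esub> snd a = snd b \<cdot>\<^bsub>N\<^esub> f'" and g: "on_arr F g \<cdot>\<^bsub>N\<^esub> snd a = snd b \<cdot>\<^bsub>N\<^esub> g'"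
    using assms by (auto simp: transport_def)
  note [simp] = frameD(3-5)[OF fr(1)] frameD(3-5)[OF fr(2)]
  have [simp]: "Dom M g = Dom M f" "Cod M g = Cod M f" "Dom N g' = Dom N f'" "Cod N g' = Cod N f'"
    using fr[THEN frameD(2)] fr[THEN frameD(4)] by simp_all
  have "on_arr F (HAdd M f g) = HAdd N (on_arr F f) (on_arr F g)"
    using additive unfolding additive_def
    by (metis \<open>Cod M g = Cod M f\<close> \<open>Dom M g = Dom M f\<close> \<open>f \<in> Arr M\<close> \<open>g \<in> Arr M\<close> src.Dom_Cod_Obj src.Hom_iff)
  then have "on_arr F (HAdd M f g) \<cdot>\<^bsub>N\<^esub> snd a = snd b \<cdot>\<^bsub>N\<^esub> HAdd N f' g'"
    by (simp add: tgt.HAdd_Comp f g)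
  then show ?thesis
    using fr by (simp add: transport_def)
qed

text \<open>The summands consist of the unit and the constraints; additivity handles the sum. It
  serves twice: with identity frames along \<open>F\<close>, and along the identity functor with a
  bialgebra morphism as frame.\<close>

lemma transport_prim_sum:
  assumes "frame a (carr A) (carr A')" "transport frame_unit (unt A) (unt A') a"
  shows "transport a (prim_sum M A) (prim_sum N A') (a \<star> a)"
  unfolding prim_sum_def by (rule transport_HAdd assms transport_intros)+

end

definition id_functor :: "('o, 'a, 'o, 'a) cfunctor" where
  "id_functor = \<lparr>on_obj = \<lambda>X. X, on_arr = \<lambda>f. f\<rparr>"

lemma id_functor_simps: "on_obj id_functor X = X" "on_arr id_functor f = f"
  by (simp_all add: id_functor_def)

text \<open>Makes the transport rules available inside one category, where a frame is just an arrow
  of \<open>M\<close>, such as the inclusion of the primitives.\<close>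

lemma (in preadditive_monoidal_category) additive_monoidal_functor_id:
  "additive_monoidal_functor M M id_functor (Ide M (Unit M)) (\<lambda>U V. Ide M (U \<boxdot> V))"
proof unfold_locales
  show "Ide M (U' \<boxdot> V') \<cdot> (on_arr id_functor f \<boxtimes> on_arr id_functor g) = on_arr id_functor (f \<boxtimes> g) \<cdot> Ide M (U \<boxdot> V)"
    if "f \<in> Hom M U U'" "g \<in> Hom M V V'" for f g U U' V V'
    using that by (auto simp: id_functor_simps Hom_iff)
qed (auto simp: id_functor_simps Hom_iff additive_def)

section \<open>Primitives of a braided bialgebra\<close>

context monoidal_category
begin

lemma braidings_simps [simp]:
  assumes "V \<in> Obj M" "c \<in> Arr M" "Dom M c = V \<boxdot> V" "Cod M c = V \<boxdot> V"
  shows "br12 M V c \<in> Arr M" "Dom M (br12 M V c) = V \<boxdot> V \<boxdot> V" "Cod M (br12 M V c) = V \<boxdot> V \<boxdot> V"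
    "br23 M V c \<in> Arr M" "Dom M (br23 M V c) = V \<boxdot> V \<boxdot> V" "Cod M (br23 M V c) = V \<boxdot> V \<boxdot> V"
    "iso_arr M c \<Longrightarrow> iso_arr M (br12 M V c)" "iso_arr M c \<Longrightarrow> iso_arr M (br23 M V c)"
  using assms by (auto simp: br12_def br23_def intro!: iso_arr_Comp iso_arr_TenA)

text \<open>
  The compatibility of \<open>\<Delta>\<close> with the braiding, for an arbitrary \<open>x : V \<rightarrow> V \<otimes> V\<close>. It holds for
  both units \<open>(A \<otimes> u) r\<^sup>-\<^sup>1\<close> and \<open>(u \<otimes> A) l\<^sup>-\<^sup>1\<close> because the braiding exchanges them.
\<close>

definition braid_intertwines :: "'o \<Rightarrow> 'a \<Rightarrow> 'a \<Rightarrow> bool" where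
  "braid_intertwines V c x \<longleftrightarrow> x \<in> Hom M V (V \<boxdot> V) \<and>
     (x \<boxtimes> Ide M V) \<cdot> c = br23 M V c \<cdot> br12 M V c \<cdot> inv_arr M (Assoc M V V V) \<cdot> (Ide M V \<boxtimes> x) \<and>
     inv_arr M (Assoc M V V V) \<cdot> (Ide M V \<boxtimes> x) \<cdot> c = br12 M V c \<cdot> br23 M V c \<cdot> (x \<boxtimes> Ide M V)"

context
  fixes A :: "('o, 'a) bialg"
  assumes A: "braided_bialgebra M A"
begin

abbreviation "right_unit \<equiv> (Ide M (carr A) \<boxtimes> unt A) \<cdot> inv_arr M (RUnit M (carr A))"

abbreviation "left_unit \<equiv> (unt A \<boxtimes> Ide M (carr A)) \<cdot> inv_arr M (LUnit M (carr A))"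

lemma braid_intertwines_comul: "braid_intertwines (carr A) (braid A) (comul A)"
  using A unfolding braid_intertwines_def braided_bialgebra_def braided_coalgebra_def coalgebra_in_def
  by blast

text \<open>Think of \<open>y1\<close> and \<open>y2\<close> as inserting the unit after or before a
  factor. On two factors there are three slots for the unit: in an outer slot it lets the braiding
  of the other two factors pass, and \<open>c\<close> moves it between adjacent slots.\<close>

lemma braid_intertwines_units:
  shows "braid_intertwines (carr A) (braid A) right_unit" "braid_intertwines (carr A) (braid A) left_unit"
proof -
  define X u c where Xuc: "X = carr A" "u = unt A" "c = braid A"
  note [simp] = Xuc[symmetric]
  note [simp] = braided_bialgebraD(1,5,6,7)[OF A, folded Xuc]
    braided_objectD(2-5)[OF braided_bialgebraD(14)[OF A], folded Xuc]
  define y1 y2 where y: "y1 = (Ide M X \<boxtimes> u) \<cdot> inv_arr M (RUnit M X)" "y2 = (u \<boxtimes> Ide M X) \<cdot> inv_arr M (LUnit M X)"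
  let ?ai = "inv_arr M (Assoc M X X X)"
  have [simp]: "y1 \<in> Arr M" "y2 \<in> Arr M" "Dom M y1 = X" "Dom M y2 = X" "Cod M y1 = X \<boxdot> X" "Cod M y2 = X \<boxdot> X"
    by (simp_all add: y)
  have c: "c \<cdot> y1 = y2" "c \<cdot> y2 = y1"
    using A unfolding y Xuc braided_bialgebra_def braided_algebra_def by blast+
  \<comment> \<open>The unit in the third slot: by coherence this is the right unit insertion for
    the single object \<open>X \<boxdot> X\<close>.\<close>
  have E: "?ai \<cdot> (Ide M X \<boxtimes> y1) = (Ide M (X \<boxdot> X) \<boxtimes> u) \<cdot> inv_arr M (RUnit M (X \<boxdot> X))"
  proof -
    have "?ai \<cdot> (Ide M X \<boxtimes> y1) = (?ai \<cdot> (Ide M X \<boxtimes> (Ide M X \<boxtimes> u))) \<cdot> (Ide M X \<boxtimes> inv_arr M (RUnit M X))"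
      by (simp add: y whisker_left)
    also have "\<dots> = (Ide M (X \<boxdot> X) \<boxtimes> u) \<cdot> inv_arr M (Assoc M X X (Unit M)) \<cdot> (Ide M X \<boxtimes> inv_arr M (RUnit M X))"
      using Assoc_inv_naturality[of "Ide M X" "Ide M X" u] by simp
    finally show ?thesis
      by (simp add: RUnit_TenO_inv)
  qed
  \<comment> \<open>With the unit in the third slot, naturality of the right unit constraint lets
    the braiding of the first two factors pass.\<close>
  have K1: "br12 M X c \<cdot> ?ai \<cdot> (Ide M X \<boxtimes> y1) = ?ai \<cdot> (Ide M X \<boxtimes> y1) \<cdot> c"
  proof -
    have "br12 M X c \<cdot> ?ai \<cdot> (Ide M X \<boxtimes> y1) = (Ide M (X \<boxdot> X) \<boxtimes> u) \<cdot> (c \<boxtimes> Ide M (Unit M)) \<cdot> inv_arr M (RUnit M (X \<boxdot> X))"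
      unfolding E br12_def by (simp add: interchange_Comp)
    also have "\<dots> = ((Ide M (X \<boxdot> X) \<boxtimes> u) \<cdot> inv_arr M (RUnit M (X \<boxdot> X))) \<cdot> c"
      using RUnit_inv_naturality[of c] by simp
    finally show ?thesis
      unfolding E[symmetric] by simp
  qed
  \<comment> \<open>Both sides put the unit into the middle slot; they agree by the
    triangle.\<close>
  have K2: "?ai \<cdot> (Ide M X \<boxtimes> y2) = y1 \<boxtimes> Ide M X"
  proof -
    have "?ai \<cdot> (Ide M X \<boxtimes> y2) = (?ai \<cdot> (Ide M X \<boxtimes> (u \<boxtimes> Ide M X))) \<cdot> (Ide M X \<boxtimes> inv_arr M (LUnit M X))"
      by (simp add: y whisker_left)
    also have "\<dots> = ((Ide M X \<boxtimes> u) \<boxtimes> Ide M X) \<cdot> inv_arr M (Assoc M X (Unit M) X) \<cdot> (Ide M X \<boxtimes> inv_arr M (LUnit M X))"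
      using Assoc_inv_naturality[of "Ide M X" u "Ide M X"] by simp
    also have "\<dots> = y1 \<boxtimes> Ide M X"
      by (simp add: triangle_inv y whisker_right)
    finally show ?thesis .
  qed
  \<comment> \<open>The unit in the first slot, rewritten as the left unit insertion for
    \<open>X \<boxdot> X\<close>.\<close>
  have D: "y2 \<boxtimes> Ide M X = ?ai \<cdot> (u \<boxtimes> Ide M (X \<boxdot> X)) \<cdot> inv_arr M (LUnit M (X \<boxdot> X))"
  proof -
    have "y2 \<boxtimes> Ide M X = (((u \<boxtimes> Ide M X) \<boxtimes> Ide M X) \<cdot> inv_arr M (Assoc M (Unit M) X X)) \<cdot> inv_arr M (LUnit M (X \<boxdot> X))"
      by (simp add: y whisker_right LUnit_TenO_inv)
    moreover have n: "?ai \<cdot> (u \<boxtimes> Ide M (X \<boxdot> X)) = ((u \<boxtimes> Ide M X) \<boxtimes> Ide M X) \<cdot> inv_arr M (Assoc M (Unit M) X X)"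
      using Assoc_inv_naturality[of u "Ide M X" "Ide M X"] by simp
    ultimately show ?thesis
      by (simp add: Comp_reduce[OF n])
  qed
  have K3: "br23 M X c \<cdot> (y2 \<boxtimes> Ide M X) = (y2 \<boxtimes> Ide M X) \<cdot> c"
  proof -
    have "br23 M X c \<cdot> (y2 \<boxtimes> Ide M X)
        = ?ai \<cdot> (u \<boxtimes> Ide M (X \<boxdot> X)) \<cdot> (Ide M (Unit M) \<boxtimes> c) \<cdot> inv_arr M (LUnit M (X \<boxdot> X))"
      unfolding D br23_def by (simp add: interchange_Comp)
    then show ?thesis
      unfolding D using LUnit_inv_naturality[of c] by simp
  qed
  \<comment> \<open>These two identities, applied with \<open>c \<cdot> y1 = y2\<close> and
    \<open>c \<cdot> y2 = y1\<close>, move the unit from an outer slot to the middle or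
    back.\<close>
  have br23: "br23 M X c \<cdot> ?ai \<cdot> (Ide M X \<boxtimes> f) = ?ai \<cdot> (Ide M X \<boxtimes> (c \<cdot> f))"
    if "f \<in> Hom M X (X \<boxdot> X)" for f
    using that by (simp add: br23_def Hom_iff whisker_left)
  have br12: "br12 M X c \<cdot> (f \<boxtimes> Ide M X) = (c \<cdot> f) \<boxtimes> Ide M X" if "f \<in> Hom M X (X \<boxdot> X)" for f
    using that by (simp add: br12_def Hom_iff whisker_right)
  have y1: "(y1 \<boxtimes> Ide M X) \<cdot> c = br23 M X c \<cdot> br12 M X c \<cdot> ?ai \<cdot> (Ide M X \<boxtimes> y1)"
  proof -
    have "br23 M X c \<cdot> br12 M X c \<cdot> ?ai \<cdot> (Ide M X \<boxtimes> y1) = (br23 M X c \<cdot> ?ai \<cdot> (Ide M X \<boxtimes> y1)) \<cdot> c"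
      unfolding K1 by simp
    then show ?thesis
      by (simp add: br23 c K2 Hom_iff)
  qed
  have y1': "?ai \<cdot> (Ide M X \<boxtimes> y1) \<cdot> c = br12 M X c \<cdot> br23 M X c \<cdot> (y1 \<boxtimes> Ide M X)"
    unfolding K2[symmetric] by (simp add: br23 c K1 Hom_iff)
  have y2: "(y2 \<boxtimes> Ide M X) \<cdot> c = br23 M X c \<cdot> br12 M X c \<cdot> ?ai \<cdot> (Ide M X \<boxtimes> y2)"
    unfolding K2 by (simp add: br12 c K3 Hom_iff)
  have y2': "?ai \<cdot> (Ide M X \<boxtimes> y2) \<cdot> c = br12 M X c \<cdot> br23 M X c \<cdot> (y2 \<boxtimes> Ide M X)"
  proof -
    have "br12 M X c \<cdot> br23 M X c \<cdot> (y2 \<boxtimes> Ide M X) = (br12 M X c \<cdot> (y2 \<boxtimes> Ide M X)) \<cdot> c"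
      unfolding K3 by simp
    also have "\<dots> = (?ai \<cdot> (Ide M X \<boxtimes> y2)) \<cdot> c"
      by (simp add: br12 c K2 Hom_iff)
    finally show ?thesis
      by simp
  qed
  show "braid_intertwines (carr A) (braid A) right_unit" "braid_intertwines (carr A) (braid A) left_unit"
    using y1 y1' y2 y2' unfolding braid_intertwines_def y Xuc by (simp_all add: Hom_iff)
qed

end

text \<open>Sliding \<open>f\<close> through the braiding brings it directly onto \<open>e\<close>,
  where it may be replaced by \<open>g\<close>. The four conclusions are the conditions of
  \<open>equalizer_square_factor\<close> for the braiding and for its inverse, restricted along
  \<open>e \<boxtimes> e\<close>.\<close>

lemma braid_intertwines_equalizer:
  assumes f: "braid_intertwines X c f" and g: "braid_intertwines X c g"
    and c: "X \<in> Obj M" "c \<in> Hom M (X \<boxdot> X) (X \<boxdot> X)" "iso_arr M c"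
    and e: "e \<in> Hom M E X" "f \<cdot> e = g \<cdot> e"
  shows "(f \<boxtimes> Ide M X) \<cdot> c \<cdot> (e \<boxtimes> e) = (g \<boxtimes> Ide M X) \<cdot> c \<cdot> (e \<boxtimes> e)"
    and "(Ide M X \<boxtimes> f) \<cdot> c \<cdot> (e \<boxtimes> e) = (Ide M X \<boxtimes> g) \<cdot> c \<cdot> (e \<boxtimes> e)"
    and "(f \<boxtimes> Ide M X) \<cdot> inv_arr M c \<cdot> (e \<boxtimes> e) = (g \<boxtimes> Ide M X) \<cdot> inv_arr M c \<cdot> (e \<boxtimes> e)"
    and "(Ide M X \<boxtimes> f) \<cdot> inv_arr M c \<cdot> (e \<boxtimes> e) = (Ide M X \<boxtimes> g) \<cdot> inv_arr M c \<cdot> (e \<boxtimes> e)"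
proof -
  note [simp] = c(1) c(2)[unfolded Hom_iff] c(3) e(1)[unfolded Hom_iff]
  let ?a = "Assoc M X X X" let ?ai = "inv_arr M ?a"
  \<comment> \<open>Each right-hand side involves the intertwiner \<open>h\<close> only through
    \<open>h \<cdot> e\<close>, so it takes the same value for \<open>f\<close> and
    \<open>g\<close>.\<close>
  have fg: "(h \<boxtimes> Ide M X) \<cdot> c \<cdot> (e \<boxtimes> e) = br23 M X c \<cdot> br12 M X c \<cdot> ?ai \<cdot> (e \<boxtimes> (h \<cdot> e))"
     "(Ide M X \<boxtimes> h) \<cdot> c \<cdot> (e \<boxtimes> e) = ?a \<cdot> br12 M X c \<cdot> br23 M X c \<cdot> ((h \<cdot> e) \<boxtimes> e)"
     "br23 M X c \<cdot> br12 M X c \<cdot> ?ai \<cdot> (Ide M X \<boxtimes> h) \<cdot> inv_arr M c \<cdot> (e \<boxtimes> e) = (h \<cdot> e) \<boxtimes> e"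
     "br12 M X c \<cdot> br23 M X c \<cdot> (h \<boxtimes> Ide M X) \<cdot> inv_arr M c \<cdot> (e \<boxtimes> e) = ?ai \<cdot> (e \<boxtimes> (h \<cdot> e))"
    if "braid_intertwines X c h" for h
  proof -
    have [simp]: "h \<in> Arr M" "Dom M h = X" "Cod M h = X \<boxdot> X"
      and 1: "(h \<boxtimes> Ide M X) \<cdot> c = br23 M X c \<cdot> br12 M X c \<cdot> ?ai \<cdot> (Ide M X \<boxtimes> h)"
      and 2: "?ai \<cdot> (Ide M X \<boxtimes> h) \<cdot> c = br12 M X c \<cdot> br23 M X c \<cdot> (h \<boxtimes> Ide M X)"
      using that by (simp_all add: braid_intertwines_def Hom_iff)
    have 3: "(Ide M X \<boxtimes> h) \<cdot> c = ?a \<cdot> br12 M X c \<cdot> br23 M X c \<cdot> (h \<boxtimes> Ide M X)"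
      unfolding 2[symmetric] by simp
    show "(h \<boxtimes> Ide M X) \<cdot> c \<cdot> (e \<boxtimes> e) = br23 M X c \<cdot> br12 M X c \<cdot> ?ai \<cdot> (e \<boxtimes> (h \<cdot> e))"
      by (simp add: Comp_reduce[OF 1] interchange)
    show "(Ide M X \<boxtimes> h) \<cdot> c \<cdot> (e \<boxtimes> e) = ?a \<cdot> br12 M X c \<cdot> br23 M X c \<cdot> ((h \<cdot> e) \<boxtimes> e)"
      by (simp add: Comp_reduce[OF 3] interchange)
    have "br23 M X c \<cdot> br12 M X c \<cdot> ?ai \<cdot> (Ide M X \<boxtimes> h) \<cdot> inv_arr M c \<cdot> (e \<boxtimes> e)
        = (br23 M X c \<cdot> br12 M X c \<cdot> ?ai \<cdot> (Ide M X \<boxtimes> h)) \<cdot> inv_arr M c \<cdot> (e \<boxtimes> e)"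
      by simp
    then show "br23 M X c \<cdot> br12 M X c \<cdot> ?ai \<cdot> (Ide M X \<boxtimes> h) \<cdot> inv_arr M c \<cdot> (e \<boxtimes> e) = (h \<cdot> e) \<boxtimes> e"
      unfolding 1[symmetric] by (simp add: interchange)
    have "br12 M X c \<cdot> br23 M X c \<cdot> (h \<boxtimes> Ide M X) \<cdot> inv_arr M c \<cdot> (e \<boxtimes> e)
        = (br12 M X c \<cdot> br23 M X c \<cdot> (h \<boxtimes> Ide M X)) \<cdot> inv_arr M c \<cdot> (e \<boxtimes> e)"
      by simp
    then show "br12 M X c \<cdot> br23 M X c \<cdot> (h \<boxtimes> Ide M X) \<cdot> inv_arr M c \<cdot> (e \<boxtimes> e) = ?ai \<cdot> (e \<boxtimes> (h \<cdot> e))"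
      unfolding 2[symmetric] by (simp add: interchange)
  qed
  have [simp]: "f \<in> Arr M" "Dom M f = X" "Cod M f = X \<boxdot> X" "g \<in> Arr M" "Dom M g = X" "Cod M g = X \<boxdot> X"
    using f g by (auto simp: braid_intertwines_def Hom_iff)
  show "(f \<boxtimes> Ide M X) \<cdot> c \<cdot> (e \<boxtimes> e) = (g \<boxtimes> Ide M X) \<cdot> c \<cdot> (e \<boxtimes> e)"
       "(Ide M X \<boxtimes> f) \<cdot> c \<cdot> (e \<boxtimes> e) = (Ide M X \<boxtimes> g) \<cdot> c \<cdot> (e \<boxtimes> e)"
    unfolding fg[OF f] fg[OF g] e(2) by (rule refl)+
  \<comment> \<open>For the inverse braiding the sliding identity is available only after composing
    with braidings of adjacent factors. These are invertible and are cancelled; the last conclusion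
    is obtained in the same way, with an associator in addition.\<close>
  have "(br12 M X c \<cdot> br23 M X c) \<cdot> (f \<boxtimes> Ide M X) \<cdot> inv_arr M c \<cdot> (e \<boxtimes> e)
      = (br12 M X c \<cdot> br23 M X c) \<cdot> (g \<boxtimes> Ide M X) \<cdot> inv_arr M c \<cdot> (e \<boxtimes> e)"
    using fg(4)[OF f] fg(4)[OF g] e(2) by simp
  then show "(f \<boxtimes> Ide M X) \<cdot> inv_arr M c \<cdot> (e \<boxtimes> e) = (g \<boxtimes> Ide M X) \<cdot> inv_arr M c \<cdot> (e \<boxtimes> e)"
    by (rule iso_arr_left_cancel) (simp_all add: iso_arr_Comp)
  have "(br23 M X c \<cdot> br12 M X c \<cdot> ?ai) \<cdot> (Ide M X \<boxtimes> f) \<cdot> inv_arr M c \<cdot> (e \<boxtimes> e)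
      = (br23 M X c \<cdot> br12 M X c \<cdot> ?ai) \<cdot> (Ide M X \<boxtimes> g) \<cdot> inv_arr M c \<cdot> (e \<boxtimes> e)"
    using fg(3)[OF f] fg(3)[OF g] e(2) by simp
  then show "(Ide M X \<boxtimes> f) \<cdot> inv_arr M c \<cdot> (e \<boxtimes> e) = (Ide M X \<boxtimes> g) \<cdot> inv_arr M c \<cdot> (e \<boxtimes> e)"
    by (rule iso_arr_left_cancel) (simp_all add: iso_arr_Comp)
qed

end

section \<open>The object of primitives and its restricted braiding\<close>

locale braided_primitives = preadditive_monoidal_category M
  for M :: "('o, 'a, 'x) addmoncat_scheme" (structure) and eqz :: "'a \<Rightarrow> 'a \<Rightarrow> 'a" +
  assumes tensor_additive: "tensor_functors_additive M"
    and tensor_equalizers: "tensor_functors_preserve_equalizers M"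
    and choice: "equalizer_choice M eqz"
begin

lemma TenA_HAdd:
  assumes "f \<in> Hom M X Y" "g \<in> Hom M X Y" "Z \<in> Obj M"
  shows "Ide M Z \<boxtimes> HAdd M f g = HAdd M (Ide M Z \<boxtimes> f) (Ide M Z \<boxtimes> g)"
    and "HAdd M f g \<boxtimes> Ide M Z = HAdd M (f \<boxtimes> Ide M Z) (g \<boxtimes> Ide M Z)"
proof -
  have "X \<in> Obj M" "Y \<in> Obj M"
    using assms by (auto simp: Hom_iff)
  with assms tensor_additive show "Ide M Z \<boxtimes> HAdd M f g = HAdd M (Ide M Z \<boxtimes> f) (Ide M Z \<boxtimes> g)"
      "HAdd M f g \<boxtimes> Ide M Z = HAdd M (f \<boxtimes> Ide M Z) (g \<boxtimes> Ide M Z)"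
    by (auto simp: tensor_functors_additive_def additive_def tensor_left_def tensor_right_def)
qed

lemma equalizer_tensor:
  assumes "is_equalizer M f g e" "Z \<in> Obj M"
  shows "is_equalizer M (Ide M Z \<boxtimes> f) (Ide M Z \<boxtimes> g) (Ide M Z \<boxtimes> e)"
    and "is_equalizer M (f \<boxtimes> Ide M Z) (g \<boxtimes> Ide M Z) (e \<boxtimes> Ide M Z)"
  using assms tensor_equalizers
  by (auto simp: tensor_functors_preserve_equalizers_def preserves_equalizers_def tensor_left_def tensor_right_def)

text \<open>A tensor power of \<open>e\<close> is a composite of arrows with \<open>e\<close> in one
  factor and identities in the others. Each of these is an equalizer since tensor functors preserve
  equalizers.\<close>

lemma mono_arr_TenA_equalizer:
  assumes "is_equalizer M f g e"
  shows "mono_arr (e \<boxtimes> e)" "mono_arr (e \<boxtimes> e \<boxtimes> e)"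
proof -
  note [simp] = equalizerD(3)[OF assms]
  let ?E = "Ide M (Dom M e)" and ?X = "Ide M (Cod M e)"
  have "mono_arr ((e \<boxtimes> ?X) \<cdot> (?E \<boxtimes> e))"
    by (rule mono_arr_Comp mono_arr_equalizer equalizer_tensor assms | simp)+
  then show "mono_arr (e \<boxtimes> e)"
    by (simp add: interchange)
  have "mono_arr (((e \<boxtimes> ?X) \<boxtimes> ?X) \<cdot> ((?E \<boxtimes> e) \<boxtimes> ?X) \<cdot> (Ide M (Dom M e \<boxdot> Dom M e) \<boxtimes> e))"
    by (rule mono_arr_Comp mono_arr_equalizer equalizer_tensor assms | simp)+
  then show "mono_arr (e \<boxtimes> e \<boxtimes> e)"
    by (simp add: interchange)
qed

text \<open>The first equation factors \<open>h\<close> through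
  \<open>e \<boxtimes> Ide M X\<close>, the second factors the resulting arrow through
  \<open>Ide M (Dom M e) \<boxtimes> e\<close>.\<close>

lemma equalizer_square_factor:
  assumes e: "is_equalizer M f g e" and "Dom M f = X" and h: "h \<in> Hom M Z (X \<boxdot> X)"
    and eq: "(f \<boxtimes> Ide M X) \<cdot> h = (g \<boxtimes> Ide M X) \<cdot> h" "(Ide M X \<boxtimes> f) \<cdot> h = (Ide M X \<boxtimes> g) \<cdot> h"
  obtains k where "k \<in> Hom M Z (Dom M e \<boxdot> Dom M e)" "(e \<boxtimes> e) \<cdot> k = h"
proof -
  note [simp] = equalizerD(1-6)[OF e] assms(2) h[unfolded Hom_iff]
  have [simp]: "X \<in> Obj M"
    using assms(2) equalizerD(1)[OF e] Dom_Cod_Obj by blast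
  obtain k where k: "k \<in> Hom M Z (Dom M e \<boxdot> X)" "(e \<boxtimes> Ide M X) \<cdot> k = h"
    by (rule equalizer_factor[OF equalizer_tensor(2)[OF e, of X] _ eq(1), of Z]) (simp_all add: Hom_iff)
  note [simp] = k(1)[unfolded Hom_iff]
  \<comment> \<open>Arrows acting on different tensor factors commute. Hence the second equation for
    \<open>h\<close> becomes one for the lift \<open>k\<close>, preceded by a monic arrow that can
    be cancelled.\<close>
  have *: "(e \<boxtimes> Ide M (Cod M f)) \<cdot> (Ide M (Dom M e) \<boxtimes> l) \<cdot> k = (Ide M X \<boxtimes> l) \<cdot> h"
    if "l \<in> Hom M X (Cod M f)" for l
    using that by (simp add: Hom_iff interchange_Comp flip: k(2))
  have "(Ide M (Dom M e) \<boxtimes> f) \<cdot> k = (Ide M (Dom M e) \<boxtimes> g) \<cdot> k"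
  proof (rule mono_arrD[OF mono_arr_equalizer[OF equalizer_tensor(2)[OF e, of "Cod M f"]]])
    show "(e \<boxtimes> Ide M (Cod M f)) \<cdot> (Ide M (Dom M e) \<boxtimes> f) \<cdot> k = (e \<boxtimes> Ide M (Cod M f)) \<cdot> (Ide M (Dom M e) \<boxtimes> g) \<cdot> k"
      using eq(2) by (simp add: * Hom_iff)
  qed (auto simp: Hom_iff)
  from equalizer_factor[OF equalizer_tensor(1)[OF e, of "Dom M e"] _ this, of Z]
  obtain k' where k': "k' \<in> Hom M Z (Dom M e \<boxdot> Dom M e)" "(Ide M (Dom M e) \<boxtimes> e) \<cdot> k' = k"
    by (auto simp: Hom_iff)
  note [simp] = k'(1)[unfolded Hom_iff]
  have "(e \<boxtimes> e) \<cdot> k' = h"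
    unfolding k(2)[symmetric] k'(2)[symmetric] by (simp add: interchange_Comp)
  with k'(1) show ?thesis
    by (rule that)
qed

text \<open>Both conditions are additive in \<open>x\<close>, by additivity of the tensor functors
  and biadditivity of composition. So \<open>prim_sum\<close> inherits them from the two unit
  insertions.\<close>

lemma braid_intertwines_HAdd:
  assumes f: "braid_intertwines X c f" and g: "braid_intertwines X c g"
    and c: "X \<in> Obj M" "c \<in> Hom M (X \<boxdot> X) (X \<boxdot> X)"
  shows "braid_intertwines X c (HAdd M f g)"
proof -
  have H: "f \<in> Hom M X (X \<boxdot> X)" "g \<in> Hom M X (X \<boxdot> X)"
    using f g by (auto simp: braid_intertwines_def)
  note [simp] = c(1) c(2)[unfolded Hom_iff] H[unfolded Hom_iff]
  let ?ai = "inv_arr M (Assoc M X X X)"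
  have "(HAdd M f g \<boxtimes> Ide M X) \<cdot> c = HAdd M ((f \<boxtimes> Ide M X) \<cdot> c) ((g \<boxtimes> Ide M X) \<cdot> c)"
    by (simp add: TenA_HAdd[OF H] HAdd_Comp)
  also have "\<dots> = br23 M X c \<cdot> br12 M X c \<cdot> ?ai \<cdot> (Ide M X \<boxtimes> HAdd M f g)"
    using f g unfolding braid_intertwines_def by (simp add: TenA_HAdd[OF H] HAdd_Comp)
  finally have 1: "(HAdd M f g \<boxtimes> Ide M X) \<cdot> c = br23 M X c \<cdot> br12 M X c \<cdot> ?ai \<cdot> (Ide M X \<boxtimes> HAdd M f g)" .
  have "?ai \<cdot> (Ide M X \<boxtimes> HAdd M f g) \<cdot> c = HAdd M (?ai \<cdot> (Ide M X \<boxtimes> f) \<cdot> c) (?ai \<cdot> (Ide M X \<boxtimes> g) \<cdot> c)"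
    by (simp add: TenA_HAdd[OF H] HAdd_Comp)
  also have "\<dots> = br12 M X c \<cdot> br23 M X c \<cdot> (HAdd M f g \<boxtimes> Ide M X)"
    using f g unfolding braid_intertwines_def by (simp add: TenA_HAdd[OF H] HAdd_Comp)
  finally show ?thesis
    using 1 HAdd_Hom[OF H] by (simp add: braid_intertwines_def)
qed

lemma braid_intertwines_prim_sum:
  assumes "braided_bialgebra M A"
  shows "braid_intertwines (carr A) (braid A) (prim_sum M A)"
  unfolding prim_sum_def
  using braided_bialgebraD(1)[OF assms] braided_objectD(2-4)[OF braided_bialgebraD(14)[OF assms]]
  by (intro braid_intertwines_HAdd braid_intertwines_units[OF assms]) (simp_all add: Hom_iff)

lemma prim_arr_equalizer:
  assumes "braided_bialgebra M A"
  shows "is_equalizer M (comul A) (prim_sum M A) (prim_arr M eqz A)"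
proof -
  have "comul A \<in> Hom M (carr A) (carr A \<boxdot> carr A)" "prim_sum M A \<in> Hom M (carr A) (carr A \<boxdot> carr A)"
    using braid_intertwines_comul[OF assms] braid_intertwines_prim_sum[OF assms]
    unfolding braid_intertwines_def by blast+
  then have "parallel M (comul A) (prim_sum M A)"
    by (simp add: parallel_def Hom_iff)
  then show ?thesis
    using choice unfolding prim_arr_def equalizer_choice_def by blast
qed

lemma prim_arr_simps:
  assumes "braided_bialgebra M A"
  shows "prim_arr M eqz A \<in> Arr M" "Dom M (prim_arr M eqz A) = prim M eqz A" "Cod M (prim_arr M eqz A) = carr A"
    "prim M eqz A \<in> Obj M"
  using equalizerD(3,6)[OF prim_arr_equalizer[OF assms]] braided_bialgebraD(9)[OF assms]
  by (auto simp: prim_def)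

text \<open>Both arrows of the defining pair satisfy \<open>braid_intertwines\<close>, so the
  braiding and its inverse factor through the square of the inclusion, which is monic. The second
  factorization is the candidate for the inverse of \<open>prim_braid\<close>.\<close>

lemma prim_braid_ex1:
  assumes A: "braided_bialgebra M A"
  shows "\<exists>!c. c \<in> Hom M (prim M eqz A \<boxdot> prim M eqz A) (prim M eqz A \<boxdot> prim M eqz A) \<and>
      (prim_arr M eqz A \<boxtimes> prim_arr M eqz A) \<cdot> c = braid A \<cdot> (prim_arr M eqz A \<boxtimes> prim_arr M eqz A)"
    and "\<exists>c. c \<in> Hom M (prim M eqz A \<boxdot> prim M eqz A) (prim M eqz A \<boxdot> prim M eqz A) \<and>
      (prim_arr M eqz A \<boxtimes> prim_arr M eqz A) \<cdot> c = inv_arr M (braid A) \<cdot> (prim_arr M eqz A \<boxtimes> prim_arr M eqz A)"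
proof -
  let ?e = "prim_arr M eqz A" and ?P = "prim M eqz A"
  note eqz = prim_arr_equalizer[OF A]
  note c = braided_objectD[OF braided_bialgebraD(14)[OF A]]
  note [simp] = c prim_arr_simps[OF A] braided_bialgebraD(1,8,9,10)[OF A]
  note eqs = braid_intertwines_equalizer[OF braid_intertwines_comul[OF A] braid_intertwines_prim_sum[OF A]
      c(1) _ c(5) _
      equalizerD(7)[OF eqz], of ?P]
  obtain k where k: "k \<in> Hom M (?P \<boxdot> ?P) (?P \<boxdot> ?P)" "(?e \<boxtimes> ?e) \<cdot> k = braid A \<cdot> (?e \<boxtimes> ?e)"
    by (rule equalizer_square_factor[OF eqz, of "carr A" "braid A \<cdot> (?e \<boxtimes> ?e)" "?P \<boxdot> ?P"])
      (auto simp: Hom_iff intro!: eqs)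
  show "\<exists>!c. c \<in> Hom M (?P \<boxdot> ?P) (?P \<boxdot> ?P) \<and> (?e \<boxtimes> ?e) \<cdot> c = braid A \<cdot> (?e \<boxtimes> ?e)"
  proof (rule ex1I[of _ k])
    fix c assume "c \<in> Hom M (?P \<boxdot> ?P) (?P \<boxdot> ?P) \<and> (?e \<boxtimes> ?e) \<cdot> c = braid A \<cdot> (?e \<boxtimes> ?e)"
    with k show "c = k"
      by (metis mono_arrD[OF mono_arr_TenA_equalizer(1)[OF eqz]] TenA_simps(2) prim_arr_simps(1,2)[OF A])
  qed (use k in simp)
  obtain k' where k': "k' \<in> Hom M (?P \<boxdot> ?P) (?P \<boxdot> ?P)" "(?e \<boxtimes> ?e) \<cdot> k' = inv_arr M (braid A) \<cdot> (?e \<boxtimes> ?e)"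
    by (rule equalizer_square_factor[OF eqz, of "carr A" "inv_arr M (braid A) \<cdot> (?e \<boxtimes> ?e)" "?P \<boxdot> ?P"])
      (auto simp: Hom_iff intro!: eqs)
  then show "\<exists>c. c \<in> Hom M (?P \<boxdot> ?P) (?P \<boxdot> ?P) \<and> (?e \<boxtimes> ?e) \<cdot> c = inv_arr M (braid A) \<cdot> (?e \<boxtimes> ?e)"
    by blast
qed

lemma prim_braid:
  assumes A: "braided_bialgebra M A"
  shows prim_braid_Hom: "prim_braid M eqz A \<in> Hom M (prim M eqz A \<boxdot> prim M eqz A) (prim M eqz A \<boxdot> prim M eqz A)"
    and prim_braid_eq: "(prim_arr M eqz A \<boxtimes> prim_arr M eqz A) \<cdot> prim_braid M eqz A
      = braid A \<cdot> (prim_arr M eqz A \<boxtimes> prim_arr M eqz A)"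
  using theI'[OF prim_braid_ex1(1)[OF A]] unfolding prim_braid_def by auto

text \<open>The restrictions of the braiding and of its inverse are mutually inverse, as is seen
  after the monic square of the inclusion.\<close>

lemma iso_arr_prim_braid:
  assumes A: "braided_bialgebra M A"
  shows "iso_arr M (prim_braid M eqz A)"
proof -
  let ?e = "prim_arr M eqz A" and ?P = "prim M eqz A" and ?k = "prim_braid M eqz A"
  note c = braided_objectD[OF braided_bialgebraD(14)[OF A]]
  note k = prim_braid_Hom[OF A]
  obtain k' where k': "k' \<in> Hom M (?P \<boxdot> ?P) (?P \<boxdot> ?P)" "(?e \<boxtimes> ?e) \<cdot> k' = inv_arr M (braid A) \<cdot> (?e \<boxtimes> ?e)"
    using prim_braid_ex1(2)[OF A] by blast
  note [simp] = c prim_arr_simps[OF A] k[unfolded Hom_iff] k'(1)[unfolded Hom_iff]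
  note mono = mono_arrD[OF mono_arr_TenA_equalizer(1)[OF prim_arr_equalizer[OF A]]]
  have "(?e \<boxtimes> ?e) \<cdot> k' \<cdot> ?k = inv_arr M (braid A) \<cdot> (?e \<boxtimes> ?e) \<cdot> ?k"
    by (simp add: Comp_reduce[OF k'(2)])
  also have "\<dots> = (?e \<boxtimes> ?e) \<cdot> Ide M (?P \<boxdot> ?P)"
    by (simp add: prim_braid_eq[OF A])
  finally have "k' \<cdot> ?k = Ide M (?P \<boxdot> ?P)"
    by (rule mono) (auto simp: Hom_iff)
  moreover have "(?e \<boxtimes> ?e) \<cdot> ?k \<cdot> k' = (?e \<boxtimes> ?e) \<cdot> Ide M (?P \<boxdot> ?P)"
    by (simp add: Comp_reduce[OF prim_braid_eq[OF A]] k'(2))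
  then have "?k \<cdot> k' = Ide M (?P \<boxdot> ?P)"
    by (rule mono) (auto simp: Hom_iff)
  ultimately show ?thesis
    by (rule iso_arrI(1)[OF k k'(1)])
qed

lemma braided_object_prim:
  assumes A: "braided_bialgebra M A"
  shows "braided_object M (prim M eqz A) (prim_braid M eqz A)"
proof -
  interpret idf: additive_monoidal_functor M M id_functor "Ide M (Unit M)" "\<lambda>U V. Ide M (U \<boxdot> V)"
    by (rule additive_monoidal_functor_id)
  \<comment> \<open>The inclusion \<xi> is taken as a frame over the identity functor. The transport
    square of the braiding is then the defining equation of \<open>prim_braid\<close>, and the braid
    equation is pulled back along the monic triple tensor of \<xi>.\<close>
  let ?a = "(carr A, prim_arr M eqz A)"
  note c = braided_bialgebraD(14)[OF A]
  note [simp] = braided_objectD[OF c] prim_arr_simps[OF A] prim_braid_Hom[OF A, unfolded Hom_iff]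
  note T = idf.frame_def idf.frame_tensor_def idf.transport_def
  show ?thesis
  proof (rule idf.braided_object_transport[OF c _ _ iso_arr_prim_braid[OF A], of ?a])
    show "idf.frame ?a (carr A) (prim M eqz A)"
      by (simp add: T Hom_iff id_functor_simps)
    show "idf.transport (idf.frame_tensor ?a ?a) (braid A) (prim_braid M eqz A) (idf.frame_tensor ?a ?a)"
      by (simp add: T Hom_iff id_functor_simps prim_braid_eq[OF A])
    show "mono_arr (snd (idf.frame_tensor (idf.frame_tensor ?a ?a) ?a))"
      by (simp add: T mono_arr_TenA_equalizer(2)[OF prim_arr_equalizer[OF A]])
  qed
qed

lemma braided_morphism_prim_arr:
  assumes A: "braided_bialgebra M A"
  shows "braided_morphism M (prim M eqz A, prim_braid M eqz A) (prim_arr M eqz A) (carr A, braid A)"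
  using prim_arr_simps[OF A] prim_braid_eq[OF A] by (simp add: braided_morphism_def Hom_iff)

lemma prim_sum_natural:
  assumes A: "braided_bialgebra M A" and B: "braided_bialgebra M B" and f: "bialgebra_morphism M A f B"
  shows "prim_sum M B \<cdot> f = (f \<boxtimes> f) \<cdot> prim_sum M A"
proof -
  \<comment> \<open>As \<open>f\<close> maps the unit of \<open>A\<close> to that of \<open>B\<close>, it is a frame along which the unit is transported.\<close>
  interpret idf: additive_monoidal_functor M M id_functor "Ide M (Unit M)" "\<lambda>U V. Ide M (U \<boxdot> V)"
    by (rule additive_monoidal_functor_id)
  let ?a = "(carr B, f)"
  note [simp] = braided_bialgebraD[OF A] braided_bialgebraD[OF B] bialgebra_morphismD(1-3)[OF f]
  note T = idf.frame_def idf.frame_tensor_def idf.transport_def idf.frame_unit_def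
  have "idf.transport ?a (prim_sum M B) (prim_sum M A) (idf.frame_tensor ?a ?a)"
    by (rule idf.transport_prim_sum)
      (simp_all add: T Hom_iff id_functor_simps bialgebra_morphismD(6)[OF f])
  then show ?thesis
    by (simp add: T id_functor_simps)
qed

text \<open>A bialgebra morphism commutes with the comultiplication and, preserving units, with
  \<open>prim_sum\<close>. Hence its composite with the inclusion for \<open>A\<close> equalizes the
  pair of \<open>B\<close>.\<close>

lemma prim_map_ex1:
  assumes A: "braided_bialgebra M A" and B: "braided_bialgebra M B" and f: "bialgebra_morphism M A f B"
  shows "\<exists>!g. g \<in> Hom M (prim M eqz A) (prim M eqz B) \<and> prim_arr M eqz B \<cdot> g = f \<cdot> prim_arr M eqz A"
proof -
  note [simp] = braided_bialgebraD[OF A] braided_bialgebraD[OF B] bialgebra_morphismD(1-3)[OF f]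
    prim_arr_simps[OF A] prim_arr_simps[OF B] equalizerD(1-6)[OF prim_arr_equalizer[OF A]]
     equalizerD(1-6)[OF prim_arr_equalizer[OF B]]
  have "comul B \<cdot> f \<cdot> prim_arr M eqz A = (f \<boxtimes> f) \<cdot> comul A \<cdot> prim_arr M eqz A"
    by (simp add: Comp_reduce[OF bialgebra_morphismD(7)[OF f]])
  also have "\<dots> = prim_sum M B \<cdot> f \<cdot> prim_arr M eqz A"
    by (simp add: equalizerD(7)[OF prim_arr_equalizer[OF A]] Comp_reduce[OF prim_sum_natural[OF A B f]])
  finally show ?thesis
    using equalizer_univ[OF prim_arr_equalizer[OF B], of "f \<cdot> prim_arr M eqz A"] by simp
qed

end

section \<open>Comparison of the primitives\<close>

text \<open>The inverse is automatically braided: \<open>f\<close> after it is an identity, and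
  \<open>f \<boxtimes> f\<close> is monic.\<close>

lemma (in monoidal_category) iso_arr_Br:
  assumes V: "braided_object M (fst V) (snd V)" and W: "braided_object M (fst W) (snd W)"
    and f: "braided_morphism M V f W" and iso: "iso_arr M f"
  shows "iso_arr (Br M) (V, f, W)"
proof -
  interpret Br: category "Br M"
    by (rule category_Br)
  note [simp] = braided_morphismD(1-3)[OF f] iso braided_objectD(1)[OF V] braided_objectD(1)[OF W]
  have "braided_morphism M W (inv_arr M f) V"
    by (rule braided_morphism_factor[OF f _ _ _ W V W])
      (simp_all add: braided_morphism_Ide W mono_arr_iso iso_arr_TenA Hom_iff)
  then show ?thesis
    using V W f by (intro Br.iso_arrI(1)[of _ V W "(W, inv_arr M f, V)"]) (simp_all add: Hom_Br)
qed

lemma is_functor_comp: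
  assumes "is_functor C D F" "is_functor D E G"
  shows "is_functor C E (G \<circ>\<^sub>F F)"
proof -
  interpret F: is_functor C D F by fact
  interpret G: is_functor D E G by fact
  show ?thesis
    by unfold_locales
      (simp_all add: comp_functor_def F.on_arr_Hom G.on_arr_Hom F.on_arr_Comp
        G.on_arr_Comp[OF F.on_arr_Hom F.on_arr_Hom])
qed

section \<open>Functoriality of \<open>P_Br\<close>\<close>

context braided_primitives
begin

abbreviation P_obj :: "('o, 'a) bialg \<Rightarrow> 'o \<times> 'a" where
  "P_obj A \<equiv> (prim M eqz A, prim_braid M eqz A)"

definition prim_map :: "('o, 'a) bialg \<Rightarrow> 'a \<Rightarrow> ('o, 'a) bialg \<Rightarrow> 'a" where
  "prim_map A f B = (THE g. g \<in> Hom M (prim M eqz A) (prim M eqz B) \<and>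
     prim_arr M eqz B \<cdot> g = f \<cdot> prim_arr M eqz A)"

lemma P_Br_simps [simp]:
  "on_obj (P_Br M eqz) A = P_obj A"
  "on_arr (P_Br M eqz) (A, f, B) = (P_obj A, prim_map A f B, P_obj B)"
  by (simp_all add: P_Br_def prim_map_def)

lemma prim_map:
  assumes "braided_bialgebra M A" "braided_bialgebra M B" "bialgebra_morphism M A f B"
  shows prim_map_Hom: "prim_map A f B \<in> Hom M (prim M eqz A) (prim M eqz B)"
    and prim_map_eq: "prim_arr M eqz B \<cdot> prim_map A f B = f \<cdot> prim_arr M eqz A"
  using theI'[OF prim_map_ex1[OF assms]] unfolding prim_map_def by auto

lemma prim_map_eqI:
  assumes "braided_bialgebra M A" "braided_bialgebra M B" "bialgebra_morphism M A f B"
    and "g \<in> Hom M (prim M eqz A) (prim M eqz B)" "prim_arr M eqz B \<cdot> g = f \<cdot> prim_arr M eqz A"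
  shows "prim_map A f B = g"
  using prim_map_ex1[OF assms(1-3)] prim_map[OF assms(1-3)] assms(4,5) by blast

text \<open>Followed by the inclusion for \<open>B\<close> it becomes \<open>f\<close> after the
  inclusion for \<open>A\<close>, a composite of braided morphisms;
  \<open>braided_morphism_factor\<close> removes the inclusion.\<close>

lemma braided_morphism_prim_map:
  assumes A: "braided_bialgebra M A" and B: "braided_bialgebra M B" and f: "bialgebra_morphism M A f B"
  shows "braided_morphism M (P_obj A) (prim_map A f B) (P_obj B)"
proof (rule braided_morphism_factor[OF braided_morphism_prim_arr[OF B]])
  show "braided_morphism M (P_obj A) (prim_arr M eqz B \<cdot> prim_map A f B) (carr B, braid B)"
    unfolding prim_map_eq[OF A B f]
    by (rule braided_morphism_Comp[OF braided_morphism_prim_arr[OF A] bialgebra_morphismD(4)[OF f]])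
      (simp_all add: A B braided_object_prim braided_bialgebraD(14))
qed (simp_all add: A B prim_map_Hom f braided_object_prim braided_bialgebraD(14)
    mono_arr_TenA_equalizer(1)[OF prim_arr_equalizer])

lemma is_functor_P_Br: "is_functor (BrBialg M) (Br M) (P_Br M eqz)"
proof (intro is_functor.intro is_functor_axioms.intro category_BrBialg category_Br)
  show "on_obj (P_Br M eqz) A \<in> Obj (Br M)" if "A \<in> Obj (BrBialg M)" for A
    using that by (simp add: braided_object_prim)
  show "on_arr (P_Br M eqz) f \<in> Hom (Br M) (on_obj (P_Br M eqz) A) (on_obj (P_Br M eqz) B)"
    if "f \<in> Hom (BrBialg M) A B" for f A B
    using that unfolding Hom_BrBialg Hom_Br by (auto simp: braided_object_prim braided_morphism_prim_map)
  show "on_arr (P_Br M eqz) (Ide (BrBialg M) A) = Ide (Br M) (on_obj (P_Br M eqz) A)"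
    if "A \<in> Obj (BrBialg M)" for A
  proof -
    have A: "braided_bialgebra M A"
      using that by simp
    have "prim_map A (Ide M (carr A)) A = Ide M (prim M eqz A)"
      by (rule prim_map_eqI[OF A A bialgebra_morphism_Ide[OF A]]) (simp_all add: prim_arr_simps[OF A] Hom_iff)
    then show ?thesis
      by simp
  qed
  show "on_arr (P_Br M eqz) (g \<cdot>\<^bsub>BrBialg M\<^esub> f) = on_arr (P_Br M eqz) g \<cdot>\<^bsub>Br M\<^esub> on_arr (P_Br M eqz) f"
    if fH: "f \<in> Hom (BrBialg M) A B" and gH: "g \<in> Hom (BrBialg M) B C" for f g A B C
  proof -
    obtain f' g' where fg: "f = (A, f', B)" "g = (B, g', C)"
      and A: "braided_bialgebra M A" and B: "braided_bialgebra M B" and C: "braided_bialgebra M C"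
      and f': "bialgebra_morphism M A f' B" and g': "bialgebra_morphism M B g' C"
      using fH gH by (auto simp: Hom_BrBialg)
    note [simp] = prim_arr_simps[OF A] prim_arr_simps[OF B] prim_arr_simps[OF C]
      bialgebra_morphismD(1-3)[OF f'] bialgebra_morphismD(1-3)[OF g']
      prim_map_Hom[OF A B f', unfolded Hom_iff] prim_map_Hom[OF B C g', unfolded Hom_iff]
    have "prim_map A (g' \<cdot> f') C = prim_map B g' C \<cdot> prim_map A f' B"
      by (rule prim_map_eqI[OF A C bialgebra_morphism_Comp[OF f' g' A B C]])
        (simp_all add: Hom_iff Comp_reduce[OF prim_map_eq[OF B C g']] prim_map_eq[OF A B f'])
    then show ?thesis
      by (simp add: fg)
  qed
qed

end

section \<open>The primitives of \<open>F A\<close> and the image under \<open>F\<close> of the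
  primitives of \<open>A\<close>\<close>

locale braided_primitives_functor =
  additive_monoidal_functor M N F \<phi>\<^sub>0 \<phi>\<^sub>2 + src: braided_primitives M eqz + tgt: braided_primitives N eqz'
  for M :: "('o, 'a, 'x) addmoncat_scheme" and N :: "('p, 'b, 'y) addmoncat_scheme"
  and F :: "('o, 'a, 'p, 'b) cfunctor" and \<phi>\<^sub>0 :: 'b and \<phi>\<^sub>2 :: "'o \<Rightarrow> 'o \<Rightarrow> 'b"
  and eqz :: "'a \<Rightarrow> 'a \<Rightarrow> 'a" and eqz' :: "'b \<Rightarrow> 'b \<Rightarrow> 'b" +
  assumes preserves_equalizers: "preserves_equalizers M N F"
begin

abbreviation F_bialg :: "('o, 'a) bialg \<Rightarrow> ('p, 'b) bialg" where
  "F_bialg \<equiv> BrBialg_map_obj N F \<phi>\<^sub>0 \<phi>\<^sub>2"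

abbreviation F_Br :: "'o \<times> 'a \<Rightarrow> 'p \<times> 'b" where
  "F_Br \<equiv> Br_map_obj N F \<phi>\<^sub>2"

text \<open>The transport square of \<open>prim_sum\<close> for identity frames, solved for the
  arrow in \<open>N\<close> by inverting \<open>\<phi>\<^sub>2\<close>. It matches the formula for
  the induced comultiplication, so one isomorphism carries the whole pair.\<close>

lemma prim_sum_image:
  assumes A: "braided_bialgebra M A"
  shows "prim_sum N (F_bialg A) = inv_arr N (\<phi>\<^sub>2 (carr A) (carr A)) \<cdot>\<^bsub>N\<^esub> on_arr F (prim_sum M A)"
proof -
  note T = bialg_transportD[OF bialg_transport_BrBialg_map_obj[OF A]]
  note [simp] = src.braided_bialgebraD(1)[OF A]
  have "prim_sum N (F_bialg A) \<in> Hom N (on_obj F (carr A)) (on_obj F (carr A) \<boxdot>\<^bsub>N\<^esub> on_obj F (carr A))"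
    using tgt.braid_intertwines_prim_sum[OF braided_bialgebra_BrBialg_map_obj[OF A]]
    by (simp add: tgt.braid_intertwines_def)
  moreover have "prim_sum M A \<in> Hom M (carr A) (carr A \<boxdot>\<^bsub>M\<^esub> carr A)"
    using src.braid_intertwines_prim_sum[OF A] by (simp add: src.braid_intertwines_def)
  moreover have "on_arr F (prim_sum M A) \<cdot>\<^bsub>N\<^esub> snd (frame_obj (carr A))
      = snd (frame_obj (carr A) \<star> frame_obj (carr A)) \<cdot>\<^bsub>N\<^esub> prim_sum N (F_bialg A)"
    using transport_prim_sum[OF T(1,3)] unfolding transport_def by blast
  ultimately show ?thesis
    by (simp add: snd_frame_tensor_obj tgt.Hom_iff src.Hom_iff) (simp add: frame_obj_def)
qed

lemma equalizer_on_arr_prim_arr: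
  assumes A: "braided_bialgebra M A"
  shows "is_equalizer N (comul (F_bialg A)) (prim_sum N (F_bialg A)) (on_arr F (prim_arr M eqz A))"
proof -
  note [simp] = src.braided_bialgebraD(1,8,9,10)[OF A]
  have "is_equalizer N (on_arr F (comul A)) (on_arr F (prim_sum M A)) (on_arr F (prim_arr M eqz A))"
    using preserves_equalizers src.prim_arr_equalizer[OF A] unfolding preserves_equalizers_def by blast
  then show ?thesis
    unfolding prim_sum_image[OF A] BrBialg_map_obj_simps by (rule tgt.equalizer_postcompose_iso) simp_all
qed

lemma F_Br_forget: "F_Br (carr A, braid A) = (carr (F_bialg A), braid (F_bialg A))"
  by simp

lemma braided_morphism_on_arr_prim_arr:
  assumes A: "braided_bialgebra M A"
  shows "braided_morphism N (F_Br (src.P_obj A)) (on_arr F (prim_arr M eqz A)) (carr (F_bialg A), braid (F_bialg A))"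
  using braided_morphism_on_arr[OF src.braided_morphism_prim_arr[OF A]]
    src.braided_object_prim[OF A] src.braided_bialgebraD(14)[OF A]
  unfolding F_Br_forget by simp

definition comparison :: "('o, 'a) bialg \<Rightarrow> 'b" where
  "comparison A = (THE k. k \<in> Hom N (prim N eqz' (F_bialg A)) (on_obj F (prim M eqz A)) \<and>
     on_arr F (prim_arr M eqz A) \<cdot>\<^bsub>N\<^esub> k = prim_arr N eqz' (F_bialg A))"

lemma comparison:
  assumes A: "braided_bialgebra M A"
  shows comparison_Hom: "comparison A \<in> Hom N (prim N eqz' (F_bialg A)) (on_obj F (prim M eqz A))"
    and comparison_eq: "on_arr F (prim_arr M eqz A) \<cdot>\<^bsub>N\<^esub> comparison A = prim_arr N eqz' (F_bialg A)"
proof -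
  note E = tgt.prim_arr_equalizer[OF braided_bialgebra_BrBialg_map_obj[OF A]]
  note [simp] = tgt.prim_arr_simps(1,2)[OF braided_bialgebra_BrBialg_map_obj[OF A]] src.prim_arr_simps[OF A]
  have "\<exists>!k. k \<in> Hom N (prim N eqz' (F_bialg A)) (on_obj F (prim M eqz A)) \<and>
     on_arr F (prim_arr M eqz A) \<cdot>\<^bsub>N\<^esub> k = prim_arr N eqz' (F_bialg A)"
    using tgt.equalizer_univ[OF equalizer_on_arr_prim_arr[OF A] tgt.equalizerD(3,6,7)[OF E]] by simp
  from theI'[OF this] show "comparison A \<in> Hom N (prim N eqz' (F_bialg A)) (on_obj F (prim M eqz A))"
    "on_arr F (prim_arr M eqz A) \<cdot>\<^bsub>N\<^esub> comparison A = prim_arr N eqz' (F_bialg A)"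
    unfolding comparison_def by auto
qed

lemma iso_arr_comparison:
  assumes A: "braided_bialgebra M A"
  shows "iso_arr N (comparison A)"
  using tgt.iso_arr_equalizer_comparison[OF equalizer_on_arr_prim_arr[OF A]
      tgt.prim_arr_equalizer[OF braided_bialgebra_BrBialg_map_obj[OF A]]]
    comparison[OF A] tgt.prim_arr_simps(2)[OF braided_bialgebra_BrBialg_map_obj[OF A]] src.prim_arr_simps[OF A]
  by simp

text \<open>The comparison factors the braided morphism \<xi>' through the image of \<xi>, which is
  itself braided and has a monic tensor square.\<close>

lemma braided_morphism_comparison:
  assumes A: "braided_bialgebra M A"
  shows "braided_morphism N (tgt.P_obj (F_bialg A)) (comparison A) (F_Br (src.P_obj A))"
proof -
  note A' = braided_bialgebra_BrBialg_map_obj[OF A]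
  show ?thesis
    by (rule tgt.braided_morphism_factor[OF braided_morphism_on_arr_prim_arr[OF A]])
      (use tgt.braided_morphism_prim_arr[OF A'] tgt.braided_object_prim[OF A'] tgt.braided_bialgebraD(14)[OF A']
        braided_object_Br_map_obj[of "src.P_obj A"] src.braided_object_prim[OF A] comparison[OF A]
        tgt.mono_arr_TenA_equalizer(1)[OF equalizer_on_arr_prim_arr[OF A]] in simp_all)
qed

text \<open>Followed by the monic image of \<xi> at \<open>B\<close>, both composites become
  \<open>on_arr F f\<close> after \<xi>' at \<open>F A\<close>.\<close>

lemma comparison_natural:
  assumes A: "braided_bialgebra M A" and B: "braided_bialgebra M B" and f: "bialgebra_morphism M A f B"
  shows "comparison B \<cdot>\<^bsub>N\<^esub> tgt.prim_map (F_bialg A) (on_arr F f) (F_bialg B)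
    = on_arr F (src.prim_map A f B) \<cdot>\<^bsub>N\<^esub> comparison A"
proof -
  note A' = braided_bialgebra_BrBialg_map_obj[OF A] and B' = braided_bialgebra_BrBialg_map_obj[OF B]
    and f' = bialgebra_morphism_on_arr[OF f A B]
  note [simp] = src.prim_arr_simps[OF A] src.prim_arr_simps[OF B] tgt.prim_arr_simps[OF A'] tgt.prim_arr_simps[OF B']
    comparison_Hom[OF A, unfolded tgt.Hom_iff] comparison_Hom[OF B, unfolded tgt.Hom_iff]
    src.prim_map_Hom[OF A B f, unfolded src.Hom_iff] tgt.prim_map_Hom[OF A' B' f', unfolded tgt.Hom_iff]
    src.bialgebra_morphismD(1-3)[OF f]
  have F: "on_arr F (prim_arr M eqz B) \<cdot>\<^bsub>N\<^esub> on_arr F (src.prim_map A f B) = on_arr F f \<cdot>\<^bsub>N\<^esub> on_arr F (prim_arr M eqz A)"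
    using src.prim_map_eq[OF A B f] by (simp flip: on_arr_Comp_arr)
  have "on_arr F (prim_arr M eqz B) \<cdot>\<^bsub>N\<^esub> comparison B \<cdot>\<^bsub>N\<^esub> tgt.prim_map (F_bialg A) (on_arr F f) (F_bialg B)
      = on_arr F f \<cdot>\<^bsub>N\<^esub> prim_arr N eqz' (F_bialg A)"
    by (simp add: tgt.Comp_reduce[OF comparison_eq[OF B]] tgt.prim_map_eq[OF A' B' f'])
  also have "\<dots> = on_arr F (prim_arr M eqz B) \<cdot>\<^bsub>N\<^esub> on_arr F (src.prim_map A f B) \<cdot>\<^bsub>N\<^esub> comparison A"
    by (simp add: tgt.Comp_reduce[OF F] comparison_eq[OF A])
  finally show ?thesis
    by (rule tgt.mono_arrD[OF tgt.mono_arr_equalizer[OF equalizer_on_arr_prim_arr[OF B]]])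
      (auto simp: tgt.Hom_iff)
qed

abbreviation "G\<^sub>1 \<equiv> P_Br N eqz' \<circ>\<^sub>F BrBialg_map N F \<phi>\<^sub>0 \<phi>\<^sub>2"

abbreviation "G\<^sub>2 \<equiv> Br_map N F \<phi>\<^sub>2 \<circ>\<^sub>F P_Br M eqz"

lemma composite_simps:
  "on_obj G\<^sub>1 A = tgt.P_obj (F_bialg A)" "on_obj G\<^sub>2 A = F_Br (src.P_obj A)"
  "on_arr G\<^sub>1 (A, f, B)
    = (tgt.P_obj (F_bialg A), tgt.prim_map (F_bialg A) (on_arr F f) (F_bialg B), tgt.P_obj (F_bialg B))"
  "on_arr G\<^sub>2 (A, f, B) = (F_Br (src.P_obj A), on_arr F (src.prim_map A f B), F_Br (src.P_obj B))"
  by (simp_all add: comp_functor_def BrBialg_map_def Br_map_def)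

lemma is_functor_composites:
  "is_functor (BrBialg M) (Br N) G\<^sub>1" "is_functor (BrBialg M) (Br N) G\<^sub>2"
  by (rule is_functor_comp[OF is_functor_BrBialg_map tgt.is_functor_P_Br]
      is_functor_comp[OF src.is_functor_P_Br is_functor_Br_map])+

lemma natural_isomorphism_comparison:
  "natural_isomorphism (BrBialg M) (Br N) G\<^sub>1 G\<^sub>2
    (\<lambda>A. (tgt.P_obj (F_bialg A), comparison A, F_Br (src.P_obj A)))"
  (is "natural_isomorphism _ _ _ _ ?\<theta>")
proof -
  have obj: "braided_object N (fst (F_Br (src.P_obj A))) (snd (F_Br (src.P_obj A)))"
     "braided_object N (fst (tgt.P_obj (F_bialg A))) (snd (tgt.P_obj (F_bialg A)))"
    if "braided_bialgebra M A" for A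
    using that by (simp_all only: braided_object_Br_map_obj fst_conv snd_conv src.braided_object_prim
        tgt.braided_object_prim braided_bialgebra_BrBialg_map_obj)
  have "?\<theta> A \<in> Hom (Br N) (on_obj G\<^sub>1 A) (on_obj G\<^sub>2 A)" if "A \<in> Obj (BrBialg M)" for A
    using that obj[of A] braided_morphism_comparison[of A] unfolding composite_simps tgt.Hom_Br by simp
  moreover have "?\<theta> (Cod (BrBialg M) f) \<cdot>\<^bsub>Br N\<^esub> on_arr G\<^sub>1 f = on_arr G\<^sub>2 f \<cdot>\<^bsub>Br N\<^esub> ?\<theta> (Dom (BrBialg M) f)"
    if "f \<in> Arr (BrBialg M)" for f
  proof -
    have "f \<in> Hom (BrBialg M) (Dom (BrBialg M) f) (Cod (BrBialg M) f)"
      using that by (simp add: Hom_def)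
    then obtain A g B where "f = (A, g, B)" "braided_bialgebra M A" "braided_bialgebra M B"
        "bialgebra_morphism M A g B"
      unfolding src.Hom_BrBialg by blast
    then show ?thesis
      by (simp add: composite_simps comparison_natural del: Br_map_obj_Pair)
  qed
  moreover have "iso_arr (Br N) (?\<theta> A)" if "A \<in> Obj (BrBialg M)" for A
    using that obj[of A] by (intro tgt.iso_arr_Br braided_morphism_comparison iso_arr_comparison) simp_all
  ultimately show ?thesis
    using is_functor_composites unfolding natural_isomorphism_def natural_transformation_def by blast
qed

lemma xi_comparison:
  assumes "A \<in> Obj (BrBialg M)"
  shows "on_arr (Br_map N F \<phi>\<^sub>2) (xi M eqz A) \<cdot>\<^bsub>Br N\<^esub> (tgt.P_obj (F_bialg A), comparison A, F_Br (src.P_obj A))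
    = xi N eqz' (on_obj (BrBialg_map N F \<phi>\<^sub>0 \<phi>\<^sub>2) A)"
  using assms comparison_eq[of A]
  by (simp add: xi_def Br_map_def BrBialg_map_def BrBialg_forget_def)

text \<open>By \<open>prim_sum_image\<close> the pair in \<open>compatible_choices\<close> is the
  one defining the primitives of \<open>F A\<close>, so the inclusions coincide; taking domains
  gives the objects. The braiding induced by \<open>F\<close> solves the equation that characterizes
  \<open>prim_braid\<close>, because the image of \<xi> is braided.\<close>

lemma compatible_prim:
  assumes "compatible_choices M N F \<phi>\<^sub>2 eqz eqz'" and A: "braided_bialgebra M A"
  shows compatible_prim_arr: "prim_arr N eqz' (F_bialg A) = on_arr F (prim_arr M eqz A)"
    and compatible_P_obj: "tgt.P_obj (F_bialg A) = F_Br (src.P_obj A)"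
proof -
  note A' = braided_bialgebra_BrBialg_map_obj[OF A]
  have "A \<in> Obj (BrBialg M)"
    using A by simp
  then show \<xi>: "prim_arr N eqz' (F_bialg A) = on_arr F (prim_arr M eqz A)"
    using assms(1) unfolding compatible_choices_def Let_def prim_arr_def[of N] prim_arr_def[of M]
      prim_sum_image[OF A] BrBialg_map_obj_simps by blast
  have P: "prim N eqz' (F_bialg A) = on_obj F (prim M eqz A)"
    using tgt.prim_arr_simps(2)[OF A'] src.prim_arr_simps[OF A] unfolding \<xi> by simp
  have "braided_morphism N (F_Br (src.P_obj A)) (prim_arr N eqz' (F_bialg A)) (carr (F_bialg A), braid (F_bialg A))"
    unfolding \<xi> by (rule braided_morphism_on_arr_prim_arr[OF A])
  moreover have "braided_object N (fst (F_Br (src.P_obj A))) (snd (F_Br (src.P_obj A)))"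
    by (simp only: braided_object_Br_map_obj fst_conv snd_conv src.braided_object_prim[OF A])
  moreover have "fst (F_Br (src.P_obj A)) = prim N eqz' (F_bialg A)"
    by (simp add: P)
  ultimately have "snd (F_Br (src.P_obj A)) = prim_braid N eqz' (F_bialg A)"
    using tgt.prim_braid_ex1(1)[OF A'] tgt.prim_braid[OF A']
    unfolding braided_morphism_def braided_object_def by (metis snd_conv)
  then show "tgt.P_obj (F_bialg A) = F_Br (src.P_obj A)"
    by (simp add: P)
qed

text \<open>Once the inclusions coincide, the image under \<open>F\<close> of the map induced by
  \<open>f\<close> solves the equation that determines the map induced by
  \<open>F f\<close>.\<close>

lemma compatible_equal_functors:
  assumes c: "compatible_choices M N F \<phi>\<^sub>2 eqz eqz'"
  shows "equal_functors (BrBialg M) (Br N) G\<^sub>1 G\<^sub>2"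
proof -
  have "on_arr G\<^sub>1 f = on_arr G\<^sub>2 f" if f: "f \<in> Arr (BrBialg M)" for f
  proof -
    have "f \<in> Hom (BrBialg M) (Dom (BrBialg M) f) (Cod (BrBialg M) f)"
      using f by (simp add: Hom_def)
    then obtain A g B where f: "f = (A, g, B)" and A: "braided_bialgebra M A" and B: "braided_bialgebra M B"
        and g: "bialgebra_morphism M A g B"
      unfolding src.Hom_BrBialg by blast
    note [simp] = src.prim_arr_simps[OF A] src.prim_arr_simps[OF B] src.prim_map_Hom[OF A B g, unfolded src.Hom_iff]
      src.bialgebra_morphismD(1-3)[OF g]
    have P: "prim N eqz' (F_bialg A) = on_obj F (prim M eqz A)" "prim N eqz' (F_bialg B) = on_obj F (prim M eqz B)"
      using compatible_P_obj[OF c A] compatible_P_obj[OF c B] by simp_all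
    have "tgt.prim_map (F_bialg A) (on_arr F g) (F_bialg B) = on_arr F (src.prim_map A g B)"
    proof (rule tgt.prim_map_eqI)
      show "prim_arr N eqz' (F_bialg B) \<cdot>\<^bsub>N\<^esub> on_arr F (src.prim_map A g B) = on_arr F g \<cdot>\<^bsub>N\<^esub> prim_arr N eqz' (F_bialg A)"
        using src.prim_map_eq[OF A B g]
        by (simp add: compatible_prim_arr[OF c A] compatible_prim_arr[OF c B] flip: on_arr_Comp_arr)
    qed (simp_all add: A B g braided_bialgebra_BrBialg_map_obj bialgebra_morphism_on_arr P tgt.Hom_iff)
    then show ?thesis
      unfolding f composite_simps by (simp only: compatible_P_obj[OF c A] compatible_P_obj[OF c B])
  qed
  moreover have "on_obj G\<^sub>1 A = on_obj G\<^sub>2 A" if "A \<in> Obj (BrBialg M)" for A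
    using that compatible_P_obj[OF c, of A] unfolding composite_simps by simp
  ultimately show ?thesis
    using is_functor_composites by (simp add: equal_functors_def)
qed

lemma compatible_xi:
  assumes c: "compatible_choices M N F \<phi>\<^sub>2 eqz eqz'" and "A \<in> Obj (BrBialg M)"
  shows "xi N eqz' (on_obj (BrBialg_map N F \<phi>\<^sub>0 \<phi>\<^sub>2) A) = on_arr (Br_map N F \<phi>\<^sub>2) (xi M eqz A)"
proof -
  have A: "braided_bialgebra M A"
    using assms(2) by simp
  show ?thesis
    using compatible_prim_arr[OF c A] compatible_P_obj[OF c A]
    by (simp add: xi_def Br_map_def BrBialg_map_def BrBialg_forget_def)
qed

end

theorem proposition3p6:
  fixes M :: "('o, 'a, 'x) addmoncat_scheme" and M' :: "('p, 'b, 'y) addmoncat_scheme"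
    and F :: "('o, 'a, 'p, 'b) cfunctor" and \<phi>\<^sub>0 :: 'b and \<phi>\<^sub>2 :: "'o \<Rightarrow> 'o \<Rightarrow> 'b"
    and eqz :: "'a \<Rightarrow> 'a \<Rightarrow> 'a" and eqz' :: "'b \<Rightarrow> 'b \<Rightarrow> 'b"
  assumes "preadditive_monoidal_category M" and "preadditive_monoidal_category M'"
    and "has_equalizers M" and "has_equalizers M'"
    and "tensor_functors_additive M" and "tensor_functors_additive M'"
    and "tensor_functors_preserve_equalizers M" and "tensor_functors_preserve_equalizers M'"
    and "monoidal_functor M M' F \<phi>\<^sub>0 \<phi>\<^sub>2"
    and "additive M M' F"
    and "preserves_equalizers M M' F"
    and "equalizer_choice M eqz" and "equalizer_choice M' eqz'"
  shows
    "(compatible_choices M M' F \<phi>\<^sub>2 eqz eqz' \<longrightarrow>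
       equal_functors (BrBialg M) (Br M')
         (P_Br M' eqz' \<circ>\<^sub>F BrBialg_map M' F \<phi>\<^sub>0 \<phi>\<^sub>2) (Br_map M' F \<phi>\<^sub>2 \<circ>\<^sub>F P_Br M eqz) \<and>
       (\<forall>A\<in>Obj (BrBialg M).
          xi M' eqz' (on_obj (BrBialg_map M' F \<phi>\<^sub>0 \<phi>\<^sub>2) A) = on_arr (Br_map M' F \<phi>\<^sub>2) (xi M eqz A))) \<and>
     (\<exists>\<theta>. natural_isomorphism (BrBialg M) (Br M')
           (P_Br M' eqz' \<circ>\<^sub>F BrBialg_map M' F \<phi>\<^sub>0 \<phi>\<^sub>2) (Br_map M' F \<phi>\<^sub>2 \<circ>\<^sub>F P_Br M eqz) \<theta> \<and>
         (\<forall>A\<in>Obj (BrBialg M).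
            on_arr (Br_map M' F \<phi>\<^sub>2) (xi M eqz A) \<cdot>\<^bsub>Br M'\<^esub> \<theta> A
              = xi M' eqz' (on_obj (BrBialg_map M' F \<phi>\<^sub>0 \<phi>\<^sub>2) A)))"
proof -
  interpret braided_primitives_functor M M' F \<phi>\<^sub>0 \<phi>\<^sub>2 eqz eqz'
    using assms by (intro braided_primitives_functor.intro additive_monoidal_functor.intro
      additive_monoidal_functor_axioms.intro braided_primitives.intro braided_primitives_axioms.intro
      braided_primitives_functor_axioms.intro)
  \<comment> \<open>The witness for \<open>\<theta>\<close> is the family of
    \<open>comparison\<close> arrows, equipped with source and target as arrows of
    \<open>Br M'\<close>.\<close>
  show ?thesis
    using compatible_equal_functors compatible_xi natural_isomorphism_comparison xi_comparison by blast
qed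

end
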